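(* Let $T$ be a (not necessarily complete) theory of fields in a language $L\supseteq L_{\mathrm{rings}}$. If $T$ has quantifier elimination, then $\mathrm{ACF}_T^{f}$ has quantifier elimination (in the language $L^f$).
   Context: $L_{\mathrm{rings}}$ is the language of rings. A theory of fields is a theory in a language $L\supseteq L_{\mathrm{rings}}$ which contains all the field axioms. $\mathrm{ACF}$ is the theory of algebraically closed fields. The theory $\mathrm{ACF}_T$: let $L^P=L\cup\{P\}$ with $P$ a unary predicate. $\mathrm{ACF}_T$ is the $L^P$-theory consisting of $\mathrm{ACF}$ (for the $L_{\mathrm{rings}}$-reduct of the universe) together with: (1) $P$ is a subfield of the universe; (2) $P$ (with the induced $L$-structure) is a model of $T$; (3) for every $n$-ary function symbol $f\in L\setminus L_{\mathrm{rings}}$: if $x_0,\dots,x_{n-1}\in P$ then $f(x_0,\dots,x_{n-1})\in P$, and if some $x_i\notin P$ then $f(x_0,\dots,x_{n-1})=0$; (4) for every $n$-ary relation symbol $R\in L$, if some $x_i\notin P$ then $\lnot R(x_0,\dots,x_{n-1})$; (5) the degree of the field extension of the universe over $P$ is infinite. Definable expansions: for $n\ge 1$, $l_n(x_0,\dots,x_{n-1})$ holds iff $x_0,\dots,x_{n-1}$ are linearly independent over $P$. For $n>i\ge 0$, $f_{n,i}$ is the $(n+1)$-ary function defined as follows: if $l_n(x_0,\dots,x_{n-1})$ and $\lnot l_{n+1}(x_0,\dots,x_n)$ hold, there are unique $y_0,\dots,y_{n-1}\in P$ with $x_n=y_0x_0+\dots+y_{n-1}x_{n-1}$, and $f_{n,i}(x_n;x_0,\dots,x_{n-1})=y_i$;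 otherwise $f_{n,i}(x_n;x_0,\dots,x_{n-1})=0$. $\mathrm{ACF}_T^{ld}$ is the expansion of $\mathrm{ACF}_T$ to $L^{ld}=L^P\cup\{l_n\}_{n\ge 1}$ by these definitions of $l_n$, and $\mathrm{ACF}_T^f$ is the expansion of $\mathrm{ACF}_T^{ld}$ to $L^f=L^{ld}\cup\{f_{n,i}\}_{n>i\ge 0}$ by these definitions of $f_{n,i}$. *)

theory Defs
  imports Main
begin

section \<open>First-order logic with equality\<close>

record ('f, 'r) language =
  funs :: "'f set"
  rels :: "'r set"
  farity :: "'f \<Rightarrow> nat"
  rarity :: "'r \<Rightarrow> nat"

text \<open>Constants are function symbols of arity \<open>0\<close>. Raw terms and formulas ignore the arities;
  \<open>is_tm\<close> and \<open>is_fm\<close> below single out those of a given language.\<close>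

datatype 'f tm = Var nat | Fun 'f "'f tm list"

datatype ('f, 'r) fm =
    Falsum
  | Eq "'f tm" "'f tm"
  | Rel 'r "'f tm list"
  | Neg "('f, 'r) fm"
  | Conj "('f, 'r) fm" "('f, 'r) fm"
  | Exists nat "('f, 'r) fm"

abbreviation Imp :: "('f, 'r) fm \<Rightarrow> ('f, 'r) fm \<Rightarrow> ('f, 'r) fm"
  where "Imp \<phi> \<psi> \<equiv> Neg (Conj \<phi> (Neg \<psi>))"

abbreviation Iff :: "('f, 'r) fm \<Rightarrow> ('f, 'r) fm \<Rightarrow> ('f, 'r) fm"
  where "Iff \<phi> \<psi> \<equiv> Conj (Imp \<phi> \<psi>) (Imp \<psi> \<phi>)"

abbreviation Forall :: "nat \<Rightarrow> ('f, 'r) fm \<Rightarrow> ('f, 'r) fm"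
  where "Forall x \<phi> \<equiv> Neg (Exists x (Neg \<phi>))"

definition Conjs :: "('f, 'r) fm list \<Rightarrow> ('f, 'r) fm"
  where "Conjs \<phi>s = foldr Conj \<phi>s (Neg Falsum)"

definition Foralls :: "nat list \<Rightarrow> ('f, 'r) fm \<Rightarrow> ('f, 'r) fm"
  where "Foralls xs \<phi> = foldr Forall xs \<phi>"

definition Existss :: "nat list \<Rightarrow> ('f, 'r) fm \<Rightarrow> ('f, 'r) fm"
  where "Existss xs \<phi> = foldr Exists xs \<phi>"

primrec fv_tm :: "'f tm \<Rightarrow> nat set" where
  "fv_tm (Var x) = {x}"
| "fv_tm (Fun f ts) = \<Union> (set (map fv_tm ts))"

primrec fv :: "('f, 'r) fm \<Rightarrow> nat set" where
  "fv Falsum = {}"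
| "fv (Eq s t) = fv_tm s \<union> fv_tm t"
| "fv (Rel r ts) = \<Union> (fv_tm ` set ts)"
| "fv (Neg \<phi>) = fv \<phi>"
| "fv (Conj \<phi> \<psi>) = fv \<phi> \<union> fv \<psi>"
| "fv (Exists x \<phi>) = fv \<phi> - {x}"

primrec qfree :: "('f, 'r) fm \<Rightarrow> bool" where
  "qfree Falsum = True"
| "qfree (Eq s t) = True"
| "qfree (Rel r ts) = True"
| "qfree (Neg \<phi>) = qfree \<phi>"
| "qfree (Conj \<phi> \<psi>) = (qfree \<phi> \<and> qfree \<psi>)"
| "qfree (Exists x \<phi>) = False"

primrec is_tm :: "('f, 'r) language \<Rightarrow> 'f tm \<Rightarrow> bool" where
  "is_tm L (Var x) = True"
| "is_tm L (Fun f ts) = (f \<in> funs L \<and> length ts = farity L f \<and> list_all (is_tm L) ts)"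

primrec is_fm :: "('f, 'r) language \<Rightarrow> ('f, 'r) fm \<Rightarrow> bool" where
  "is_fm L Falsum = True"
| "is_fm L (Eq s t) = (is_tm L s \<and> is_tm L t)"
| "is_fm L (Rel r ts) = (r \<in> rels L \<and> length ts = rarity L r \<and> list_all (is_tm L) ts)"
| "is_fm L (Neg \<phi>) = is_fm L \<phi>"
| "is_fm L (Conj \<phi> \<psi>) = (is_fm L \<phi> \<and> is_fm L \<psi>)"
| "is_fm L (Exists x \<phi>) = is_fm L \<phi>"

definition is_theory :: "('f, 'r) language \<Rightarrow> ('f, 'r) fm set \<Rightarrow> bool"
  where "is_theory L T \<longleftrightarrow> (\<forall>\<theta>\<in>T. is_fm L \<theta> \<and> fv \<theta> = {})"

record ('f, 'r, 'm) fo_structure =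
  universe :: "'m set"
  fint :: "'f \<Rightarrow> 'm list \<Rightarrow> 'm"
  rint :: "'r \<Rightarrow> 'm list \<Rightarrow> bool"

definition is_structure :: "('f, 'r) language \<Rightarrow> ('f, 'r, 'm) fo_structure \<Rightarrow> bool"
  where "is_structure L M \<longleftrightarrow> universe M \<noteq> {} \<and>
    (\<forall>f\<in>funs L. \<forall>as. length as = farity L f \<longrightarrow> set as \<subseteq> universe M \<longrightarrow> fint M f as \<in> universe M)"

primrec eval :: "('f, 'r, 'm) fo_structure \<Rightarrow> (nat \<Rightarrow> 'm) \<Rightarrow> 'f tm \<Rightarrow> 'm" where
  "eval M e (Var x) = e x"
| "eval M e (Fun f ts) = fint M f (map (eval M e) ts)"

primrec sat :: "('f, 'r, 'm) fo_structure \<Rightarrow> (nat \<Rightarrow> 'm) \<Rightarrow> ('f, 'r) fm \<Rightarrow> bool" where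
  "sat M e Falsum = False"
| "sat M e (Eq s t) = (eval M e s = eval M e t)"
| "sat M e (Rel r ts) = rint M r (map (eval M e) ts)"
| "sat M e (Neg \<phi>) = (\<not> sat M e \<phi>)"
| "sat M e (Conj \<phi> \<psi>) = (sat M e \<phi> \<and> sat M e \<psi>)"
| "sat M e (Exists x \<phi>) = (\<exists>a\<in>universe M. sat M (e(x := a)) \<phi>)"

definition valid :: "('f, 'r, 'm) fo_structure \<Rightarrow> ('f, 'r) fm \<Rightarrow> bool"
  where "valid M \<phi> \<longleftrightarrow> (\<forall>e. range e \<subseteq> universe M \<longrightarrow> sat M e \<phi>)"

definition is_model ::
    "('f, 'r) language \<Rightarrow> ('f, 'r) fm set \<Rightarrow> ('f, 'r, 'm) fo_structure \<Rightarrow> bool"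
  where "is_model L T M \<longleftrightarrow> is_structure L M \<and> (\<forall>\<theta>\<in>T. valid M \<theta>)"

text \<open>A definition cannot quantify over all types, so the models below have as universe an arbitrary
  nonempty set of formulas. By the downward Loewenheim-Skolem theorem this is no restriction: there
  are at least as many formulas as there are symbols, and infinitely many. Theorem
  \<open>entails_all_models\<close> shows that a consequence in this sense holds in all models, over any type.\<close>

definition entails :: "('f, 'r) language \<Rightarrow> ('f, 'r) fm set \<Rightarrow> ('f, 'r) fm \<Rightarrow> bool"
  where "entails L T \<phi> \<longleftrightarrow>
    (\<forall>M :: ('f, 'r, ('f, 'r) fm) fo_structure. is_model L T M \<longrightarrow> valid M \<phi>)"

definition has_qe :: "('f, 'r) language \<Rightarrow> ('f, 'r) fm set \<Rightarrow> bool"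
  where "has_qe L T \<longleftrightarrow>
    (\<forall>\<phi>. is_fm L \<phi> \<longrightarrow>
      (\<exists>\<psi>. is_fm L \<psi> \<and> qfree \<psi> \<and> fv \<psi> \<subseteq> fv \<phi> \<and> entails L T (Iff \<phi> \<psi>)))"


subsection \<open>Independence of the universe type\<close>

lemma eval_cong: "(\<And>x. x \<in> fv_tm t \<Longrightarrow> d x = e x) \<Longrightarrow> eval M d t = eval M e t"
  proof (induction t)
  case (Fun f ts)
  then have "map (eval M d) ts = map (eval M e) ts" by auto
  then show ?case by (simp only: eval.simps)
qed simp

lemma sat_cong: "(\<And>x. x \<in> fv \<phi> \<Longrightarrow> d x = e x) \<Longrightarrow> sat M d \<phi> = sat M e \<phi>"
proof (induction \<phi> arbitrary: d e)
  case (Eq s t)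
  then show ?case using eval_cong[of s d e M] eval_cong[of t d e M] by auto
next
  case (Rel r ts)
  then have "map (eval M d) ts = map (eval M e) ts"
    by (intro map_cong refl eval_cong) auto
  then show ?case by (simp only: sat.simps)
next
  case (Neg \<phi>)
  have "sat M d \<phi> = sat M e \<phi>" by (rule Neg.IH) (use Neg.prems in simp)
  then show ?case by simp
next
  case (Conj \<phi> \<psi>)
  have "sat M d \<phi> = sat M e \<phi>" by (rule Conj.IH(1)) (use Conj.prems in simp)
  moreover have "sat M d \<psi> = sat M e \<psi>" by (rule Conj.IH(2)) (use Conj.prems in simp)
  ultimately show ?case by simp
next
  case (Exists x \<phi>)
  have "sat M (d(x := a)) \<phi> = sat M (e(x := a)) \<phi>" for a
    by (rule Exists.IH) (use Exists.prems in auto)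
  then show ?case by simp
qed simp

lemma finite_fv_tm: "finite (fv_tm t)"
  by (induction t) auto

lemma finite_fv: "finite (fv \<phi>)"
  by (induction \<phi>) (auto simp: finite_fv_tm)

datatype ('f, 'r) sk =
    SVar nat
  | SFun 'f "('f, 'r) sk list"
  | SWit nat "('f, 'r) fm" "('f, 'r) sk list"

primrec conj_list :: "('f, 'r) fm list \<Rightarrow> ('f, 'r) fm" where
  "conj_list [] = Falsum"
| "conj_list (\<phi> # \<phi>s) = Conj \<phi> (conj_list \<phi>s)"

lemma conj_list_inject: "conj_list xs = conj_list ys \<Longrightarrow> xs = ys"
proof (induction xs arbitrary: ys)
  case Nil
  then show ?case by (cases ys) auto
next
  case (Cons a xs)
  then show ?case by (cases ys) auto
qed

primrec sk_code :: "('f, 'r) sk \<Rightarrow> ('f, 'r) fm" where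
  "sk_code (SVar n) = Eq (Var n) (Var n)"
| "sk_code (SFun f ss) = Conj (Eq (Fun f []) (Fun f [])) (conj_list (map sk_code ss))"
| "sk_code (SWit x \<phi> ss) = Exists x (Conj \<phi> (conj_list (map sk_code ss)))"

lemma sk_code_inject: "sk_code s = sk_code t \<Longrightarrow> s = t"
proof (induction s arbitrary: t)
  case (SVar n)
  then show ?case by (cases t) auto
next
  case (SFun f ss)
  show ?case
  proof (cases t)
    case (SFun f' ss')
    with SFun.prems have eqs: "sk_code (SFun f ss) = sk_code t" by simp
    from eqs have "map sk_code ss = map sk_code ss'"
      unfolding SFun by (simp add: conj_list_inject)
    with SFun.IH have "ss = ss'" by (rule list.inj_map_strong)
    with eqs show ?thesis unfolding SFun by simp
  qed (use SFun.prems in simp_all)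
next
  case (SWit x \<phi> ss)
  show ?case
  proof (cases t)
    case (SWit x' \<phi>' ss')
    with SWit.prems have eqs: "sk_code (SWit x \<phi> ss) = sk_code t" by simp
    from eqs have "map sk_code ss = map sk_code ss'"
      unfolding SWit by (simp add: conj_list_inject)
    with SWit.IH have "ss = ss'" by (rule list.inj_map_strong)
    with eqs show ?thesis unfolding SWit by simp
  qed (use SWit.prems in simp_all)
qed

definition list_assign :: "'m \<Rightarrow> 'm list \<Rightarrow> nat \<Rightarrow> 'm"
  where "list_assign a as i = (if i < length as then as ! i else a)"

primrec sk_val :: "('f, 'r, 'm) fo_structure \<Rightarrow> (nat \<Rightarrow> 'm) \<Rightarrow> ('f, 'r) sk \<Rightarrow> 'm" where
  "sk_val M e (SVar n) = e n"
| "sk_val M e (SFun f ss) =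
    (if fint M f (map (sk_val M e) ss) \<in> universe M then fint M f (map (sk_val M e) ss) else e 0)"
| "sk_val M e (SWit x \<phi> ss) =
    (if \<exists>a\<in>universe M. sat M ((list_assign (e 0) (map (sk_val M e) ss))(x := a)) \<phi>
     then SOME a. a \<in> universe M \<and> sat M ((list_assign (e 0) (map (sk_val M e) ss))(x := a)) \<phi>
     else e 0)"

lemma sk_val_in_univ:
  assumes "range e \<subseteq> universe M"
  shows "sk_val M e s \<in> universe M"
proof (induction s)
  case (SWit x \<phi> ss)
  let ?P = "\<lambda>a. a \<in> universe M \<and> sat M ((list_assign (e 0) (map (sk_val M e) ss))(x := a)) \<phi>"
  show ?case
  proof (cases "\<exists>a. ?P a")
    case True
    then have "?P (SOME a. ?P a)" by (rule someI_ex)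
    with True show ?thesis by auto
  next
    case False
    then show ?thesis using assms by auto
  qed
qed (use assms in auto)

lemma sk_witness:
  assumes d: "range d \<subseteq> range (sk_val M e)"
    and a: "a \<in> universe M" "sat M (d(x := a)) \<phi>"
  shows "\<exists>b\<in>range (sk_val M e). sat M (d(x := b)) \<phi>"
proof -
  obtain N where N: "\<And>y. y \<in> fv \<phi> \<Longrightarrow> y < N"
    using finite_fv[of \<phi>] by (meson finite_nat_set_iff_bounded)
  define ss where "ss = map (\<lambda>i. inv (sk_val M e) (d i)) [0..<N]"
  have vals: "map (sk_val M e) ss = map d [0..<N]"
    unfolding ss_def using d by (auto intro!: f_inv_into_f)
  let ?c = "list_assign (e 0) (map (sk_val M e) ss)"
  have agree: "sat M (?c(x := b)) \<phi> = sat M (d(x := b)) \<phi>" for b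
    by (rule sat_cong) (auto simp: vals list_assign_def dest: N)
  let ?P = "\<lambda>b. b \<in> universe M \<and> sat M (?c(x := b)) \<phi>"
  have ex: "\<exists>b. ?P b" using a agree by blast
  then have "?P (SOME b. ?P b)" by (rule someI_ex)
  moreover have "sk_val M e (SWit x \<phi> ss) = (SOME b. ?P b)" using ex by auto
  ultimately show ?thesis using agree by (metis rangeI)
qed

theorem entails_all_models:
  fixes M :: "('f, 'r, 'm) fo_structure"
  assumes ent: "entails L T \<phi>" and T: "\<forall>\<theta>\<in>T. is_fm L \<theta>" and \<phi>: "is_fm L \<phi>"
    and M: "is_model L T M"
  shows "valid M \<phi>"
  unfolding valid_def
proof (intro allI impI)
  fix e :: "nat \<Rightarrow> 'm" assume e: "range e \<subseteq> universe M"
  define H where "H = range (sk_val M e)"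
  define g where "g = sk_code \<circ> inv (sk_val M e)"
  define h where "h = inv_into H g"
  define N where "N = \<lparr>universe = g ` H, fint = (\<lambda>f as. g (fint M f (map h as))),
    rint = (\<lambda>r as. rint M r (map h as))\<rparr>"
  have inj: "inj_on g H"
  proof (rule inj_onI)
    fix a b assume ab: "a \<in> H" "b \<in> H" "g a = g b"
    then have "inv (sk_val M e) a = inv (sk_val M e) b"
      unfolding g_def comp_def by (intro sk_code_inject)
    then show "a = b" using ab by (metis H_def f_inv_into_f)
  qed
  have hg: "h (g a) = a" if "a \<in> H" for a
    using inj that by (simp add: h_def)
  have hN: "h b \<in> H" if "b \<in> universe N" for b
    using that hg by (auto simp: N_def)
  have HM: "H \<subseteq> universe M" using sk_val_in_univ[OF e] by (auto simp: H_def)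
  have e_H: "e n \<in> H" for n
    using rangeI[of "sk_val M e" "SVar n"] by (simp add: H_def)
  have clos: "fint M f as \<in> H" if "f \<in> funs L" "length as = farity L f" "set as \<subseteq> H" for f as
  proof -
    define ss where "ss = map (inv (sk_val M e)) as"
    have "map (sk_val M e) ss = as"
      unfolding ss_def using that(3) by (auto simp: H_def f_inv_into_f intro!: map_idI)
    moreover have "fint M f as \<in> universe M"
      using that HM M by (auto simp: is_model_def is_structure_def)
    ultimately have "sk_val M e (SFun f ss) = fint M f as" by simp
    then show ?thesis by (metis H_def rangeI)
  qed
  have tm: "eval M (h \<circ> d) t \<in> H \<and> eval N d t = g (eval M (h \<circ> d) t)"
    if "is_tm L t" "range d \<subseteq> universe N" for d t
    using that
  proof (induction t)
    case (Var x)
    then have "d x \<in> g ` H" by (auto simp: N_def)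
    then show ?case using hg by auto
  next
    case (Fun f ts)
    then have IH: "\<And>t. t \<in> set ts \<Longrightarrow> eval M (h \<circ> d) t \<in> H \<and> eval N d t = g (eval M (h \<circ> d) t)"
      unfolding is_tm.simps list_all_iff by blast
    then have eq: "map h (map (eval N d) ts) = map (eval M (h \<circ> d)) ts"
      by (auto simp: hg)
    have "fint M f (map (eval M (h \<circ> d)) ts) \<in> H"
      using Fun.prems IH by (intro clos) auto
    moreover have "eval N d (Fun f ts) = g (fint M f (map h (map (eval N d) ts)))"
      by (simp add: N_def)
    ultimately show ?case by (simp only: eq eval.simps)
  qed
  have fm: "sat N d \<chi> \<longleftrightarrow> sat M (h \<circ> d) \<chi>" if "is_fm L \<chi>" "range d \<subseteq> universe N" for d \<chi>
    using that
  proof (induction \<chi> arbitrary: d)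
    case (Eq s t)
    then show ?case using tm[of s d] tm[of t d] inj
      by (simp add: inj_on_eq_iff o_def)
  next
    case (Rel r ts)
    have "map h (map (eval N d) ts) = map (eval M (h \<circ> d)) ts"
      using Rel.prems tm by (auto simp: list_all_iff hg)
    moreover have "sat N d (Rel r ts) = rint M r (map h (map (eval N d) ts))"
      by (simp add: N_def)
    ultimately show ?case by (simp only: sat.simps)
  next
    case (Exists x \<chi>)
    have upd: "h \<circ> d(x := g b) = (h \<circ> d)(x := b)" if "b \<in> H" for b
      using that hg by auto
    have IH: "sat N (d(x := g b)) \<chi> \<longleftrightarrow> sat M ((h \<circ> d)(x := b)) \<chi>" if "b \<in> H" for b
    proof -
      have "range (d(x := g b)) \<subseteq> universe N"
        using Exists.prems(2) that by (auto simp: N_def)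
      moreover have "is_fm L \<chi>" using Exists.prems(1) by simp
      ultimately have "sat N (d(x := g b)) \<chi> \<longleftrightarrow> sat M (h \<circ> d(x := g b)) \<chi>"
        by (intro Exists.IH)
      then show ?thesis unfolding upd[OF that] .
    qed
    have dH: "range (h \<circ> d) \<subseteq> range (sk_val M e)"
      using Exists.prems(2) hN by (auto simp: H_def)
    have "sat N d (Exists x \<chi>) \<longleftrightarrow> (\<exists>b\<in>H. sat N (d(x := g b)) \<chi>)"
      by (auto simp: N_def)
    also have "\<dots> \<longleftrightarrow> (\<exists>b\<in>H. sat M ((h \<circ> d)(x := b)) \<chi>)"
      using IH by blast
    also have "\<dots> \<longleftrightarrow> sat M (h \<circ> d) (Exists x \<chi>)"
      using sk_witness[OF dH, of _ x \<chi>] HM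
      unfolding sat.simps H_def by blast
    finally show ?case .
  qed auto
  have NT: "valid N \<theta>" if "\<theta> \<in> T" for \<theta>
    unfolding valid_def
  proof (intro allI impI)
    fix d :: "nat \<Rightarrow> ('f, 'r) fm" assume d: "range d \<subseteq> universe N"
    then have "range (h \<circ> d) \<subseteq> universe M" using hN HM by auto
    then have "sat M (h \<circ> d) \<theta>" using M that by (auto simp: is_model_def valid_def)
    then show "sat N d \<theta>" using fm[OF _ d] T that by blast
  qed
  have "is_structure L N"
    unfolding is_structure_def
  proof (intro conjI ballI allI impI)
    show "universe N \<noteq> {}" using e_H by (auto simp: N_def)
    fix f as assume f: "f \<in> funs L" "length as = farity L f" "set as \<subseteq> universe N"
    have "set (map h as) \<subseteq> H" using f(3) hN by auto
    then have "fint M f (map h as) \<in> H" using f by (intro clos) auto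
    then show "fint N f as \<in> universe N" by (auto simp: N_def)
  qed
  then have "is_model L T N" using NT by (simp add: is_model_def)
  then have "valid N \<phi>" using ent by (simp add: entails_def)
  moreover have r: "range (g \<circ> e) \<subseteq> universe N" using e_H by (auto simp: N_def)
  ultimately have "sat N (g \<circ> e) \<phi>" by (auto simp: valid_def)
  then have "sat M (h \<circ> (g \<circ> e)) \<phi>" using fm[OF \<phi> r] by blast
  moreover have "h \<circ> (g \<circ> e) = e" using hg e_H by auto
  ultimately show "sat M e \<phi>" by simp
qed


section \<open>Theories of fields\<close>

datatype ring_fun = RZero | ROne | RPlus | RMinus | RTimes

text \<open>Up to renaming of symbols, a language extending the language of rings
  \<open>{0, 1, +, -, \<cdot>}\<close> (with unary \<open>-\<close>) has function symbols \<open>Ring c\<close> and some symbols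
  \<open>Extra f\<close>, and arbitrary relation symbols.\<close>

datatype 'f rfun = Ring ring_fun | Extra 'f

fun ring_arity :: "ring_fun \<Rightarrow> nat" where
  "ring_arity RZero = 0"
| "ring_arity ROne = 0"
| "ring_arity RMinus = 1"
| "ring_arity RPlus = 2"
| "ring_arity RTimes = 2"

definition extends_L_rings :: "('f rfun, 'r) language \<Rightarrow> bool"
  where "extends_L_rings L \<longleftrightarrow> (\<forall>c. Ring c \<in> funs L \<and> farity L (Ring c) = ring_arity c)"

abbreviation zero_t :: "'f rfun tm"
  where "zero_t \<equiv> Fun (Ring RZero) []"

abbreviation one_t :: "'f rfun tm"
  where "one_t \<equiv> Fun (Ring ROne) []"

abbreviation minus_t :: "'f rfun tm \<Rightarrow> 'f rfun tm"
  where "minus_t s \<equiv> Fun (Ring RMinus) [s]"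

abbreviation plus_t :: "'f rfun tm \<Rightarrow> 'f rfun tm \<Rightarrow> 'f rfun tm"
  where "plus_t s t \<equiv> Fun (Ring RPlus) [s, t]"

abbreviation times_t :: "'f rfun tm \<Rightarrow> 'f rfun tm \<Rightarrow> 'f rfun tm"
  where "times_t s t \<equiv> Fun (Ring RTimes) [s, t]"

definition sum_t :: "'f rfun tm list \<Rightarrow> 'f rfun tm"
  where "sum_t ts = foldr plus_t ts zero_t"

definition power_t :: "'f rfun tm \<Rightarrow> nat \<Rightarrow> 'f rfun tm"
  where "power_t t n = (times_t t ^^ n) one_t"

definition field_axioms :: "('f rfun, 'r) fm set"
  where "field_axioms =
   (let x = Var 0; y = Var 1; z = Var 2 in
    {Foralls [0,1,2] (Eq (plus_t (plus_t x y) z) (plus_t x (plus_t y z))),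
     Foralls [0,1] (Eq (plus_t x y) (plus_t y x)),
     Foralls [0] (Eq (plus_t x zero_t) x),
     Foralls [0] (Eq (plus_t x (minus_t x)) zero_t),
     Foralls [0,1,2] (Eq (times_t (times_t x y) z) (times_t x (times_t y z))),
     Foralls [0,1] (Eq (times_t x y) (times_t y x)),
     Foralls [0] (Eq (times_t x one_t) x),
     Foralls [0,1,2] (Eq (times_t x (plus_t y z)) (plus_t (times_t x y) (times_t x z))),
     Neg (Eq zero_t one_t),
     Foralls [0] (Imp (Neg (Eq x zero_t)) (Exists 1 (Eq (times_t x y) one_t)))})"

text \<open>Containment of the field axioms is read modulo logical consequence, so that it does not
  depend on the axiomatization chosen above nor on \<open>T\<close> being deductively closed.\<close>

definition theory_of_fields :: "('f rfun, 'r) language \<Rightarrow> ('f rfun, 'r) fm set \<Rightarrow> bool"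
  where "theory_of_fields L T \<longleftrightarrow>
    extends_L_rings L \<and> is_theory L T \<and> (\<forall>\<theta>\<in>field_axioms. entails L T \<theta>)"

text \<open>Every monic polynomial of degree \<open>n \<ge> 1\<close> has a root; the variables \<open>0, \<dots>, n - 1\<close> are its lower
  coefficients and \<open>n\<close> is the root.\<close>

definition ACF :: "('f rfun, 'r) fm set"
  where "ACF = field_axioms \<union>
    {Foralls [0..<n] (Exists n
       (Eq (plus_t (power_t (Var n) n)
              (sum_t (map (\<lambda>i. times_t (Var i) (power_t (Var n) i)) [0..<n])))
           zero_t)) | n. n \<ge> 1}"


section \<open>Pairs of fields\<close>

text \<open>The symbols of \<open>L\<close> become \<open>OldF f\<close> and \<open>OldR r\<close>; \<open>InP\<close> is the predicate \<open>P\<close>, \<open>LinInd n\<close> is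
  \<open>l\<^sub>n\<close> and \<open>Coord n i\<close> is \<open>f\<^sub>n\<^sub>,\<^sub>i\<close>. The three languages differ only in which of these
  symbols they contain.\<close>

datatype 'f pfun = OldF 'f | Coord nat nat

datatype 'r prel = OldR 'r | InP | LinInd nat

primrec pfun_arity :: "('f \<Rightarrow> nat) \<Rightarrow> 'f pfun \<Rightarrow> nat" where
  "pfun_arity ar (OldF f) = ar f"
| "pfun_arity ar (Coord n i) = n + 1"

primrec prel_arity :: "('r \<Rightarrow> nat) \<Rightarrow> 'r prel \<Rightarrow> nat" where
  "prel_arity ar (OldR r) = ar r"
| "prel_arity ar InP = 1"
| "prel_arity ar (LinInd n) = n"

definition L_P :: "('f, 'r) language \<Rightarrow> ('f pfun, 'r prel) language"
  where "L_P L = \<lparr>funs = OldF ` funs L, rels = OldR ` rels L \<union> {InP},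
    farity = pfun_arity (farity L), rarity = prel_arity (rarity L)\<rparr>"

definition L_ld :: "('f, 'r) language \<Rightarrow> ('f pfun, 'r prel) language"
  where "L_ld L = (L_P L)\<lparr>rels := rels (L_P L) \<union> {LinInd n | n. n \<ge> 1}\<rparr>"

definition L_f :: "('f, 'r) language \<Rightarrow> ('f pfun, 'r prel) language"
  where "L_f L = (L_ld L)\<lparr>funs := funs (L_ld L) \<union> {Coord n i | n i. n > i}\<rparr>"

abbreviation old_t :: "'f tm \<Rightarrow> 'f pfun tm"
  where "old_t \<equiv> map_tm OldF"

abbreviation old_fm :: "('f, 'r) fm \<Rightarrow> ('f pfun, 'r prel) fm"
  where "old_fm \<equiv> map_fm OldF OldR"

abbreviation P_fm :: "'f pfun tm \<Rightarrow> ('f pfun, 'r prel) fm"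
  where "P_fm t \<equiv> Rel InP [t]"

primrec relativize :: "('f, 'r) fm \<Rightarrow> ('f pfun, 'r prel) fm" where
  "relativize Falsum = Falsum"
| "relativize (Eq s t) = Eq (old_t s) (old_t t)"
| "relativize (Rel r ts) = Rel (OldR r) (map old_t ts)"
| "relativize (Neg \<phi>) = Neg (relativize \<phi>)"
| "relativize (Conj \<phi> \<psi>) = Conj (relativize \<phi>) (relativize \<psi>)"
| "relativize (Exists x \<phi>) = Exists x (Conj (P_fm (Var x)) (relativize \<phi>))"

definition all_in_P :: "nat list \<Rightarrow> ('f pfun, 'r prel) fm"
  where "all_in_P xs = Conjs (map (\<lambda>x. P_fm (Var x)) xs)"

definition lincomb_t :: "nat list \<Rightarrow> nat list \<Rightarrow> 'f rfun pfun tm"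
  where "lincomb_t ys xs = old_t (sum_t (map2 (\<lambda>y x. times_t (Var y) (Var x)) ys xs))"

text \<open>\<open>lin_indep_fm n\<close> says that the variables \<open>0, \<dots>, n - 1\<close> are linearly independent over \<open>P\<close>.\<close>

definition lin_indep_fm :: "nat \<Rightarrow> ('f rfun pfun, 'r prel) fm"
  where "lin_indep_fm n =
    (let xs = [0..<n]; ys = [n..<2 * n] in
     Foralls ys (Imp (Conj (all_in_P ys) (Eq (lincomb_t ys xs) (old_t zero_t)))
                     (Conjs (map (\<lambda>y. Eq (Var y) (old_t zero_t)) ys))))"

definition subfield_axioms :: "('f rfun pfun, 'r prel) fm set"
  where "subfield_axioms =
   (let x = Var 0; y = Var 1 in
    {P_fm (old_t zero_t),
     P_fm (old_t one_t),
     Foralls [0,1] (Imp (all_in_P [0,1]) (P_fm (old_t (plus_t x y)))),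
     Foralls [0] (Imp (all_in_P [0]) (P_fm (old_t (minus_t x)))),
     Foralls [0,1] (Imp (all_in_P [0,1]) (P_fm (old_t (times_t x y)))),
     Foralls [0] (Imp (Conj (all_in_P [0]) (Neg (Eq (old_t x) (old_t zero_t))))
       (Exists 1 (Conj (P_fm (old_t y)) (Eq (old_t (times_t x y)) (old_t one_t)))))})"

definition extra_fun_axioms :: "('f rfun, 'r) language \<Rightarrow> ('f rfun pfun, 'r prel) fm set"
  where "extra_fun_axioms L =
    {let xs = [0..<farity L (Extra f)]; t = Fun (OldF (Extra f)) (map Var xs) in
     Foralls xs (Conj (Imp (all_in_P xs) (P_fm t))
                      (Imp (Neg (all_in_P xs)) (Eq t (old_t zero_t))))
     | f. Extra f \<in> funs L}"

definition rel_axioms :: "('f rfun, 'r) language \<Rightarrow> ('f rfun pfun, 'r prel) fm set"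
  where "rel_axioms L =
    {let xs = [0..<rarity L r] in
     Foralls xs (Imp (Neg (all_in_P xs)) (Neg (Rel (OldR r) (map Var xs))))
     | r. r \<in> rels L}"

definition infinite_degree_axioms :: "('f rfun pfun, 'r prel) fm set"
  where "infinite_degree_axioms = {Existss [0..<n] (lin_indep_fm n) | n. n \<ge> 1}"

definition ACF_T ::
    "('f rfun, 'r) language \<Rightarrow> ('f rfun, 'r) fm set \<Rightarrow> ('f rfun pfun, 'r prel) fm set"
  where "ACF_T L T = old_fm ` ACF \<union> subfield_axioms \<union> relativize ` T \<union>
    extra_fun_axioms L \<union> rel_axioms L \<union> infinite_degree_axioms"

definition ACF_T_ld ::
    "('f rfun, 'r) language \<Rightarrow> ('f rfun, 'r) fm set \<Rightarrow> ('f rfun pfun, 'r prel) fm set"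
  where "ACF_T_ld L T = ACF_T L T \<union>
    {Foralls [0..<n] (Iff (Rel (LinInd n) (map Var [0..<n])) (lin_indep_fm n)) | n. n \<ge> 1}"

text \<open>In the defining axiom of \<open>f\<^sub>n\<^sub>,\<^sub>i\<close>, the variables \<open>0, \<dots>, n\<close> stand for
  \<open>x\<^sub>0, \<dots>, x\<^sub>n\<close> and \<open>n + 1 + j\<close> for \<open>y\<^sub>j\<close>; the argument \<open>x\<^sub>n\<close> comes first.\<close>

definition coord_axiom :: "nat \<Rightarrow> nat \<Rightarrow> ('f rfun pfun, 'r prel) fm"
  where "coord_axiom n i =
    (let xs = [0..<n]; ys = [n + 1..<2 * n + 1];
         t = Fun (Coord n i) (map Var (n # xs));
         dep = Conj (Rel (LinInd n) (map Var xs))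
                    (Neg (Rel (LinInd (n + 1)) (map Var (xs @ [n]))))
     in Foralls (xs @ [n])
       (Conj (Imp dep (Existss ys (Conj (all_in_P ys)
                                (Conj (Eq (Var n) (lincomb_t ys xs)) (Eq t (Var (ys ! i)))))))
             (Imp (Neg dep) (Eq t (old_t zero_t)))))"

definition ACF_T_f ::
    "('f rfun, 'r) language \<Rightarrow> ('f rfun, 'r) fm set \<Rightarrow> ('f rfun pfun, 'r prel) fm set"
  where "ACF_T_f L T = ACF_T_ld L T \<union> {coord_axiom n i | n i. n > i}"

end

theory Submission
  imports "HOL-Algebra.Algebraic_Closure" Defs
begin

text \<open>
  A formula whose quantifiers range over the subfield \<open>P\<close> depends on elements \<open>e\<close> of the universe only
  through the \<open>P\<close>-linear relations between finitely many monomials in \<open>e\<close>. Choosing a basis among these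
  monomials (with \<open>l\<^sub>n\<close>) and taking coordinates (with \<open>f\<^sub>n\<^sub>,\<^sub>i\<close>) turns it into an \<open>L\<close>-formula about
  elements of \<open>P\<close>, which is quantifier-free modulo \<open>T\<close>.

  It remains to eliminate a quantifier \<open>\<exists>x\<close> over the universe, and by the same normal form it is enough
  to express, with quantifiers over \<open>P\<close> only, that some \<open>x\<close> satisfies polynomial equations
  \<open>h\<^sub>k(x) = 0\<close> while certain \<open>m\<^sub>1(x), \<dots>, m\<^sub>r(x)\<close> are linearly independent over \<open>P\<close>. If some \<open>h\<^sub>k\<close> is
  nonzero, there are at most \<open>D\<close> common roots, so that failure means: there are nonzero tuples
  \<open>u\<^sub>1, \<dots>, u\<^sub>D\<close> in \<open>P\<close> such that every common root is a zero of
  \<open>\<Prod>\<^sub>j (\<Sum>\<^sub>i u\<^sub>j\<^sub>i m\<^sub>i(x))\<close>; the inner statement is one about algebraically closed fields and is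
  quantifier-free by pseudo-division. If all \<open>h\<^sub>k\<close> vanish, one needs an \<open>x\<close> that is not a root of any
  nonzero polynomial of bounded degree over a given finite-dimensional \<open>P\<close>-subspace. Otherwise the
  universe would have bounded degree over a finitely generated extension of \<open>P\<close>, hence over \<open>P\<close>, as
  \<open>w\<close> transcendental over \<open>F\<close> has roots of arbitrarily large degree over \<open>F(w)\<close>, and then finite
  degree by the primitive element theorem.
\<close>

section \<open>Linear independence, derivatives and simple roots\<close>

text \<open>All definitions must be uniform in the models: neither the characteristic nor the
  vanishing of a coefficient is known in advance. Polynomials are therefore unsimplified lists of
  terms, degrees are replaced by syntactic bounds, and the vanishing of a leading coefficient
  becomes a case inside the defining formula. Independence at a root is itself a statement with
  quantifiers over P, so taken literally it would put these below the quantifier over the universe.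
  A failure supplies one relation for each root. With boundedly many roots the relations can be
  chosen before the root, and their product turns "one of them holds here" into a single equation.
  If all equations are trivial there are infinitely many candidates for x, and a generic one takes
  the place of this count. The primitive element argument needs separability. In positive
  characteristic it is applied not to x but to some y^q, where y^(D!) = x and q \<le> D; as q
  divides D!, x is again a power of y^q.\<close>

text \<open>HOL-Algebra builds \<open>independent\<close> inductively, one vector outside the span
  at a time, while \<open>lin_indep_fm\<close> speaks of vanishing combinations. Inclusion in
  \<open>{\<zero>}\<close> instead of equality covers the empty list.\<close>

lemma (in ring) independent_iff_combine:
  assumes K: "subfield K R" and U: "set Us \<subseteq> carrier R"
  shows "independent K Us \<longleftrightarrow>
    (\<forall>Ks. length Ks = length Us \<longrightarrow> set Ks \<subseteq> K \<longrightarrow> combine Ks Us = \<zero> \<longrightarrow> set Ks \<subseteq> {\<zero>})" (is "_ \<longleftrightarrow> ?B")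
proof
  assume B: ?B
  show "independent K Us"
  proof (rule ccontr)
    assume dep: "\<not> ?thesis"
    then obtain Ks where Ks: "length Ks = length Us" "combine Ks Us = \<zero>" "set Ks \<subseteq> K" "set Ks \<noteq> {\<zero>}"
      using dependent_imp_non_trivial_combine[OF K U] by metis
    then have "set Ks \<subseteq> {\<zero>}" using B by simp
    then have "Ks = []" using Ks(4) by (cases Ks) auto
    then have "Us = []" using Ks(1) by simp
    then show False using dep by simp
  qed
next
  assume ind: "independent K Us"
  show ?B
  proof (intro allI impI)
    fix Ks assume Ks: "length Ks = length Us" "set Ks \<subseteq> K" "combine Ks Us = \<zero>"
    then show "set Ks \<subseteq> {\<zero>}"
      using independent_imp_trivial_combine[OF K ind Ks(2,3)] by simp
  qed
qed

section \<open>Formal derivatives of coefficient lists\<close>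

context ring
begin

declare poly_add.simps [simp del] poly_mult.simps [simp del]

lemma eval_zero_list:
  assumes "set p \<subseteq> {\<zero>}" "x \<in> carrier R"
  shows "eval p x = \<zero>"
  using assms by (induction p) auto

lemma normalize_eq_Nil_iff: "normalize p = [] \<longleftrightarrow> set p \<subseteq> {\<zero>}"
  by (induction p) auto

text \<open>The value of the formal derivative. Lists start with the leading coefficient, so
  \<open>a\<close> has degree \<open>length p\<close>; for empty \<open>p\<close> the truncated
  exponent is harmless because the factor \<open>[0] \<cdot> a\<close> vanishes.\<close>

fun deriv_eval :: "'a list \<Rightarrow> 'a \<Rightarrow> 'a" where
  "deriv_eval [] x = \<zero>"
| "deriv_eval (a # p) x = ([length p] \<cdot> a) \<otimes> x [^] (length p - 1) \<oplus> deriv_eval p x"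

text \<open>The derivative as a list, to be played off against the minimal polynomial. It is not
  normalized: in positive characteristic leading entries may vanish.\<close>

definition deriv_list :: "'a list \<Rightarrow> 'a list"
  where "deriv_list p = map (\<lambda>i. [i] \<cdot> coeff p i) (rev [1..<length p])"

lemma deriv_eval_closed:
  "set p \<subseteq> carrier R \<Longrightarrow> x \<in> carrier R \<Longrightarrow> deriv_eval p x \<in> carrier R"
  by (induction p) auto

lemma deriv_list_Cons:
  "deriv_list (a # p) = (if p = [] then [] else ([length p] \<cdot> a) # deriv_list p)"
proof (cases p)
  case (Cons b q)
  have "rev [1..<length (a # p)] = length p # rev [1..<length p]"
    using Cons by simp
  moreover have "map (\<lambda>i. [i] \<cdot> coeff (a # p) i) (rev [1..<length p]) =
      map (\<lambda>i. [i] \<cdot> coeff p i) (rev [1..<length p])"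
    by (rule map_cong) auto
  ultimately show ?thesis using Cons unfolding deriv_list_def by simp
qed (simp add: deriv_list_def)

lemma eval_deriv_list:
  assumes "set p \<subseteq> carrier R" "x \<in> carrier R"
  shows "eval (deriv_list p) x = deriv_eval p x"
  using assms
proof (induction p)
  case Nil
  then show ?case by (simp add: deriv_list_def)
next
  case (Cons a p)
  have [simp]: "length (deriv_list p) = length p - 1" by (simp add: deriv_list_def)
  show ?case
  proof (cases "p = []")
    case True
    then show ?thesis using Cons.prems by (simp add: deriv_list_Cons)
  next
    case False
    then show ?thesis using Cons by (simp add: deriv_list_Cons)
  qed
qed

end

context cring
begin

text \<open>Appending a coefficient passes from p to p X + b, so this is the product rule; it
  permits induction from the right end of the list.\<close>

lemma deriv_eval_snoc:
  assumes "set p \<subseteq> carrier R" "b \<in> carrier R" "x \<in> carrier R"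
  shows "deriv_eval (p @ [b]) x = deriv_eval p x \<otimes> x \<oplus> eval p x"
  using assms
proof (induction p)
  case (Cons a p)
  have c: "a \<in> carrier R" "set p \<subseteq> carrier R" "eval p x \<in> carrier R" "deriv_eval p x \<in> carrier R"
    using Cons.prems by (auto intro: eval_in_carrier deriv_eval_closed)
  have IH: "deriv_eval (p @ [b]) x = deriv_eval p x \<otimes> x \<oplus> eval p x"
    using Cons c by blast
  have step: "([Suc (length p)] \<cdot> a) \<otimes> x [^] length p =
      (([length p] \<cdot> a) \<otimes> x [^] (length p - 1)) \<otimes> x \<oplus> a \<otimes> x [^] length p"
  proof (cases "length p")
    case 0
    then show ?thesis using c Cons.prems by simp
  next
    case (Suc n)
    have "(([Suc n] \<cdot> a) \<oplus> a) \<otimes> (x [^] n \<otimes> x) = (([Suc n] \<cdot> a) \<otimes> x [^] n) \<otimes> x \<oplus> a \<otimes> (x [^] n \<otimes> x)"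
      if "[Suc n] \<cdot> a \<in> carrier R" "x [^] n \<in> carrier R"
      using that c Cons.prems(3) by algebra
    then show ?thesis using Suc c Cons.prems by simp
  qed
  have "deriv_eval ((a # p) @ [b]) x =
      ((([length p] \<cdot> a) \<otimes> x [^] (length p - 1)) \<otimes> x \<oplus> a \<otimes> x [^] length p) \<oplus>
      (deriv_eval p x \<otimes> x \<oplus> eval p x)"
    using IH step by (simp del: add.nat_pow_Suc)
  also have "\<dots> = deriv_eval (a # p) x \<otimes> x \<oplus> eval (a # p) x"
    using c Cons.prems by (simp add: l_distr a_ac)
  finally show ?case .
qed simp

text \<open>The quotient (p(X) - p(y)) / (X - y) is a polynomial whose value at y is the derivative.
  Passing from p to p X + b replaces s by s X + p(y), which is the witness in the induction.\<close>

lemma eval_difference_quotient: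
  assumes "set p \<subseteq> carrier R" "y \<in> carrier R"
  shows "\<exists>s. set s \<subseteq> carrier R \<and> eval s y = deriv_eval p y \<and>
    (\<forall>x\<in>carrier R. eval p x \<ominus> eval p y = (x \<ominus> y) \<otimes> eval s x)"
  using assms(1)
proof (induction p rule: rev_induct)
  case Nil
  show ?case using assms(2) by (intro exI[of _ "[]"]) (simp add: minus_eq)
next
  case (snoc b p)
  then obtain s where s: "set s \<subseteq> carrier R" "eval s y = deriv_eval p y"
    "\<forall>x\<in>carrier R. eval p x \<ominus> eval p y = (x \<ominus> y) \<otimes> eval s x" by auto
  have c: "b \<in> carrier R" "set p \<subseteq> carrier R" "eval p y \<in> carrier R"
    using snoc.prems assms(2) by (auto intro: eval_in_carrier)
  show ?case
  proof (intro exI[of _ "s @ [eval p y]"] conjI ballI)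
    show "set (s @ [eval p y]) \<subseteq> carrier R" using s c by auto
    show "eval (s @ [eval p y]) y = deriv_eval (p @ [b]) y"
      using s c assms(2) by (simp add: eval_append_aux deriv_eval_snoc)
    fix x assume x: "x \<in> carrier R"
    have cx: "eval p x \<in> carrier R" "eval s x \<in> carrier R"
      using x c s by (auto intro: eval_in_carrier)
    have "eval (p @ [b]) x \<ominus> eval (p @ [b]) y = (eval p x \<otimes> x \<oplus> b) \<ominus> (eval p y \<otimes> y \<oplus> b)"
      using c x assms(2) by (simp add: eval_append_aux)
    also have "\<dots> = (eval p x \<ominus> eval p y) \<otimes> x \<oplus> (x \<ominus> y) \<otimes> eval p y"
      using c cx x assms(2) by algebra
    also have "\<dots> = ((x \<ominus> y) \<otimes> eval s x) \<otimes> x \<oplus> (x \<ominus> y) \<otimes> eval p y"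
      using s x by simp
    also have "\<dots> = (x \<ominus> y) \<otimes> (eval s x \<otimes> x \<oplus> eval p y)"
      using c cx x assms(2) by algebra
    finally show "eval (p @ [b]) x \<ominus> eval (p @ [b]) y = (x \<ominus> y) \<otimes> eval (s @ [eval p y]) x"
      using c s x by (simp add: eval_append_aux)
  qed
qed

end

section \<open>Roots of raw coefficient lists\<close>

context domain
begin

text \<open>Most arguments use raw lists, possibly with leading zeros; this passes to the elements
  of K[X] that minimal polynomials are compared with.\<close>

lemma poly_root_subring:
  assumes "subring K R" "set p \<subseteq> K" "\<not> set p \<subseteq> {\<zero>}" "x \<in> carrier R" "eval p x = \<zero>"
  shows "normalize p \<in> carrier (K[X])" "normalize p \<noteq> []" "eval (normalize p) x = \<zero>"
  using assms normalize_gives_polynomial[OF assms(2)] subringE(1)[OF assms(1)]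
  by (auto simp: normalize_eq_Nil_iff univ_poly_carrier[symmetric] eval_normalize)

lemma finite_roots_list:
  assumes "set p \<subseteq> carrier R" "\<not> set p \<subseteq> {\<zero>}"
  shows "finite {x \<in> carrier R. eval p x = \<zero>}"
proof -
  have n: "normalize p \<in> carrier (poly_ring R)" "normalize p \<noteq> []"
    using normalize_gives_polynomial[OF assms(1)] assms(2)
    by (auto simp: normalize_eq_Nil_iff univ_poly_carrier[symmetric])
  have "{x \<in> carrier R. eval p x = \<zero>} \<subseteq> {x. is_root (normalize p) x}"
    using n assms by (auto simp: is_root_def eval_normalize)
  then show ?thesis using finite_number_of_roots[OF n(1)] finite_subset by blast
qed

text \<open>Horner's scheme with a + b X in place of the variable. It serves to form f(\<gamma> - c
  X), which shares the root \<beta> with g in the primitive element argument.\<close>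

lemma affine_substitution:
  assumes K: "subring K R" and p: "set p \<subseteq> K" and ab: "a \<in> K" "b \<in> K"
  shows "\<exists>q\<in>carrier (K[X]). \<forall>x\<in>carrier R. eval q x = eval p (a \<oplus> b \<otimes> x)"
  using p
proof (induction p rule: rev_induct)
  case Nil
  have "[] \<in> carrier (K[X])" by (simp add: univ_poly_carrier[symmetric] polynomial_def)
  then show ?case by (intro bexI[of _ "[]"]) auto
next
  case (snoc c p)
  note KR = subringE(1)[OF K]
  obtain q where q: "q \<in> carrier (K[X])" "\<forall>x\<in>carrier R. eval q x = eval p (a \<oplus> b \<otimes> x)"
    using snoc by auto
  have qK: "set q \<subseteq> K" using q(1) by (auto simp: univ_poly_carrier[symmetric] polynomial_def)
  define l where "l = normalize [b, a]"
  define m where "m = normalize [c]"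
  have lm: "l \<in> carrier (K[X])" "m \<in> carrier (K[X])"
    using normalize_gives_polynomial[of _ K] ab snoc.prems
    by (auto simp: l_def m_def univ_poly_carrier[symmetric] simp del: normalize.simps)
  have lmR: "set l \<subseteq> carrier R" "set m \<subseteq> carrier R" "set q \<subseteq> carrier R"
    using lm qK KR by (auto simp: univ_poly_carrier[symmetric] polynomial_def)
  define r where "r = poly_add (poly_mult q l) m"
  have "r \<in> carrier (K[X])"
    using q lm ring.ring_simprules(1,5)[OF univ_poly_is_ring[OF K]]
    unfolding r_def univ_poly_add[of R K, symmetric] univ_poly_mult[of R K, symmetric] by metis
  moreover have "eval r x = eval (p @ [c]) (a \<oplus> b \<otimes> x)" if x: "x \<in> carrier R" for x
  proof -
    have "eval l x = a \<oplus> b \<otimes> x" "eval m x = c"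
      using x ab snoc.prems KR unfolding l_def m_def
      by (auto simp: eval_normalize a_comm subset_iff simp del: normalize.simps)
    moreover have "a \<oplus> b \<otimes> x \<in> carrier R" using x ab KR by auto
    moreover have "set p \<subseteq> carrier R" "c \<in> carrier R" using snoc.prems KR by auto
    ultimately show ?thesis using q(2) x lmR poly_mult_in_carrier[of q l]
      unfolding r_def by (simp add: eval_poly_add eval_poly_mult eval_append_aux del: poly_add.simps poly_mult.simps)
  qed
  ultimately show ?case by blast
qed

text \<open>If p = (X - y)^2 q, the difference quotient s agrees with (X - y) q away from y. In an
  infinite domain they then agree at y too, where one side is the derivative of p and the other is
  zero.\<close>

lemma double_root_deriv_eval:
  assumes p: "p \<in> carrier (poly_ring R)" and y: "y \<in> carrier R"
    and dvd: "([\<one>, \<ominus> y] [^]\<^bsub>poly_ring R\<^esub> (2::nat)) pdivides p"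
    and inf: "infinite (carrier R)"
  shows "deriv_eval p y = \<zero>"
proof -
  let ?P = "poly_ring R"
  interpret P: domain ?P using univ_poly_is_domain[OF carrier_is_subring] .
  have l: "[\<one>, \<ominus> y] \<in> carrier ?P"
    using y by (auto simp: univ_poly_carrier[symmetric] polynomial_def)
  obtain q where q: "q \<in> carrier ?P" "p = ([\<one>, \<ominus> y] [^]\<^bsub>?P\<^esub> (2::nat)) \<otimes>\<^bsub>?P\<^esub> q"
    using dvd unfolding pdivides_def factor_def by blast
  have car: "set p \<subseteq> carrier R" "set q \<subseteq> carrier R" "set [\<one>, \<ominus> y] \<subseteq> carrier R"
    using p q l by (auto simp: univ_poly_carrier[symmetric] polynomial_def)
  have hom: "eval (f \<otimes>\<^bsub>?P\<^esub> g) x = eval f x \<otimes> eval g x"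
    if "f \<in> carrier ?P" "g \<in> carrier ?P" "x \<in> carrier R" for f g x
    using ring_hom_mult[OF eval_is_hom[OF carrier_is_subring that(3)] that(1,2)] .
  have ev: "eval p x = ((x \<ominus> y) \<otimes> (x \<ominus> y)) \<otimes> eval q x" if x: "x \<in> carrier R" for x
  proof -
    have "eval [\<one>, \<ominus> y] x = x \<ominus> y" using x y by (simp add: minus_eq)
    then show ?thesis unfolding q(2) using l q x
      by (simp add: hom numeral_2_eq_2)
  qed
  obtain s where s: "set s \<subseteq> carrier R" "eval s y = deriv_eval p y"
    "\<forall>x\<in>carrier R. eval p x \<ominus> eval p y = (x \<ominus> y) \<otimes> eval s x"
    using eval_difference_quotient[OF car(1) y] by blast
  have py: "eval p y = \<zero>" using ev[OF y] y car eval_in_carrier by (simp add: minus_eq r_neg)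
  have s_eq: "eval s x = (x \<ominus> y) \<otimes> eval q x" if x: "x \<in> carrier R" "x \<noteq> y" for x
  proof -
    have c: "eval s x \<in> carrier R" "eval q x \<in> carrier R" "eval p x \<in> carrier R"
      using s car x eval_in_carrier by auto
    have "(x \<ominus> y) \<otimes> eval s x = (x \<ominus> y) \<otimes> ((x \<ominus> y) \<otimes> eval q x)"
      using bspec[OF s(3) x(1)] ev[OF x(1)] x y c py by (simp add: m_assoc minus_eq)
    moreover have "x \<ominus> y \<noteq> \<zero>" using x y by (simp add: r_right_minus_eq)
    ultimately show ?thesis using x y c by (simp add: m_lcancel)
  qed
  let ?t = "poly_mult [\<one>, \<ominus> y] q"
  let ?d = "poly_add s (map (\<lambda>a. \<ominus> a) ?t)"
  have t: "set ?t \<subseteq> carrier R" using poly_mult_in_carrier car by blast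
  have tm: "set (map (\<lambda>a. \<ominus> a) ?t) \<subseteq> carrier R" using t by auto
  have evneg: "eval (map (\<lambda>a. \<ominus> a) u) x = \<ominus> (eval u x)" if "set u \<subseteq> carrier R" "x \<in> carrier R" for u x
    using that by (induction u) (auto simp: l_minus minus_add eval_in_carrier)
  have evd: "eval ?d x = eval s x \<ominus> (x \<ominus> y) \<otimes> eval q x" if x: "x \<in> carrier R" for x
    using x y car s t tm by (simp only: eval_poly_add evneg eval_poly_mult) (simp add: minus_eq)
  have "carrier R - {y} \<subseteq> {x \<in> carrier R. eval ?d x = \<zero>}"
    using evd s_eq y car s eval_in_carrier by (auto simp: minus_eq r_neg)
  then have "infinite {x \<in> carrier R. eval ?d x = \<zero>}"
    using inf by (meson finite.emptyI finite_insert finite_Diff2 finite_subset)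
  then have "set ?d \<subseteq> {\<zero>}" using finite_roots_list poly_add_in_carrier[OF s(1) tm] by blast
  then have "eval ?d y = \<zero>" using eval_zero_list y by blast
  then show ?thesis using evd[OF y] s y car eval_in_carrier deriv_eval_closed[OF car(1) y]
    by (simp add: minus_eq r_neg)
qed

end

section \<open>Fields of bounded degree\<close>

text \<open>Degree at most D means \<open>Suc D\<close> coefficients. Raw lists are used so that the
  failure of \<open>generic_element\<close> has exactly this shape.\<close>

definition (in ring) bounded_degree :: "'a set \<Rightarrow> nat \<Rightarrow> bool"
  where "bounded_degree K D \<longleftrightarrow> (\<forall>x\<in>carrier R.
    \<exists>p. set p \<subseteq> K \<and> \<not> set p \<subseteq> {\<zero>} \<and> length p \<le> Suc D \<and> eval p x = \<zero>)"

context domain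
begin

lemma bounded_degree_Irr:
  assumes K: "subfield K R" and b: "bounded_degree K D" and x: "x \<in> carrier R"
  shows "(algebraic over K) x" "degree (Irr K x) \<le> D"
proof -
  obtain p where p: "set p \<subseteq> K" "\<not> set p \<subseteq> {\<zero>}" "length p \<le> Suc D" "eval p x = \<zero>"
    using b x unfolding bounded_degree_def by blast
  note n = poly_root_subring[OF subfieldE(1)[OF K] p(1,2) x p(4)]
  show alg: "(algebraic over K) x" using algebraicI[OF n] by (simp add: over_def)
  have "Irr K x pdivides normalize p" using Irr_minimal[OF K x alg n(1,3)] .
  then have "degree (Irr K x) \<le> degree (normalize p)"
    using pdivides_imp_degree_le[OF subfieldE(1)[OF K] IrrE(1)[OF K x alg] n(1,2)] by simp
  also have "\<dots> \<le> D" using normalize_length_le[of p] p(3) by linarith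
  finally show "degree (Irr K x) \<le> D" .
qed

text \<open>Separability of y over K, witnessed by any polynomial over K instead of the minimal
  one.\<close>

definition simple_root_over :: "'a set \<Rightarrow> 'a \<Rightarrow> bool"
  where "simple_root_over K y \<longleftrightarrow>
    (\<exists>g\<in>carrier (K[X]). g \<noteq> [] \<and> eval g y = \<zero> \<and> deriv_eval g y \<noteq> \<zero>)"

lemma add_pow_one: "a \<in> carrier R \<Longrightarrow> [(n::nat)] \<cdot> a = ([n] \<cdot> \<one>) \<otimes> a"
  by (simp add: add_pow_ldistr)

text \<open>If only exponents divisible by m occur, p is a polynomial in X^m. The bound
  \<open>(length p + m - 1) div m\<close> is the quotient rounded up, the number of multiples of m
  below \<open>length p\<close>.\<close>

lemma eval_coeff_multiples:
  assumes p: "set p \<subseteq> carrier R" and x: "x \<in> carrier R" and m: "m \<ge> 1"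
    and z: "\<And>i. i < length p \<Longrightarrow> coeff p i \<noteq> \<zero> \<Longrightarrow> m dvd i"
  shows "eval p x = eval (map (\<lambda>i. coeff p (m * i)) (rev [0..<(length p + m - 1) div m])) (x [^] m)"
  using p z
proof (induction p)
  case Nil
  then show ?case using m by simp
next
  case (Cons a p)
  let ?n = "length p"
  let ?q = "\<lambda>p. map (\<lambda>i. coeff p (m * i)) (rev [0..<(length p + m - 1) div m])"
  have p: "set p \<subseteq> carrier R" "a \<in> carrier R" using Cons.prems by auto
  have IH: "eval p x = eval (?q p) (x [^] m)"
  proof (rule Cons.IH[OF p(1)])
    fix i assume "i < length p" "coeff p i \<noteq> \<zero>"
    then show "m dvd i" using Cons.prems(2)[of i] by simp
  qed
  show ?case
  proof (cases "m dvd ?n")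
    case True
    then obtain k where k: "?n = m * k" by blast
    have l: "(Suc ?n + m - 1) div m = Suc k" "(?n + m - 1) div m = k"
      using m k by (auto simp: div_mult_self4 div_nat_eqI)
    have "map (\<lambda>i. coeff (a # p) (m * i)) (rev [0..<k]) = map (\<lambda>i. coeff p (m * i)) (rev [0..<k])"
      using m k by (intro map_cong) auto
    then have "?q (a # p) = a # ?q p" using l k by (simp del: coeff.simps) simp
    moreover have "(x [^] m) [^] k = x [^] ?n" using x k by (simp add: nat_pow_pow)
    moreover have "length (?q p) = k" using l by simp
    ultimately show ?thesis using IH by (simp only: eval.simps list.sel list.size) simp
  next
    case False
    then have a: "a = \<zero>" using Cons.prems(2)[of ?n] by auto
    have ge: "m * ((?n + m - 1) div m) \<le> ?n + m - 1" by simp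
    have "(?n + m) div m = (?n + m - 1) div m"
    proof (rule div_nat_eqI)
      show "m * ((?n + m - 1) div m) \<le> ?n + m" using ge by linarith
      have "?n + m - 1 < m * Suc ((?n + m - 1) div m)" using m
        by (metis dividend_less_times_div less_le_trans mult_Suc_right zero_less_one add.commute)
      moreover have "\<not> m dvd ?n + m" using False by simp
      then have "?n + m \<noteq> m * Suc ((?n + m - 1) div m)" by (metis dvd_triv_left)
      ultimately show "?n + m < m * Suc ((?n + m - 1) div m)" by linarith
    qed
    moreover have "map (\<lambda>i. coeff (a # p) (m * i)) (rev [0..<(?n + m - 1) div m]) =
        map (\<lambda>i. coeff p (m * i)) (rev [0..<(?n + m - 1) div m])"
      using False a by (intro map_cong) (auto simp: coeff_length)
    ultimately have "?q (a # p) = ?q p" by simp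
    moreover have "eval (a # p) x = eval p x" using a x p by (simp add: eval_in_carrier)
    ultimately show ?thesis using IH by metis
  qed
qed

text \<open>Inseparability is removed by taking powers. If y is a multiple root of its minimal
  polynomial, only exponents divisible by the characteristic m occur there, so the degree of y^m is
  smaller at least by the factor m and induction applies. The bound on q is kept so that q will
  divide a fixed factorial.\<close>

lemma power_simple_root:
  assumes K: "subfield K R" and b: "bounded_degree K D" and y: "y \<in> carrier R"
  shows "\<exists>q::nat. 1 \<le> q \<and> q \<le> degree (Irr K y) \<and> simple_root_over K (y [^] q)"
  using y
proof (induction "degree (Irr K y)" arbitrary: y rule: less_induct)
  case less
  note y = less.prems
  let ?g = "Irr K y"
  note alg = bounded_degree_Irr(1)[OF K b y]
  note I = IrrE[OF K y alg]
  note KR = subfieldE(3)[OF K]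
  note Kr = subfieldE(1)[OF K]
  have g0: "?g \<noteq> []" using pirreducibleE(1)[OF Kr I(1,2)] .
  have deg: "degree ?g \<ge> 1" using pirreducible_degree[OF K I(1,2)] .
  have gK: "set ?g \<subseteq> K" using I(1) by (auto simp: univ_poly_carrier[symmetric] polynomial_def)
  have gR: "set ?g \<subseteq> carrier R" using gK KR by blast
  have coeffK: "coeff ?g i \<in> K" for i
  proof -
    have "coeff ?g i \<in> set ?g \<union> {\<zero>}" by (metis coeff_img(3) rangeI)
    then show ?thesis using gK subringE(2)[OF Kr] by auto
  qed
  show ?case
  proof (cases "deriv_eval ?g y = \<zero>")
    case False
    then have "simple_root_over K (y [^] (1::nat))" unfolding simple_root_over_def
      using I g0 y by auto
    then show ?thesis using deg by blast
  next
    case True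
    have dK: "set (deriv_list ?g) \<subseteq> K"
    proof -
      have "[i] \<cdot> a \<in> K" if "a \<in> K" for a and i :: nat
        by (induction i) (use that subringE(2,7)[OF Kr] in simp_all)
      then show ?thesis using coeffK by (auto simp: deriv_list_def)
    qed
    \<comment> \<open>The derivative vanishes at \<open>y\<close> and is shorter than the minimal
      polynomial, so all its entries are zero.\<close>
    have dz: "set (deriv_list ?g) \<subseteq> {\<zero>}"
    proof (rule ccontr)
      assume nz: "\<not> set (deriv_list ?g) \<subseteq> {\<zero>}"
      have e: "eval (deriv_list ?g) y = \<zero>" using True eval_deriv_list[OF gR y] by simp
      note n = poly_root_subring[OF Kr dK nz y e]
      have "degree ?g \<le> degree (normalize (deriv_list ?g))"
        using pdivides_imp_degree_le[OF Kr I(1) n(1,2) Irr_minimal[OF K y alg n(1,3)]] .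
      moreover have "length (deriv_list ?g) = length ?g - 1" by (simp add: deriv_list_def)
      moreover have "length (normalize (deriv_list ?g)) > 0" using n(2) by simp
      ultimately show False using normalize_length_le[of "deriv_list ?g"] deg by linarith
    qed
    have coeffs: "[i] \<cdot> coeff ?g i = \<zero>" if "i \<ge> 1" "i < length ?g" for i
      using dz that by (auto simp: deriv_list_def image_subset_iff)
    have cR: "coeff ?g i \<in> carrier R" for i using gR by simp
    have one0: "([i] \<cdot> \<one>) = \<zero>" if "i \<ge> 1" "i < length ?g" "coeff ?g i \<noteq> \<zero>" for i
      using coeffs[OF that(1,2)] that(3) cR[of i] integral[of "[i] \<cdot> \<one>" "coeff ?g i"] add_pow_one[OF cR[of i], of i]
      by auto
    have lead: "coeff ?g (degree ?g) = \<one>" using g0 I(3) lead_coeff_simp by simp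
    \<comment> \<open>The characteristic. It exists because the leading coefficient is one and the
      derivative is zero, so that \<open>degree ?g\<close> is a positive multiple of one that
      vanishes.\<close>
    define m where "m = (LEAST i::nat. i \<ge> 1 \<and> [i] \<cdot> \<one> = \<zero>)"
    have ex: "degree ?g \<ge> 1 \<and> [degree ?g] \<cdot> \<one> = \<zero>"
      using one0[of "degree ?g"] deg lead g0 by (cases ?g) auto
    have m: "m \<ge> 1" "[m] \<cdot> \<one> = \<zero>" using LeastI[of "\<lambda>i. i \<ge> 1 \<and> [i] \<cdot> \<one> = \<zero>", OF ex] by (auto simp: m_def)
    have m_dvd: "m dvd i" if "[i] \<cdot> \<one> = \<zero>" for i :: nat
    proof -
      define u v where uv: "u = m * (i div m)" "v = i mod m"
      have i: "i = u + v" unfolding uv by simp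
      have "[u] \<cdot> \<one> = \<zero>"
        using add.nat_pow_pow[of \<one> "i div m" m] m(2) unfolding uv by simp
      moreover have "[i] \<cdot> \<one> = ([u] \<cdot> \<one>) \<oplus> ([v] \<cdot> \<one>)"
        unfolding i by (simp add: add.nat_pow_mult)
      ultimately have "[v] \<cdot> \<one> = \<zero>" using that by simp
      moreover have "v < m" using m(1) by (simp add: uv)
      ultimately have "v = 0"
        using not_less_Least[of v "\<lambda>i. i \<ge> 1 \<and> [i] \<cdot> \<one> = \<zero>"] unfolding m_def[symmetric] by force
      then show ?thesis unfolding uv by presburger
    qed
    have m2: "m \<ge> 2"
    proof -
      have "m \<noteq> 1" using m(2) by auto
      then show ?thesis using m(1) by linarith
    qed
    have mult: "m dvd i" if "i < length ?g" "coeff ?g i \<noteq> \<zero>" for i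
      using one0[of i] m_dvd[of i] that by (cases "i = 0") auto
    define h where "h = map (\<lambda>i. coeff ?g (m * i)) (rev [0..<(length ?g + m - 1) div m])"
    have ev: "eval h (y [^] m) = \<zero>"
      using eval_coeff_multiples[OF gR y m(1) mult] I(4) unfolding h_def by simp
    obtain k where k: "degree ?g = m * k" using m_dvd ex by blast
    have lg: "length ?g = Suc (m * k)" using k g0 deg by linarith
    have lh: "length h = Suc k" unfolding h_def lg using m(1) by (simp add: div_nat_eqI)
    have hK: "set h \<subseteq> K" using coeffK unfolding h_def by auto
    have hn: "\<not> set h \<subseteq> {\<zero>}"
    proof
      assume "set h \<subseteq> {\<zero>}"
      moreover have "coeff ?g (m * k) \<in> set h" using lh unfolding h_def by auto
      ultimately show False using lead k by auto
    qed
    have ym: "y [^] m \<in> carrier R" using y by simp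
    note n = poly_root_subring[OF Kr hK hn ym ev]
    note alg' = bounded_degree_Irr(1)[OF K b ym]
    have le: "degree (Irr K (y [^] m)) \<le> k"
      using pdivides_imp_degree_le[OF Kr IrrE(1)[OF K ym alg'] n(1,2) Irr_minimal[OF K ym alg' n(1,3)]]
        normalize_length_le[of h] lh by linarith
    have "k \<ge> 1" using k deg by (cases k) auto
    moreover have "k * 2 \<le> m * k" using m2 by (simp add: mult.commute)
    ultimately have "k < degree ?g" using k by linarith
    then obtain q :: nat where q: "1 \<le> q" "q \<le> degree (Irr K (y [^] m))" "simple_root_over K ((y [^] m) [^] q)"
      using less.hyps[OF _ ym] le by fastforce
    have "simple_root_over K (y [^] (m * q))" using q(3) y by (simp add: nat_pow_pow)
    moreover have "m * q \<le> degree ?g" using q(2) le k by (metis le_trans mult_le_mono2)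
    moreover have "m * q \<ge> 1" using m q by (simp add: Suc_le_eq)
    ultimately show ?thesis by blast
  qed
qed

end

section \<open>Algebraically closed fields of bounded degree over a subfield\<close>

context algebraically_closed
begin

lemma root_exists:
  assumes "set p \<subseteq> carrier L" "length p \<ge> 2" "hd p \<noteq> \<zero>"
  shows "\<exists>x\<in>carrier L. eval p x = \<zero>"
proof -
  have p: "p \<in> carrier (poly_ring L)"
    using assms by (auto simp: univ_poly_carrier[symmetric] polynomial_def)
  have "size (roots p) = degree p" using roots_over_carrier[OF p] by (simp add: splitted_def)
  then have "roots p \<noteq> {#}" using assms(2) by auto
  then obtain x where "x \<in># roots p" by blast
  then show ?thesis using roots_mem_iff_is_root[OF p] by (auto simp: is_root_def)
qed

lemma nth_root_exists:
  assumes "a \<in> carrier L" "(n::nat) \<ge> 1"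
  shows "\<exists>x\<in>carrier L. x [^] n = a"
proof -
  let ?p = "(\<one> # replicate (n - 1) \<zero>) @ [\<ominus> a]"
  have c: "set (\<one> # replicate (n - 1) \<zero>) \<subseteq> carrier L" by auto
  obtain x where x: "x \<in> carrier L" "eval ?p x = \<zero>"
    using root_exists[of ?p] assms c by auto
  have "eval (\<one> # replicate (n - 1) \<zero>) x = x [^] (n - 1)"
    using x(1) eval_zero_list[of "replicate (n - 1) \<zero>" x] by (simp add: set_replicate_conv_if)
  then have "x [^] (n - 1) \<otimes> x \<oplus> \<ominus> a = \<zero>"
    using x c assms(1) by (simp only: eval_append_aux a_inv_closed)
  moreover have "x [^] (n - 1) \<otimes> x = x [^] n"
    using assms(2) nat_pow_Suc[of x "n - 1"] by (simp del: nat_pow_Suc)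
  ultimately show ?thesis using x(1) assms(1) by (metis minus_eq nat_pow_closed r_right_minus_eq)
qed

text \<open>The map x^2 - x sends zero and one to the same value, so on a finite carrier it would
  miss some c; then X^2 - X - c would have no root.\<close>

lemma infinite_carrier: "infinite (carrier L)"
proof
  assume fin: "finite (carrier L)"
  define f where "f x = x \<otimes> x \<ominus> x" for x
  have f: "f ` carrier L \<subseteq> carrier L" by (auto simp: f_def)
  have "f \<zero> = f \<one>" by (simp add: f_def minus_eq r_neg)
  then have "\<not> inj_on f (carrier L)" using inj_onD[of f "carrier L" \<zero> \<one>] by auto
  then have "f ` carrier L \<noteq> carrier L" using fin eq_card_imp_inj_on[of "carrier L" f] by metis
  then obtain c where c: "c \<in> carrier L" "c \<notin> f ` carrier L" using f by blast
  obtain x where x: "x \<in> carrier L" "eval [\<one>, \<ominus> \<one>, \<ominus> c] x = \<zero>"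
    using root_exists[of "[\<one>, \<ominus> \<one>, \<ominus> c]"] c by auto
  have "f x \<ominus> c = \<zero>" using x c by (simp add: f_def minus_eq numeral_2_eq_2 l_minus a_assoc)
  then have "f x = c" using x c by (simp add: f_def r_right_minus_eq)
  then show False using c x by blast
qed

text \<open>Over a finite K there are only finitely many polynomials of bounded degree; their
  finitely many roots cannot cover the infinite carrier.\<close>

lemma bounded_degree_infinite:
  assumes K: "subfield K L" and b: "bounded_degree K D"
  shows "infinite K"
proof
  assume fin: "finite K"
  let ?P = "{p. set p \<subseteq> K \<and> length p \<le> Suc D \<and> \<not> set p \<subseteq> {\<zero>}}"
  have "finite ?P" using finite_lists_length_le[OF fin, of "Suc D"] by (rule rev_finite_subset) auto
  moreover have "finite {x \<in> carrier L. eval p x = \<zero>}" if "p \<in> ?P" for p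
    using finite_roots_list[of p] that subfieldE(3)[OF K] by auto
  moreover have "carrier L \<subseteq> (\<Union>p\<in>?P. {x \<in> carrier L. eval p x = \<zero>})"
    using b unfolding bounded_degree_def by fast
  ultimately show False using infinite_carrier by (meson finite_UN finite_subset)
qed

text \<open>The argument of the primitive element theorem: for all but finitely many \<open>c\<close> in \<open>K\<close>,
  \<open>\<alpha> + c \<beta>\<close> generates both \<open>\<alpha>\<close> and \<open>\<beta>\<close>.\<close>

lemma simple_root_mem_max_extension:
  assumes K: "subfield K L" and b: "bounded_degree K D"
    and \<alpha>: "\<alpha> \<in> carrier L" and max: "\<And>x. x \<in> carrier L \<Longrightarrow> degree (Irr K x) \<le> degree (Irr K \<alpha>)"
    and \<beta>: "\<beta> \<in> carrier L" "simple_root_over K \<beta>"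
  shows "\<beta> \<in> simple_extension K \<alpha>"
proof -
  note Kr = subfieldE(1)[OF K] and KR = subfieldE(3)[OF K]
  note alg = bounded_degree_Irr(1)[OF K b]
  obtain g where g: "g \<in> carrier (K[X])" "g \<noteq> []" "eval g \<beta> = \<zero>" "deriv_eval g \<beta> \<noteq> \<zero>"
    using \<beta>(2) unfolding simple_root_over_def by blast
  define f where "f = Irr K \<alpha>"
  note f = IrrE[OF K \<alpha> alg[OF \<alpha>], folded f_def]
  have f0: "f \<noteq> []" using pirreducibleE(1)[OF Kr f(1,2)] .
  have inR: "p \<in> carrier (poly_ring L)" if "p \<in> carrier (K[X])" for p
    using carrier_polynomial_shell[OF Kr that] .
  let ?A = "{x. is_root f x}" and ?B = "{x. is_root g x}"
  have fin: "finite ?A" "finite ?B" using finite_number_of_roots inR f(1) g(1) by blast+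
  \<comment> \<open>The values of c for which \<alpha> + c \<beta> - c b is a root a of f for some
    root b of g other than \<beta>. The pairs with b = \<beta> only exclude finitely many further
    values.\<close>
  let ?bad = "(\<lambda>(a, b). (a \<ominus> \<alpha>) \<otimes> inv (\<beta> \<ominus> b)) ` (?A \<times> ?B)"
  obtain c where c: "c \<in> K" "c \<notin> ?bad"
    using bounded_degree_infinite[OF K b] fin by (meson finite_SigmaI finite_imageI finite_subset subsetI)
  have cR: "c \<in> carrier L" using c KR by blast
  define \<gamma> where "\<gamma> = \<alpha> \<oplus> c \<otimes> \<beta>"
  have \<gamma>: "\<gamma> \<in> carrier L" using \<alpha> \<beta> cR by (simp add: \<gamma>_def)
  define F where "F = simple_extension K \<gamma>"
  have F: "subfield F L" using simple_extension_is_subfield[OF K \<gamma>] alg[OF \<gamma>] unfolding F_def by blast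
  note Fr = subfieldE(1)[OF F] and FR = subfieldE(3)[OF F]
  have KF: "K \<subseteq> F" and \<gamma>F: "\<gamma> \<in> F"
    unfolding F_def using simple_extension_incl[OF KR \<gamma>] simple_extension_mem[OF Kr \<gamma>] by auto
  have algF: "(algebraic over F) \<beta>" using algebraic_mono[OF KF] alg[OF \<beta>(1)] by (simp add: over_def)
  define r where "r = Irr F \<beta>"
  note r = IrrE[OF F \<beta>(1) algF, folded r_def]
  have r0: "r \<noteq> []" using pirreducibleE(1)[OF Fr r(1,2)] .
  have degr: "degree r \<ge> 1" using pirreducible_degree[OF F r(1,2)] .
  have rR: "r \<in> carrier (poly_ring L)" using carrier_polynomial_shell[OF Fr r(1)] .
  have gF: "g \<in> carrier (F[X])" using g(1) KF by (auto simp: univ_poly_carrier[symmetric] polynomial_def)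
  have rg: "r pdivides g" using Irr_minimal[OF F \<beta>(1) algF gF g(3)] by (simp add: r_def)
  have "set f \<subseteq> F" using f(1) KF by (auto simp: univ_poly_carrier[symmetric] polynomial_def)
  \<comment> \<open>h is f(\<gamma> - c X), with coefficients in F; it vanishes at \<beta> because
    \<gamma> - c \<beta> = \<alpha>.\<close>
  then obtain h where h: "h \<in> carrier (F[X])" "\<forall>x\<in>carrier L. eval h x = eval f (\<gamma> \<oplus> (\<ominus> c) \<otimes> x)"
    using affine_substitution[OF Fr, of f \<gamma> "\<ominus> c"] \<gamma>F c(1) KF subringE(5)[OF Fr] by blast
  have "\<gamma> \<oplus> (\<ominus> c) \<otimes> \<beta> = \<alpha>" using \<alpha> \<beta> cR unfolding \<gamma>_def by (simp add: l_minus a_assoc r_neg)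
  then have "eval h \<beta> = \<zero>" using h \<beta> f(4) by simp
  then have rh: "r pdivides h" using Irr_minimal[OF F \<beta>(1) algF h(1)] by (simp add: r_def)
  have only: "x = \<beta>" if x: "x \<in> carrier L" "eval r x = \<zero>" for x
  proof (rule ccontr)
    assume ne: "x \<noteq> \<beta>"
    have "eval g x = \<zero>" using pdivides_imp_root_sharing[OF rR rg x(1)] x(2) by simp
    then have xB: "x \<in> ?B" using x g(2) by (simp add: is_root_def)
    have "eval h x = \<zero>" using pdivides_imp_root_sharing[OF rR rh x(1)] x(2) by simp
    then have xA: "\<gamma> \<oplus> (\<ominus> c) \<otimes> x \<in> ?A" using h x \<gamma> cR f0 by (simp add: is_root_def)
    have nz: "\<beta> \<ominus> x \<noteq> \<zero>" using ne x \<beta> by (simp add: r_right_minus_eq)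
    have "\<gamma> \<oplus> (\<ominus> c) \<otimes> x \<ominus> \<alpha> = c \<otimes> (\<beta> \<ominus> x)"
      using \<alpha> \<beta>(1) cR x(1) unfolding \<gamma>_def by algebra
    then have "(\<gamma> \<oplus> (\<ominus> c) \<otimes> x \<ominus> \<alpha>) \<otimes> inv (\<beta> \<ominus> x) = c"
      using nz x \<beta> cR field_Units by (simp add: m_assoc)
    then have "c \<in> ?bad" using xA xB by (force intro: rev_image_eqI)
    then show False using c(2) by blast
  qed
  \<comment> \<open>All roots of r equal \<beta>. A larger degree would make \<beta> a double root
    of r, hence of g, against the nonzero derivative.\<close>
  have "degree r = 1"
  proof (rule ccontr)
    assume "degree r \<noteq> 1"
    then have "degree r \<ge> 2" using degr by linarith
    moreover have "size (roots r) = degree r" using roots_over_carrier[OF rR] by (simp add: splitted_def)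
    moreover have "set_mset (roots r) \<subseteq> {\<beta>}"
      using roots_mem_iff_is_root[OF rR] only by (auto simp: is_root_def)
    ultimately have "count (roots r) \<beta> \<ge> 2"
      by (metis count_replicate_mset set_mset_subset_singletonD size_replicate_mset)
    then have "([\<one>, \<ominus> \<beta>] [^]\<^bsub>poly_ring L\<^esub> (2::nat)) pdivides r"
      using le_alg_mult_imp_pdivides[OF \<beta>(1) rR, of 2] alg_mult_eq_count_roots[OF rR] by simp
    moreover interpret P: domain "poly_ring L" using univ_poly_is_domain[OF carrier_is_subring] .
    have l: "[\<one>, \<ominus> \<beta>] \<in> carrier (poly_ring L)"
      using \<beta>(1) by (auto simp: univ_poly_carrier[symmetric] polynomial_def)
    ultimately have "([\<one>, \<ominus> \<beta>] [^]\<^bsub>poly_ring L\<^esub> (2::nat)) pdivides g"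
      using rg P.divides_trans unfolding pdivides_def by (meson P.nat_pow_closed)
    then show False using double_root_deriv_eval[OF inR[OF g(1)] \<beta>(1) _ infinite_carrier] g(4) by simp
  qed
  then obtain a0 b0 where ab: "a0 \<in> F" "a0 \<noteq> \<zero>" "b0 \<in> F" "r = [a0, b0]"
    using degree_oneE[OF r(1)] by metis
  have "\<beta> = \<ominus> b0"
  proof -
    have "a0 = \<one>" using r(3) ab by simp
    then have "\<beta> \<oplus> b0 = \<zero>" using r(4) ab \<beta>(1) FR by (auto simp: subset_iff)
    then show ?thesis using ab \<beta>(1) FR minus_equality by (metis subsetD)
  qed
  then have \<beta>F: "\<beta> \<in> F" using ab subringE(5)[OF Fr] by simp
  have "\<gamma> \<oplus> \<ominus> (c \<otimes> \<beta>) = \<alpha>" using \<alpha> \<beta> cR unfolding \<gamma>_def by (simp add: a_assoc r_neg)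
  then have \<alpha>F: "\<alpha> \<in> F"
    using \<gamma>F \<beta>F c KF subringE(5,6,7)[OF Fr] by (metis subsetD)
  \<comment> \<open>K(\<alpha>) lies in F = K(\<gamma>) and \<alpha> has maximal degree, so the two
    fields coincide.\<close>
  let ?E = "simple_extension K \<alpha>"
  have EF: "?E \<subseteq> F" using simple_extension_subring_incl[OF Fr KF \<alpha>F] .
  have dE: "dimension (degree (Irr K \<alpha>)) K ?E" and dF: "dimension (degree (Irr K \<gamma>)) K F"
    using dimension_simple_extension[OF K _ alg] \<alpha> \<gamma> unfolding F_def by auto
  obtain Us where Us: "set Us \<subseteq> carrier L" "independent K Us" "length Us = degree (Irr K \<alpha>)" "Span K Us = ?E"
    using exists_base[OF K dE] by blast
  have UF: "set Us \<subseteq> F" using Span_base_incl[OF K Us(1)] Us(4) EF by auto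
  then have "length Us = degree (Irr K \<gamma>)"
    using independent_length_le_dimension[OF K dF Us(2) UF] max[OF \<gamma>] Us(3) by linarith
  then have "Span K Us = F"
    using independent_length_eq_dimension[OF K dF Us(2) UF] by simp
  then show ?thesis using \<beta>F Us(4) by simp
qed

text \<open>An element \<alpha> of largest degree generates all separable elements. An arbitrary x
  is y^(D!) for some y; a power y^q with q at most D is separable, and q divides D!, so x is a power
  of an element of K(\<alpha>).\<close>

lemma bounded_degree_imp_finite_dimension:
  assumes K: "subfield K L" and b: "bounded_degree K D"
  shows "finite_dimension K (carrier L)"
proof -
  note alg = bounded_degree_Irr(1)[OF K b]
  let ?S = "(\<lambda>x. degree (Irr K x)) ` carrier L"
  have "?S \<subseteq> {..D}" using bounded_degree_Irr(2)[OF K b] by auto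
  then have fin: "finite ?S" by (rule finite_subset) simp
  have "Max ?S \<in> ?S" using fin by (intro Max_in) auto
  then obtain \<alpha> where \<alpha>1: "\<alpha> \<in> carrier L" "degree (Irr K \<alpha>) = Max ?S" by auto
  have \<alpha>: "\<alpha> \<in> carrier L" "\<And>x. x \<in> carrier L \<Longrightarrow> degree (Irr K x) \<le> degree (Irr K \<alpha>)"
    using \<alpha>1 Max_ge[OF fin] by auto
  let ?E = "simple_extension K \<alpha>"
  have E: "subfield ?E L" using simple_extension_is_subfield[OF K \<alpha>(1)] alg[OF \<alpha>(1)] by blast
  have "carrier L \<subseteq> ?E"
  proof
    fix x assume x: "x \<in> carrier L"
    obtain y where y: "y \<in> carrier L" "y [^] (fact D :: nat) = x"
      using nth_root_exists[OF x, of "fact D"] by auto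
    obtain q :: nat where q: "1 \<le> q" "q \<le> degree (Irr K y)" "simple_root_over K (y [^] q)"
      using power_simple_root[OF K b y(1)] by blast
    have "q dvd fact D" using q bounded_degree_Irr(2)[OF K b y(1)] by (intro dvd_fact) auto
    then obtain k where k: "fact D = q * k" by blast
    have "y [^] q \<in> ?E" using simple_root_mem_max_extension[OF K b \<alpha> _ q(3)] y by simp
    then have "(y [^] q) [^] k \<in> ?E"
      using subringE(3,6)[OF subfieldE(1)[OF E]] by (induction k) auto
    then show "x \<in> ?E" using y k by (simp add: nat_pow_pow)
  qed
  then have "?E = carrier L" using subfieldE(3)[OF E] by blast
  then show ?thesis using dimension_simple_extension[OF K \<alpha>(1) alg[OF \<alpha>(1)]] finite_dimensionI by metis
qed

end

section \<open>Generic elements\<close>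

context field
begin

lemma eval_smult:
  "set p \<subseteq> carrier R \<Longrightarrow> d \<in> carrier R \<Longrightarrow> x \<in> carrier R \<Longrightarrow>
    eval (map (\<lambda>a. d \<otimes> a) p) x = d \<otimes> eval p x"
  by (induction p) (auto simp: r_distr m_assoc eval_in_carrier)

lemma subfield_power_mem:
  assumes "subfield F R" "x \<in> F" shows "x [^] (n::nat) \<in> F"
  using assms(2) subringE(3,6)[OF subfieldE(1)[OF assms(1)]] by (induction n) auto

text \<open>Let m be the degree of w. By the tower K, K(w), K(w)(x) the powers 1, x, ..., x^(m D)
  lie in a space of dimension at most m D, so there is one power too many.\<close>

lemma bounded_degree_algebraic_extension:
  assumes K: "subfield K R" and w: "w \<in> carrier R" "(algebraic over K) w"
    and b: "bounded_degree (simple_extension K w) D"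
  shows "\<exists>D'. bounded_degree K D'"
proof -
  let ?F = "simple_extension K w"
  have F: "subfield ?F R" using simple_extension_is_subfield[OF K w(1)] w(2) by blast
  define m where "m = degree (Irr K w)"
  have dF: "dimension m K ?F" using dimension_simple_extension[OF K w] by (simp add: m_def)
  have "bounded_degree K (m * D)"
    unfolding bounded_degree_def
  proof
    fix x assume x: "x \<in> carrier R"
    note a = bounded_degree_Irr[OF F b x]
    let ?E = "simple_extension ?F x"
    have E: "subfield ?E R" using simple_extension_is_subfield[OF F x] a(1) by blast
    have dE: "dimension (m * degree (Irr ?F x)) K ?E"
      using telescopic_base[OF K F dF dimension_simple_extension[OF F x a(1)]] .
    let ?Us = "exp_base x (Suc (m * D))"
    have "x \<in> ?E" using simple_extension_mem[OF subfieldE(1)[OF F] x] .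
    then have UE: "set ?Us \<subseteq> ?E" using subfield_power_mem[OF E] by (auto simp: exp_base_def)
    have len: "length ?Us = Suc (m * D)" by (simp add: exp_base_def)
    have "dependent K ?Us"
    proof
      assume "independent K ?Us"
      then have "Suc (m * D) \<le> m * degree (Irr ?F x)"
        using independent_length_le_dimension[OF K dE _ UE] len by simp
      moreover have "m * degree (Irr ?F x) \<le> m * D" using a(2) by simp
      ultimately show False by linarith
    qed
    then obtain Ks where Ks: "length Ks = length ?Us" "combine Ks ?Us = \<zero>" "set Ks \<subseteq> K" "set Ks \<noteq> {\<zero>}"
      using dependent_imp_non_trivial_combine[OF K exp_base_closed[OF x]] by metis
    have "eval Ks x = \<zero>" using Ks(1,2) len combine_eq_eval[of Ks x] by simp
    moreover have "Ks \<noteq> []" using Ks(1) len by auto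
    then have "\<not> set Ks \<subseteq> {\<zero>}" using Ks(4) by (cases Ks) auto
    ultimately show "\<exists>p. set p \<subseteq> K \<and> \<not> set p \<subseteq> {\<zero>} \<and> length p \<le> Suc (m * D) \<and> eval p x = \<zero>"
      using Ks len by (intro exI[of _ Ks]) auto
  qed
  then show ?thesis by blast
qed

text \<open>For transcendental w, \<open>simple_extension K w\<close> is the ring K[w]; its
  fractions form the field K(w).\<close>

lemma fraction_subfield:
  assumes S: "subring S R"
  shows "subfield {a \<otimes> inv b | a b. a \<in> S \<and> b \<in> S \<and> b \<noteq> \<zero>} R" (is "subfield ?F R")
proof -
  note SE = subringE[OF S]
  have SR: "a \<in> S \<Longrightarrow> a \<in> carrier R" for a using SE(1) by blast
  have inv: "inv b \<in> carrier R" "b \<otimes> inv b = \<one>" "inv b \<noteq> \<zero>" if "b \<in> S" "b \<noteq> \<zero>" for b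
  proof -
    have u: "b \<in> Units R" using that SR field_Units by auto
    then show 1: "inv b \<in> carrier R" "b \<otimes> inv b = \<one>" by auto
    show "inv b \<noteq> \<zero>" using 1(2) SR[OF that(1)] by auto
  qed
  have mem: "a \<otimes> inv b \<in> ?F" if "a \<in> S" "b \<in> S" "b \<noteq> \<zero>" for a b using that by blast
  show ?thesis
  proof (intro subfieldI' subringI)
    show "?F \<subseteq> carrier R" using SR inv by auto
    show "\<one> \<in> ?F" using mem[OF SE(3,3)] by simp
    fix h assume "h \<in> ?F"
    then obtain a b where h: "h = a \<otimes> inv b" "a \<in> S" "b \<in> S" "b \<noteq> \<zero>" by blast
    have "\<ominus> h = (\<ominus> a) \<otimes> inv b" using h SR inv by (simp add: l_minus)
    then show "\<ominus> h \<in> ?F" using mem[OF SE(5)[OF h(2)] h(3,4)] by simp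
    fix h' assume "h' \<in> ?F"
    then obtain a' b' where h': "h' = a' \<otimes> inv b'" "a' \<in> S" "b' \<in> S" "b' \<noteq> \<zero>" by blast
    note i = inv[OF h(3,4)] inv[OF h'(3,4)] 
    note c = SR[OF h(2)] SR[OF h(3)] SR[OF h'(2)] SR[OF h'(3)] i(1) i(4)
    have bb: "b \<otimes> b' \<in> S" "b \<otimes> b' \<noteq> \<zero>"
      using h h' SE(6) integral_iff[OF c(2,4)] by auto
    have ib: "inv (b \<otimes> b') = inv b \<otimes> inv b'"
    proof (rule comm_inv_char)
      have "b \<otimes> b' \<otimes> (inv b \<otimes> inv b') = (b \<otimes> inv b) \<otimes> (b' \<otimes> inv b')" using c by algebra
      then show "b \<otimes> b' \<otimes> (inv b \<otimes> inv b') = \<one>" using i by simp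
    qed (use c in auto)
    have "h \<otimes> h' = (a \<otimes> a') \<otimes> inv (b \<otimes> b')" unfolding h h' ib using c by algebra
    then show "h \<otimes> h' \<in> ?F" using mem[OF SE(6)[OF h(2) h'(2)] bb] by simp
    have "h \<oplus> h' = (a \<otimes> b' \<oplus> a' \<otimes> b) \<otimes> inv (b \<otimes> b')"
    proof -
      have "(a \<otimes> b' \<oplus> a' \<otimes> b) \<otimes> inv (b \<otimes> b') =
          (a \<otimes> inv b) \<otimes> (b' \<otimes> inv b') \<oplus> (a' \<otimes> inv b') \<otimes> (b \<otimes> inv b)"
        unfolding ib using c by algebra
      then show ?thesis using i c h h' by simp
    qed
    then show "h \<oplus> h' \<in> ?F"
      using mem[OF SE(7)[OF SE(6)[OF h(2) h'(3)] SE(6)[OF h'(2) h(3)]] bb] by simp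
  next
    fix k assume k: "k \<in> ?F - {\<zero>}"
    then obtain a b where h: "k = a \<otimes> inv b" "a \<in> S" "b \<in> S" "b \<noteq> \<zero>" by blast
    have a0: "a \<noteq> \<zero>" using h k inv by auto
    note i = inv[OF h(3,4)] inv[OF h(2) a0]
    have "inv k = b \<otimes> inv a"
    proof (rule comm_inv_char)
      have "k \<otimes> (b \<otimes> inv a) = (a \<otimes> inv a) \<otimes> (b \<otimes> inv b)"
        unfolding h using i(1,4) SR[OF h(2)] SR[OF h(3)] by algebra
      then show "k \<otimes> (b \<otimes> inv a) = \<one>" using i by simp
    qed (use h i SR in auto)
    then show "inv k \<in> ?F" using mem[OF h(3,2) a0] by simp
  qed
qed

lemma common_denominator:
  assumes S: "subring S R"
    and "set p \<subseteq> {a \<otimes> inv b | a b. a \<in> S \<and> b \<in> S \<and> b \<noteq> \<zero>}"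
  shows "\<exists>d\<in>S. d \<noteq> \<zero> \<and> (\<forall>c\<in>set p. d \<otimes> c \<in> S)"
  using assms(2)
proof (induction p)
  case Nil
  show ?case using subringE(3)[OF S] by (intro bexI[of _ \<one>]) auto
next
  case (Cons c p)
  note SE = subringE[OF S]
  obtain d where d: "d \<in> S" "d \<noteq> \<zero>" "\<forall>c\<in>set p. d \<otimes> c \<in> S" using Cons by auto
  obtain a b where c: "c = a \<otimes> inv b" "a \<in> S" "b \<in> S" "b \<noteq> \<zero>" using Cons.prems by auto
  have car: "a \<in> carrier R" "b \<in> carrier R" "inv b \<in> carrier R" "d \<in> carrier R" "b \<otimes> inv b = \<one>"
    using SE(1) c d field_Units by auto
  have "(b \<otimes> d) \<otimes> c = (d \<otimes> a) \<otimes> (b \<otimes> inv b)" unfolding c using car(1-4) by algebra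
  also have "\<dots> = d \<otimes> a" using car by simp
  finally have "(b \<otimes> d) \<otimes> c \<in> S" using SE(6)[OF d(1) c(2)] by simp
  moreover have "(b \<otimes> d) \<otimes> c' \<in> S" if "c' \<in> set p" for c'
  proof -
    have "c' \<in> carrier R" using Cons.prems that subfieldE(3)[OF fraction_subfield[OF S]] by auto
    then have "(b \<otimes> d) \<otimes> c' = b \<otimes> (d \<otimes> c')" using car m_assoc by simp
    then show ?thesis using d(3) that c(3) SE(6) by simp
  qed
  moreover have "b \<otimes> d \<noteq> \<zero>" using integral_iff[OF car(2,4)] c(4) d(2) by simp
  ultimately show ?case using c d SE(6) by (intro bexI[of _ "b \<otimes> d"]) auto
qed

lemma eval_map_affine:
  assumes "\<And>A. A \<in> set As \<Longrightarrow> u A \<in> carrier R \<and> v A \<in> carrier R" "w \<in> carrier R" "z \<in> carrier R"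
  shows "eval (map (\<lambda>A. u A \<otimes> w \<oplus> v A) As) z = eval (map u As) z \<otimes> w \<oplus> eval (map v As) z"
  using assms(1)
proof (induction As)
  case (Cons A As)
  have c: "u A \<in> carrier R" "v A \<in> carrier R" "eval (map u As) z \<in> carrier R" "eval (map v As) z \<in> carrier R"
    using Cons.prems assms by (auto intro!: eval_in_carrier)
  have "(u A \<otimes> w \<oplus> v A) \<otimes> y \<oplus> (a \<otimes> w \<oplus> b) = (u A \<otimes> y \<oplus> a) \<otimes> w \<oplus> (v A \<otimes> y \<oplus> b)"
    if "y \<in> carrier R" "a \<in> carrier R" "b \<in> carrier R" for y a b
    using that c assms(2) by algebra
  then show ?case using Cons c assms by simp
qed (use assms in simp)

text \<open>If \<open>w = z\<^sup>q\<close>, then a polynomial of degree less than \<open>q\<close> in \<open>z\<close> with coefficients in \<open>K[w]\<close>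
  is a polynomial in \<open>z\<close> over \<open>K\<close>, obtained by interleaving the coefficients.\<close>

lemma interleave_coefficients:
  assumes K: "K \<subseteq> carrier R" and z: "z \<in> carrier R"
    and "length As = q" "\<And>A. A \<in> set As \<Longrightarrow> set A \<subseteq> K \<and> length A = M"
  shows "\<exists>B. set B \<subseteq> K \<and> eval B z = eval (map (\<lambda>A. eval A (z [^] q)) As) z \<and>
    (set B \<subseteq> {\<zero>} \<longrightarrow> (\<forall>A\<in>set As. set A \<subseteq> {\<zero>}))"
  using assms(3,4)
proof (induction M arbitrary: As)
  case 0
  have "eval A (z [^] q) = \<zero>" if "A \<in> set As" for A
  proof -
    have "A = []" using 0(2)[OF that] by simp
    then show ?thesis by simp
  qed
  then have "set (map (\<lambda>A. eval A (z [^] q)) As) \<subseteq> {\<zero>}" by auto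
  then have "eval (map (\<lambda>A. eval A (z [^] q)) As) z = \<zero>" using eval_zero_list[OF _ z] by blast
  moreover have "\<forall>A\<in>set As. set A \<subseteq> {\<zero>}" using 0(2) by fastforce
  ultimately show ?case by (intro exI[of _ "[]"]) auto
next
  case (Suc M)
  let ?w = "z [^] q"
  let ?As = "map butlast As"
  have split: "A = butlast A @ [last A]" "set (butlast A) \<subseteq> K" "last A \<in> K" "length (butlast A) = M"
    if "A \<in> set As" for A
    using Suc.prems(2)[OF that] by (cases A rule: rev_cases; auto)+
  obtain B where B: "set B \<subseteq> K" "eval B z = eval (map (\<lambda>A. eval A ?w) ?As) z"
    "set B \<subseteq> {\<zero>} \<longrightarrow> (\<forall>A\<in>set ?As. set A \<subseteq> {\<zero>})"
  proof -
    have "length ?As = q" "\<And>A. A \<in> set ?As \<Longrightarrow> set A \<subseteq> K \<and> length A = M"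
      using split Suc.prems(1) by auto
    from Suc.IH[OF this] that show thesis by blast
  qed
  have w: "?w \<in> carrier R" using z by simp
  have "eval A ?w = eval (butlast A) ?w \<otimes> ?w \<oplus> last A" if "A \<in> set As" for A
    using split[OF that] K w eval_append_aux[of "butlast A" "last A" ?w] by auto
  then have "map (\<lambda>A. eval A ?w) As = map (\<lambda>A. eval (butlast A) ?w \<otimes> ?w \<oplus> last A) As" by simp
  then have "eval (map (\<lambda>A. eval A ?w) As) z =
      eval (map (\<lambda>A. eval (butlast A) ?w) As) z \<otimes> ?w \<oplus> eval (map last As) z"
  proof -
    have "eval (butlast A) ?w \<in> carrier R \<and> last A \<in> carrier R" if "A \<in> set As" for A
      using split[OF that] K w by (auto intro!: eval_in_carrier)
    from eval_map_affine[of As "\<lambda>A. eval (butlast A) ?w" last ?w z, OF this w z]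
    show ?thesis by (simp only: \<open>map (\<lambda>A. eval A ?w) As = _\<close>)
  qed
  \<comment> \<open>The constant terms in w become the last q coefficients; the coefficients before
    them are shifted by z^q, which is the factor w.\<close>
  also have "\<dots> = eval (B @ map last As) z"
  proof -
    have "set B \<subseteq> carrier R" "set (map last As) \<subseteq> carrier R" using B K split by fastforce+
    then show ?thesis using B(2) Suc.prems(1) z by (simp add: eval_append comp_def)
  qed
  finally have "eval (B @ map last As) z = eval (map (\<lambda>A. eval A ?w) As) z" by simp
  moreover have "\<forall>A\<in>set As. set A \<subseteq> {\<zero>}" if "set (B @ map last As) \<subseteq> {\<zero>}"
  proof
    fix A assume A: "A \<in> set As"
    then have "set (butlast A) \<subseteq> {\<zero>}" "last A = \<zero>" using that B(3) by auto
    then show "set A \<subseteq> {\<zero>}" using split(1)[OF A] by (metis Un_subset_iff set_append list.simps(15) set_empty subset_insertI2 empty_subsetI insert_subset singletonI)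
  qed
  ultimately show ?case using B split by (intro exI[of _ "B @ map last As"]) auto
qed

lemma pad_list:
  assumes "length (p::'a list) \<le> n" "set p \<subseteq> carrier R" "x \<in> carrier R"
  shows "length (replicate (n - length p) \<zero> @ p) = n"
    "eval (replicate (n - length p) \<zero> @ p) x = eval p x"
  using assms eval_replicate[OF assms(2,3)] by auto

end

section \<open>Transcendental extensions have unbounded degree below an algebraically closed
  field\<close>

context algebraically_closed
begin

text \<open>Take z with z^(D+1) = w. A relation of degree at most D for z over K(w) becomes, after
  clearing denominators, one with D+1 coefficients in K[w]; interleaving gives a nonzero polynomial
  over K that vanishes at z. Then z, and with it w, would be algebraic over K.\<close>

lemma bounded_degree_transcendental_extension:
  assumes K: "subfield K L" and w: "w \<in> carrier L" "(transcendental over K) w"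
    and S: "S = simple_extension K w"
  shows "\<not> bounded_degree {a \<otimes> inv b | a b. a \<in> S \<and> b \<in> S \<and> b \<noteq> \<zero>} D" (is "\<not> bounded_degree ?F D")
proof
  assume b: "bounded_degree ?F D"
  note Kr = subfieldE(1)[OF K] and KR = subfieldE(3)[OF K]
  have Sr: "subring S L" using simple_extension_is_subring[OF Kr w(1)] S by simp
  have SR: "S \<subseteq> carrier L" using subringE(1)[OF Sr] .
  have FR: "?F \<subseteq> carrier L" using subfieldE(3)[OF fraction_subfield[OF Sr]] .
  let ?q = "Suc D"
  obtain z where z: "z \<in> carrier L" "z [^] ?q = w" using nth_root_exists[OF w(1), of ?q] by auto
  obtain p where p: "set p \<subseteq> ?F" "\<not> set p \<subseteq> {\<zero>}" "length p \<le> ?q" "eval p z = \<zero>"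
    using b z(1) unfolding bounded_degree_def by blast
  obtain d where d: "d \<in> S" "d \<noteq> \<zero>" "\<forall>c\<in>set p. d \<otimes> c \<in> S"
    using common_denominator[OF Sr p(1)] by blast
  \<comment> \<open>Denominators are cleared and the list is padded to exactly \<open>?q\<close>
    coefficients, the number of lists to be interleaved.\<close>
  define s where "s = replicate (?q - length p) \<zero> @ map (\<lambda>c. d \<otimes> c) p"
  have pR: "set p \<subseteq> carrier L" using p(1) FR by blast
  have dR: "d \<in> carrier L" using d SR by blast
  have dp: "set (map (\<lambda>c. d \<otimes> c) p) \<subseteq> carrier L" using pR dR by auto
  have sS: "set s \<subseteq> S" using d subringE(2)[OF Sr] by (auto simp: s_def)
  have ls: "length s = ?q" using p(3) by (simp add: s_def)
  have es: "eval s z = \<zero>"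
    using eval_smult[OF pR dR z(1)] p(4) dR pad_list[OF _ dp z(1), of ?q] p(3) by (simp add: s_def)
  obtain c where c: "c \<in> set p" "c \<noteq> \<zero>" using p(2) by blast
  then have "d \<otimes> c \<noteq> \<zero>" using d dR pR integral by blast
  moreover have "d \<otimes> c \<in> set s" using c by (simp add: s_def)
  ultimately have s0: "\<not> set s \<subseteq> {\<zero>}" by blast
  have "\<exists>A. set A \<subseteq> K \<and> eval A w = a" if "a \<in> S" for a
    using that simple_extension_as_eval_img[OF KR w(1)] S
    by (force simp: univ_poly_carrier[symmetric] polynomial_def)
  then obtain A where A: "\<And>a. a \<in> S \<Longrightarrow> set (A a) \<subseteq> K \<and> eval (A a) w = a" by metis
  \<comment> \<open>A common length for the coefficient lists over K, as the interleaving
    demands.\<close>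
  define M where "M = Max (insert 0 ((\<lambda>a. length (A a)) ` set s))"
  have M: "length (A a) \<le> M" if "a \<in> set s" for a using that unfolding M_def by (intro Max_ge) auto
  define As where "As = map (\<lambda>a. replicate (M - length (A a)) \<zero> @ A a) s"
  have As: "length As = ?q" "\<And>A. A \<in> set As \<Longrightarrow> set A \<subseteq> K \<and> length A = M"
  proof -
    show "length As = ?q" using ls by (simp add: As_def)
    fix B assume "B \<in> set As"
    then obtain a where a: "a \<in> set s" "B = replicate (M - length (A a)) \<zero> @ A a" by (auto simp: As_def)
    have "set (A a) \<subseteq> K" using A sS a(1) by blast
    then show "set B \<subseteq> K \<and> length B = M" using a M[OF a(1)] subringE(2)[OF Kr] by auto
  qed
  have evA: "map (\<lambda>A. eval A w) As = s"
    unfolding As_def map_map using A sS KR w(1) pad_list(2)[OF _ _ w(1)]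
    by (intro map_idI) (auto simp: eval_replicate subset_iff)
  obtain B where B: "set B \<subseteq> K" "eval B z = \<zero>" "set B \<subseteq> {\<zero>} \<longrightarrow> (\<forall>A\<in>set As. set A \<subseteq> {\<zero>})"
    using interleave_coefficients[OF KR z(1) As] evA es z(2) by auto
  show False
  proof (cases "set B \<subseteq> {\<zero>}")
    case True
    then have "\<forall>a\<in>set (map (\<lambda>A. eval A w) As). a = \<zero>" using B(3) eval_zero_list[OF _ w(1)] by auto
    then show False using s0 evA by auto
  next
    case False
    note n = poly_root_subring[OF Kr B(1) False z(1) B(2)]
    have algz: "(algebraic over K) z" using algebraicI[OF n] by (simp add: over_def)
    have E: "subfield (simple_extension K z) L" using simple_extension_is_subfield[OF K z(1)] algz by blast
    have "w \<in> simple_extension K z"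
      using subfield_power_mem[OF E simple_extension_mem[OF Kr z(1)], of ?q] unfolding z(2) .
    then show False
      using simple_extesion_mem_imp_algebraic[OF K z(1) algz] w(2) by (simp add: over_def)
  qed
qed

text \<open>Generators are adjoined one at a time. Across an algebraic one a bound descends to the
  smaller field; after a transcendental one no bound exists, so the last clause holds
  vacuously.\<close>

lemma bounded_degree_extension:
  assumes K: "subfield K L" and "set W \<subseteq> carrier L"
  shows "\<exists>F. subfield F L \<and> K \<subseteq> F \<and> set W \<subseteq> F \<and>
    (\<forall>D. bounded_degree F D \<longrightarrow> (\<exists>D'. bounded_degree K D'))"
  using assms(2)
proof (induction W)
  case Nil
  then show ?case using K by auto
next
  case (Cons w W)
  then obtain F where F: "subfield F L" "K \<subseteq> F" "set W \<subseteq> F"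
    "\<forall>D. bounded_degree F D \<longrightarrow> (\<exists>D'. bounded_degree K D')" by auto
  have w: "w \<in> carrier L" using Cons.prems by simp
  note Fr = subfieldE(1)[OF F(1)] and FR = subfieldE(3)[OF F(1)]
  let ?S = "simple_extension F w"
  have inc: "F \<subseteq> ?S" "w \<in> ?S" using simple_extension_incl[OF FR w] simple_extension_mem[OF Fr w] by auto
  show ?case
  proof (cases "(algebraic over F) w")
    case True
    have "subfield ?S L" using simple_extension_is_subfield[OF F(1) w] True by blast
    moreover have "\<forall>D. bounded_degree ?S D \<longrightarrow> (\<exists>D'. bounded_degree K D')"
      using bounded_degree_algebraic_extension[OF F(1) w True] F(4) by blast
    moreover have "K \<subseteq> ?S" "set (w # W) \<subseteq> ?S" using F inc by auto
    ultimately show ?thesis by blast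
  next
    case False
    let ?F = "{a \<otimes> inv b | a b. a \<in> ?S \<and> b \<in> ?S \<and> b \<noteq> \<zero>}"
    have Sr: "subring ?S L" using simple_extension_is_subring[OF Fr w] .
    have "?S \<subseteq> ?F"
    proof
      fix a assume a: "a \<in> ?S"
      then have "a = a \<otimes> inv \<one>" using subringE(1)[OF Sr] by auto
      then show "a \<in> ?F" using a subringE(3)[OF Sr] one_not_zero
        by (intro CollectI exI[of _ a] exI[of _ \<one>]) simp
    qed
    moreover have "subfield ?F L" using fraction_subfield[OF Sr] .
    moreover have "\<not> bounded_degree ?F D" for D
      using bounded_degree_transcendental_extension[OF F(1) w _ refl] False by (auto simp: over_def)
    ultimately show ?thesis using F inc by (intro exI[of _ ?F]) auto
  qed
qed

lemma generic_element:
  assumes K: "subfield K L" and inf: "infinite_dimension K (carrier L)" and W: "set W \<subseteq> carrier L"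
  shows "\<exists>x\<in>carrier L. \<forall>p. set p \<subseteq> Span K W \<longrightarrow> length p \<le> D \<longrightarrow> eval p x = \<zero> \<longrightarrow> set p \<subseteq> {\<zero>}"
proof (rule ccontr)
  assume neg: "\<not> ?thesis"
  obtain F where F: "subfield F L" "K \<subseteq> F" "set W \<subseteq> F"
    "\<forall>D. bounded_degree F D \<longrightarrow> (\<exists>D'. bounded_degree K D')"
    using bounded_degree_extension[OF K W] by blast
  have "subalgebra K F L"
    unfolding subalgebra_def subalgebra_axioms_def
    using F(1,2) subringE(6)[OF subfieldE(1)[OF F(1)]] subring.axioms(1)[OF subfieldE(1)[OF F(1)]] by blast
  then have "Span K W \<subseteq> F" using subalgebra_Span_incl[OF K _ F(3)] by blast
  then have "bounded_degree F D" using neg unfolding bounded_degree_def by (meson le_SucI order_trans)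
  then show False using F(4) bounded_degree_imp_finite_dimension[OF K] inf by blast
qed

end

section \<open>Pseudo-division with parameters\<close>

text \<open>Ring terms in two sorts of variables: \<open>MV x\<close> stands for an element of the model, \<open>PV i\<close> for
  an element of \<open>P\<close>.\<close>

datatype mt = MV nat | PV nat | MZero | MOne | MAdd mt mt | MNeg mt | MMul mt mt

primrec (in ring) mval :: "(nat \<Rightarrow> 'a) \<Rightarrow> (nat \<Rightarrow> 'a) \<Rightarrow> mt \<Rightarrow> 'a" where
  "mval e z (MV x) = e x"
| "mval e z (PV i) = z i"
| "mval e z MZero = \<zero>"
| "mval e z MOne = \<one>"
| "mval e z (MAdd s t) = mval e z s \<oplus> mval e z t"
| "mval e z (MNeg s) = \<ominus> mval e z s"
| "mval e z (MMul s t) = mval e z s \<otimes> mval e z t"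

text \<open>Padding is in front because lists start with the highest degree. Terms are never
  simplified, so lengths depend on the syntax alone and a leading coefficient may evaluate to
  zero.\<close>

definition tadd :: "mt list \<Rightarrow> mt list \<Rightarrow> mt list"
  where "tadd p q = map2 MAdd (replicate (length q - length p) MZero @ p) (replicate (length p - length q) MZero @ q)"

primrec tmul :: "mt list \<Rightarrow> mt list \<Rightarrow> mt list" where
  "tmul [] q = []"
| "tmul (c # cs) q = tadd (map (MMul c) q @ replicate (length cs) MZero) (tmul cs q)"

primrec tpow :: "mt list \<Rightarrow> nat \<Rightarrow> mt list" where
  "tpow p 0 = [MOne]"
| "tpow p (Suc n) = tmul p (tpow p n)"

text \<open>\<open>pcoef x t\<close> lists the coefficients of \<open>t\<close> as a polynomial in the variable \<open>x\<close>,
  highest degree first.\<close>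

primrec pcoef :: "nat \<Rightarrow> mt \<Rightarrow> mt list" where
  "pcoef x (MV y) = (if y = x then [MOne, MZero] else [MV y])"
| "pcoef x (PV i) = [PV i]"
| "pcoef x MZero = []"
| "pcoef x MOne = [MOne]"
| "pcoef x (MAdd s t) = tadd (pcoef x s) (pcoef x t)"
| "pcoef x (MNeg s) = map MNeg (pcoef x s)"
| "pcoef x (MMul s t) = tmul (pcoef x s) (pcoef x t)"

text \<open>Eliminates a leading term: c times the polynomial \<open>c' # cs'\<close> minus c' X^k
  times \<open>c # cs\<close>, where k is the difference of the lengths. The leading coefficients
  agree in value and cancel, so only the tails are combined.\<close>

definition tstep :: "mt \<Rightarrow> mt list \<Rightarrow> mt \<Rightarrow> mt list \<Rightarrow> mt list"
  where "tstep c cs c' cs' = map2 (\<lambda>s' s. MAdd (MMul c s') (MNeg (MMul c' s))) cs'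
    (cs @ replicate (length cs' - length cs) MZero)"

lemma length_tstep [simp]: "length cs \<le> length cs' \<Longrightarrow> length (tstep c cs c' cs') = length cs'"
  by (simp add: tstep_def)

text \<open>Pseudo-remainder on division by \<open>c # cs\<close>.\<close>

function prem :: "mt \<Rightarrow> mt list \<Rightarrow> mt list \<Rightarrow> mt list" where
  "prem c cs g = (if length g \<le> length cs then g else prem c cs (tstep c cs (hd g) (tl g)))"
  by auto
termination
proof (relation "measure (\<lambda>(c, cs, g). length g)")
  fix c and cs g :: "mt list" assume "\<not> length g \<le> length cs"
  then have "length g > 0" "length cs \<le> length (tl g)" by auto
  then show "((c, cs, tstep c cs (hd g) (tl g)), c, cs, g) \<in> measure (\<lambda>(c, cs, g). length g)"
    by simp
qed simp

declare prem.simps [simp del]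

lemma length_prem: "length (prem c cs g) \<le> length cs"
proof (induction c cs g rule: prem.induct)
  case (1 c cs g)
  then show ?case by (cases "length g \<le> length cs") (simp_all add: prem.simps[of c cs g])
qed

context cring
begin

lemma mval_closed:
  "range e \<subseteq> carrier R \<Longrightarrow> range z \<subseteq> carrier R \<Longrightarrow> mval e z t \<in> carrier R"
  by (induction t) auto

context
  fixes e z :: "nat \<Rightarrow> 'a" assumes ez: "range e \<subseteq> carrier R" "range z \<subseteq> carrier R"
begin

lemma mval_in_carrier [simp]: "mval e z t \<in> carrier R"
  using mval_closed ez by blast

abbreviation pev :: "mt list \<Rightarrow> 'a \<Rightarrow> 'a"
  where "pev p \<equiv> eval (map (mval e z) p)"

lemma mval_image_subset [simp]: "mval e z ` A \<subseteq> carrier R"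
  by auto

lemma pev_closed [simp]: "a \<in> carrier R \<Longrightarrow> pev p a \<in> carrier R"
  by (rule eval_in_carrier) auto

lemma pev_pad:
  assumes "a \<in> carrier R" shows "pev (replicate n MZero @ p) a = pev p a"
  using eval_replicate[of "map (mval e z) p" a n] assms by simp

lemma pev_map2_add:
  assumes "length p = length q" "a \<in> carrier R"
  shows "pev (map2 MAdd p q) a = pev p a \<oplus> pev q a"
  using assms(1)
proof (induction p q rule: list_induct2)
  case (Cons s p t q)
  have "(u \<oplus> v) \<otimes> y \<oplus> (b \<oplus> c) = (u \<otimes> y \<oplus> b) \<oplus> (v \<otimes> y \<oplus> c)"
    if "u \<in> carrier R" "v \<in> carrier R" "y \<in> carrier R" "b \<in> carrier R" "c \<in> carrier R" for u v y b c
    using that by algebra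
  then show ?case using Cons assms(2) by simp
qed simp

lemma pev_tadd:
  assumes "a \<in> carrier R" shows "pev (tadd p q) a = pev p a \<oplus> pev q a"
  unfolding tadd_def using assms by (subst pev_map2_add) (auto simp: pev_pad simp del: map_append map_replicate)

lemma pev_MMul:
  assumes "a \<in> carrier R" shows "pev (map (MMul c) q) a = mval e z c \<otimes> pev q a"
  using assms by (induction q) (auto simp: r_distr m_assoc)

lemma pev_MNeg:
  assumes "a \<in> carrier R" shows "pev (map MNeg q) a = \<ominus> pev q a"
  using assms by (induction q) (auto simp: l_minus minus_add)

lemma pev_shift:
  assumes "a \<in> carrier R" shows "pev (p @ replicate n MZero) a = pev p a \<otimes> a [^] n"
proof -
  have "eval (map (mval e z) p @ replicate n \<zero>) a = pev p a \<otimes> a [^] n \<oplus> eval (replicate n \<zero>) a"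
    using assms by (subst eval_append) auto
  moreover have "eval (replicate n \<zero>) a = \<zero>" using assms by (intro eval_zero_list) auto
  ultimately show ?thesis using assms by simp
qed

lemma pev_tmul:
  assumes a: "a \<in> carrier R" shows "pev (tmul p q) a = pev p a \<otimes> pev q a"
proof (induction p)
  case (Cons c cs)
  have "(mval e z c \<otimes> pev q a) \<otimes> y \<oplus> b \<otimes> pev q a = (mval e z c \<otimes> y \<oplus> b) \<otimes> pev q a"
    if "y \<in> carrier R" "b \<in> carrier R" for y b
    using that pev_closed[OF a, of q] mval_in_carrier[of c] by algebra
  then show ?case using Cons a by (simp add: pev_tadd pev_shift pev_MMul del: map_append map_replicate map_map)
qed (use a in simp)

lemma pev_tpow:
  assumes a: "a \<in> carrier R" shows "pev (tpow p n) a = pev p a [^] n"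
  by (induction n) (use a in \<open>auto simp: pev_tmul m_comm\<close>)

lemma pev_tstep:
  assumes a: "a \<in> carrier R" and le: "length cs \<le> length cs'"
  shows "pev (tstep c cs c' cs') a = mval e z c \<otimes> pev (c' # cs') a \<ominus>
    (mval e z c' \<otimes> a [^] (length cs' - length cs)) \<otimes> pev (c # cs) a"
proof -
  let ?k = "length cs' - length cs"
  have aux: "pev (map2 (\<lambda>s' s. MAdd (MMul c s') (MNeg (MMul c' s))) p q) a =
      mval e z c \<otimes> pev p a \<ominus> mval e z c' \<otimes> pev q a" if "length p = length q" for p q
    using that
  proof (induction p q rule: list_induct2)
    case Nil
    then show ?case using a by (simp add: minus_eq)
  next
    case (Cons s p t q)
    have "(C \<otimes> u \<oplus> \<ominus> (C' \<otimes> v)) \<otimes> y \<oplus> (C \<otimes> b \<ominus> C' \<otimes> d) = C \<otimes> (u \<otimes> y \<oplus> b) \<ominus> C' \<otimes> (v \<otimes> y \<oplus> d)"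
      if "u \<in> carrier R" "v \<in> carrier R" "y \<in> carrier R" "b \<in> carrier R" "d \<in> carrier R"
         "C \<in> carrier R" "C' \<in> carrier R" for u v y b d C C'
      using that by algebra
    then show ?case using Cons a by simp
  qed
  have "pev (tstep c cs c' cs') a = mval e z c \<otimes> pev cs' a \<ominus> mval e z c' \<otimes> (pev cs a \<otimes> a [^] ?k)"
    unfolding tstep_def using a le by (subst aux) (auto simp: pev_shift simp del: map_append map_replicate)
  moreover have "C \<otimes> p' \<ominus> C' \<otimes> (p \<otimes> y) = C \<otimes> (C' \<otimes> (x \<otimes> y) \<oplus> p') \<ominus> (C' \<otimes> y) \<otimes> (C \<otimes> x \<oplus> p)"
    if "C \<in> carrier R" "C' \<in> carrier R" "p \<in> carrier R" "p' \<in> carrier R" "y \<in> carrier R" "x \<in> carrier R"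
    for C C' p p' x y
    using that by algebra
  moreover have "a [^] length cs \<otimes> a [^] ?k = a [^] length cs'" using a le by (simp add: nat_pow_mult)
  ultimately show ?thesis using a by (simp) (metis mval_in_carrier pev_closed nat_pow_closed)
qed

lemma pev_pcoef:
  assumes a: "a \<in> carrier R"
  shows "mval (e(x := a)) z t = pev (pcoef x t) a"
proof (induction t)
  case (MV y)
  then show ?case using a mval_in_carrier[of "MV y"] by auto
next
  case (PV i)
  then show ?case using a mval_in_carrier[of "PV i"] by auto
qed (use a in \<open>auto simp: pev_tadd pev_tmul pev_MNeg simp del: map_map\<close>)

text \<open>The pseudo-division identity c^m g = r + s h. Each \<open>tstep\<close> costs one factor
  c and adds one monomial to the quotient s; as the quotient serves only to prove correctness, it is
  a list of ring elements and not of terms.\<close>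

lemma pev_prem:
  "\<exists>m::nat. \<exists>s. set s \<subseteq> carrier R \<and> (\<forall>a\<in>carrier R.
    pev (prem c cs g) a \<oplus> eval s a \<otimes> pev (c # cs) a = mval e z c [^] m \<otimes> pev g a)"
proof (induction c cs g rule: prem.induct)
  case (1 c cs g)
  show ?case
  proof (cases "length g \<le> length cs")
    case True
    then show ?thesis by (intro exI[of _ 0] exI[of _ "[]"]) (simp add: prem.simps)
  next
    case False
    obtain m s where ms: "set s \<subseteq> carrier R" "\<And>a. a \<in> carrier R \<Longrightarrow>
      pev (prem c cs (tstep c cs (hd g) (tl g))) a \<oplus> eval s a \<otimes> pev (c # cs) a =
        mval e z c [^] (m::nat) \<otimes> pev (tstep c cs (hd g) (tl g)) a"
      using 1[OF False] by blast
    have g: "g = hd g # tl g" "length cs \<le> length (tl g)" using False by (cases g; auto)+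
    let ?k = "length (tl g) - length cs"
    let ?t = "monom (mval e z c [^] m \<otimes> mval e z (hd g)) ?k"
    have t: "set ?t \<subseteq> carrier R" by (intro monom_in_carrier) auto
    show ?thesis
    proof (intro exI[of _ "Suc m"] exI[of _ "poly_add s ?t"] conjI ballI)
      show "set (poly_add s ?t) \<subseteq> carrier R" using poly_add_in_carrier[OF ms(1) t] .
      fix a assume a: "a \<in> carrier R"
      have es: "eval s a \<in> carrier R" using ms(1) a by (rule eval_in_carrier)
      have et: "eval ?t a = (mval e z c [^] m \<otimes> mval e z (hd g)) \<otimes> a [^] ?k" using a by (intro eval_monom) auto
      have "P \<oplus> (S \<oplus> (Cm \<otimes> C') \<otimes> y) \<otimes> H = (Cm \<otimes> C) \<otimes> G"
        if "P \<oplus> S \<otimes> H = Cm \<otimes> (C \<otimes> G \<ominus> (C' \<otimes> y) \<otimes> H)" 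
          "P \<in> carrier R" "S \<in> carrier R" "H \<in> carrier R" "Cm \<in> carrier R" "C \<in> carrier R"
          "G \<in> carrier R" "C' \<in> carrier R" "y \<in> carrier R" for P S H Cm C G C' y
      proof -
        have "P \<oplus> (S \<oplus> (Cm \<otimes> C') \<otimes> y) \<otimes> H = (P \<oplus> S \<otimes> H) \<oplus> ((Cm \<otimes> C') \<otimes> y) \<otimes> H"
          using that(2-) by algebra
        also have "\<dots> = (Cm \<otimes> C) \<otimes> G" unfolding that(1) using that(2-) by algebra
        finally show ?thesis .
      qed
      note key = this
      have "pev (prem c cs g) a = pev (prem c cs (tstep c cs (hd g) (tl g))) a"
        using False by (simp add: prem.simps[of c cs g])
      moreover have "pev (tstep c cs (hd g) (tl g)) a =
          mval e z c \<otimes> pev g a \<ominus> (mval e z (hd g) \<otimes> a [^] ?k) \<otimes> pev (c # cs) a"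
        using pev_tstep[OF a g(2), of c "hd g"] g(1) by metis
      moreover have "eval (poly_add s ?t) a = eval s a \<oplus> eval ?t a" using eval_poly_add[OF ms(1) t a] .
      ultimately show "pev (prem c cs g) a \<oplus> eval (poly_add s ?t) a \<otimes> pev (c # cs) a =
          mval e z c [^] Suc m \<otimes> pev g a"
        using key[OF ms(2)[OF a, unfolded \<open>pev (tstep c cs (hd g) (tl g)) a = _\<close>]] a es et
        by (simp del: eval.simps list.map)
    qed
  qed
qed

end

end

section \<open>A one-variable Nullstellensatz and the remainder criterion\<close>

context algebraically_closed
begin

lemma poly_eqI:
  assumes p: "p \<in> carrier (poly_ring L)" and q: "q \<in> carrier (poly_ring L)"
    and eq: "\<And>a. a \<in> carrier L \<Longrightarrow> eval p a = eval q a"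
  shows "p = q"
proof -
  let ?P = "poly_ring L"
  interpret P: domain ?P using univ_poly_is_domain[OF carrier_is_subring] .
  define d where "d = p \<oplus>\<^bsub>?P\<^esub> (\<ominus>\<^bsub>?P\<^esub> q)"
  have d: "d \<in> carrier ?P" using p q by (simp add: d_def)
  have "eval d a = \<zero>" if a: "a \<in> carrier L" for a
  proof -
    interpret h: ring_hom_ring ?P L "\<lambda>p. eval p a" using eval_ring_hom[OF carrier_is_subring a] .
    have "eval q a \<in> carrier L" using q h.hom_closed by blast
    then show ?thesis using p q eq[OF a] unfolding d_def by (simp add: r_neg)
  qed
  then have "d \<noteq> [] \<Longrightarrow> carrier L \<subseteq> {x. is_root d x}" by (auto simp: is_root_def)
  then have "d = []" using finite_number_of_roots[OF d] infinite_carrier finite_subset by blast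
  then have "d = \<zero>\<^bsub>?P\<^esub>" by (simp add: univ_poly_zero)
  then show ?thesis unfolding d_def using p q by (metis P.add.inv_closed P.minus_equality P.minus_minus P.a_comm)
qed

text \<open>A Nullstellensatz with explicit exponent: p splits into \<open>degree p\<close> linear
  factors, and each of them divides g because each root of p is a root of g.\<close>

lemma pdivides_power:
  assumes "p \<in> carrier (poly_ring L)" "p \<noteq> []" and g: "g \<in> carrier (poly_ring L)"
    and "\<And>a. a \<in> carrier L \<Longrightarrow> eval p a = \<zero> \<Longrightarrow> eval g a = \<zero>"
  shows "p pdivides (g [^]\<^bsub>poly_ring L\<^esub> degree p)"
  using assms(1,2,4)
proof (induction "degree p" arbitrary: p)
  case 0
  let ?P = "poly_ring L"
  interpret P: domain ?P using univ_poly_is_domain[OF carrier_is_subring] .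
  have "p \<in> Units ?P" using univ_poly_units'[OF carrier_is_subfield] 0 by simp
  then have "p divides\<^bsub>?P\<^esub> (g [^]\<^bsub>?P\<^esub> degree p)" using g by (intro P.unit_divides) auto
  then show ?case by (simp add: pdivides_def)
next
  case (Suc d)
  let ?P = "poly_ring L"
  interpret P: domain ?P using univ_poly_is_domain[OF carrier_is_subring] .
  have "size (roots p) = degree p" using roots_over_carrier[OF Suc.prems(1)] by (simp add: splitted_def)
  then have ne: "roots p \<noteq> {#}" using Suc.hyps(2) by auto
  obtain a where a: "a \<in> carrier L" "a \<in># roots p" "[\<one>, \<ominus> a] \<in> carrier ?P" "[\<one>, \<ominus> a] pdivides p"
    using not_empty_rootsE[OF Suc.prems(1) ne] by metis
  let ?l = "[\<one>, \<ominus> a]"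
  obtain q where q: "q \<in> carrier ?P" "p = ?l \<otimes>\<^bsub>?P\<^esub> q" using a(4) unfolding pdivides_def factor_def by blast
  have q0: "q \<noteq> []" using q Suc.prems(2) poly_mult_zero(2)[of ?l] a by (auto simp: univ_poly_mult)
  have hom: "eval (f \<otimes>\<^bsub>?P\<^esub> g) x = eval f x \<otimes> eval g x"
    if "f \<in> carrier ?P" "g \<in> carrier ?P" "x \<in> carrier L" for f g x
    using ring_hom_mult[OF eval_is_hom[OF carrier_is_subring that(3)] that(1,2)] .
  have "degree p = degree ?l + degree q"
    using poly_mult_degree_eq[OF carrier_is_subring, of ?l q] a(3) q q0
    by (simp add: univ_poly_carrier univ_poly_mult)
  then have dq: "d = degree q" using Suc.hyps(2) by simp
  have "eval g x = \<zero>" if "x \<in> carrier L" "eval q x = \<zero>" for x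
    using Suc.prems(3)[OF that(1)] hom[OF a(3) q(1) that(1)] that q(2) a(1) by simp
  then have IH: "q pdivides (g [^]\<^bsub>?P\<^esub> d)" using Suc.hyps(1)[OF dq q(1) q0] dq by simp
  have pa: "eval p a = \<zero>" using a(2) roots_mem_iff_is_root[OF Suc.prems(1)] by (simp add: is_root_def)
  have lg: "?l pdivides g"
  proof (cases "g = []")
    case True
    then show ?thesis using pdivides_zero[OF carrier_is_subring a(3)] by simp
  next
    case False
    then have "is_root g a" using Suc.prems(3)[OF a(1) pa] a(1) by (simp add: is_root_def)
    then have "alg_mult g a > 0" using alg_mult_gt_zero_iff_is_root[OF g] by simp
    then show ?thesis using le_alg_mult_imp_pdivides[OF a(1) g, of 1] a(3) by simp
  qed
  have "(?l \<otimes>\<^bsub>?P\<^esub> q) divides\<^bsub>?P\<^esub> (g \<otimes>\<^bsub>?P\<^esub> g [^]\<^bsub>?P\<^esub> d)"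
  proof -
    have "(?l \<otimes>\<^bsub>?P\<^esub> q) divides\<^bsub>?P\<^esub> (?l \<otimes>\<^bsub>?P\<^esub> g [^]\<^bsub>?P\<^esub> d)"
      using IH a(3) q(1) g unfolding pdivides_def by (intro P.divides_mult_lI) auto
    moreover have "(?l \<otimes>\<^bsub>?P\<^esub> g [^]\<^bsub>?P\<^esub> d) divides\<^bsub>?P\<^esub> (g \<otimes>\<^bsub>?P\<^esub> g [^]\<^bsub>?P\<^esub> d)"
      using lg a(3) g unfolding pdivides_def by (intro P.divides_mult_rI) auto
    ultimately show ?thesis using P.divides_trans a(3) q(1) g by blast
  qed
  moreover have "g [^]\<^bsub>?P\<^esub> degree p = g \<otimes>\<^bsub>?P\<^esub> g [^]\<^bsub>?P\<^esub> d"
    using Suc.hyps(2) g P.nat_pow_Suc2 by metis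
  ultimately show ?case using q(2) by (simp add: pdivides_def)
qed

lemma remainder_solve:
  assumes "h \<otimes> t = y" "r \<oplus> s \<otimes> h = k \<otimes> y" "h \<in> carrier L" "t \<in> carrier L" "r \<in> carrier L"
    "s \<in> carrier L" "k \<in> carrier L"
  shows "r = h \<otimes> (k \<otimes> t \<oplus> \<ominus> s)"
proof -
  have "r = (r \<oplus> s \<otimes> h) \<ominus> s \<otimes> h" using assms(3-) by algebra
  also have "\<dots> = k \<otimes> (h \<otimes> t) \<ominus> s \<otimes> h" using assms(1,2) by simp
  also have "\<dots> = h \<otimes> (k \<otimes> t \<oplus> \<ominus> s)" using assms(3-) by algebra
  finally show ?thesis .
qed

lemma normalize_in_poly_ring:
  "set p \<subseteq> carrier L \<Longrightarrow> normalize p \<in> carrier (poly_ring L)"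
  using normalize_gives_polynomial univ_poly_carrier by blast

text \<open>Let h be the polynomial \<open>c # cs\<close>; its degree is \<open>length cs\<close>
  because c does not vanish. All roots of h are roots of g exactly when h divides the power of g
  with exponent \<open>length cs\<close>, that is, when the pseudo-remainder vanishes
  coefficientwise.\<close>

lemma pev_prem_zero_iff:
  assumes ez: "range e \<subseteq> carrier L" "range z \<subseteq> carrier L" and c: "mval e z c \<noteq> \<zero>"
  shows "(\<exists>a\<in>carrier L. pev e z (c # cs) a = \<zero> \<and> pev e z g a \<noteq> \<zero>) \<longleftrightarrow>
    (\<exists>t\<in>set (prem c cs (tpow g (length cs))). mval e z t \<noteq> \<zero>)"
    (is "?L \<longleftrightarrow> ?R")
proof -
  let ?P = "poly_ring L"
  interpret P: domain ?P using univ_poly_is_domain[OF carrier_is_subring] .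
  let ?d = "length cs"
  let ?r = "prem c cs (tpow g ?d)"
  let ?H = "map (mval e z) (c # cs)" and ?G = "normalize (map (mval e z) g)"
  note mc = mval_closed[OF ez]
  obtain m :: nat and s where s: "set s \<subseteq> carrier L" "\<And>a. a \<in> carrier L \<Longrightarrow>
    pev e z ?r a \<oplus> eval s a \<otimes> eval ?H a = mval e z c [^] m \<otimes> pev e z (tpow g ?d) a"
    using pev_prem[OF ez, of c cs "tpow g ?d"] by blast
  have H: "?H \<in> carrier ?P" using c mc by (auto simp: univ_poly_carrier[symmetric] polynomial_def)
  have G: "?G \<in> carrier ?P" using mc by (intro normalize_in_poly_ring) auto
  have evG: "eval ?G a = pev e z g a" if "a \<in> carrier L" for a
    using eval_normalize[of "map (mval e z) g" a] that mc by auto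
  have cm: "mval e z c [^] m \<noteq> \<zero>" "mval e z c [^] m \<in> carrier L" using c mc by (induction m) (auto simp: integral_iff)
  have pow: "pev e z (tpow g ?d) a = pev e z g a [^] ?d" if "a \<in> carrier L" for a
    using pev_tpow[OF ez that] .
  have Hc: "eval ?H a \<in> carrier L" "eval s a \<in> carrier L" "pev e z g a \<in> carrier L" "pev e z ?r a \<in> carrier L"
    if "a \<in> carrier L" for a
    using that pev_closed[OF ez that] s(1) eval_in_carrier by blast+
  show ?thesis
  proof
    assume ?L
    then obtain a where a: "a \<in> carrier L" "eval ?H a = \<zero>" "pev e z g a \<noteq> \<zero>" by blast
    show ?R
    proof (rule ccontr)
      assume "\<not> ?R"
      then have "pev e z ?r a = \<zero>" using a(1) by (intro eval_zero_list) auto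
      then have "mval e z c [^] m \<otimes> pev e z g a [^] ?d = \<zero>" using s(2)[OF a(1)] a Hc pow by simp
      moreover have "pev e z g a [^] (n::nat) \<noteq> \<zero>" for n
        using a(3) Hc(3)[OF a(1)] by (induction n) (auto simp: integral_iff)
      ultimately show False using cm integral_iff Hc[OF a(1)] by simp
    qed
  next
    assume ?R
    show ?L
    proof (rule ccontr)
      assume "\<not> ?L"
      then have "eval ?G a = \<zero>" if "a \<in> carrier L" "eval ?H a = \<zero>" for a using that evG by auto
      then have "?H pdivides (?G [^]\<^bsub>?P\<^esub> degree ?H)" using pdivides_power[OF H _ G] by simp
      then obtain t where t: "t \<in> carrier ?P" "?G [^]\<^bsub>?P\<^esub> ?d = ?H \<otimes>\<^bsub>?P\<^esub> t"
        unfolding pdivides_def factor_def by auto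
      define S where "S = normalize s"
      have S: "S \<in> carrier ?P" using normalize_in_poly_ring[OF s(1)] by (simp add: S_def)
      define C where "C = [mval e z c [^] m]"
      have C: "C \<in> carrier ?P" using cm by (auto simp: C_def univ_poly_carrier[symmetric] polynomial_def)
      let ?u = "C \<otimes>\<^bsub>?P\<^esub> t \<oplus>\<^bsub>?P\<^esub> (\<ominus>\<^bsub>?P\<^esub> S)"
      have u: "?u \<in> carrier ?P" using C t S by simp
      let ?N = "normalize (map (mval e z) ?r)"
      have N: "?N \<in> carrier ?P" using mc by (intro normalize_in_poly_ring) auto
      have "?N = ?H \<otimes>\<^bsub>?P\<^esub> ?u"
      proof (rule poly_eqI[OF N])
        show "?H \<otimes>\<^bsub>?P\<^esub> ?u \<in> carrier ?P" using H u by simp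
        fix a assume a: "a \<in> carrier L"
        interpret h: ring_hom_cring ?P L "\<lambda>p. eval p a" using eval_cring_hom[OF carrier_is_subring a] .
        have eC: "eval C a = mval e z c [^] m" using cm a by (simp add: C_def)
        have eS: "eval S a = eval s a" using eval_normalize[OF s(1) a] by (simp add: S_def)
        have ta: "eval t a \<in> carrier L" using t(1) h.hom_closed by blast
        have "eval (?G [^]\<^bsub>?P\<^esub> ?d) a = pev e z g a [^] ?d" using G evG[OF a] h.hom_pow by simp
        then have "eval ?H a \<otimes> eval t a = pev e z g a [^] ?d" using t H by (metis h.hom_mult)
        moreover have "pev e z ?r a \<oplus> eval s a \<otimes> eval ?H a = mval e z c [^] m \<otimes> pev e z g a [^] ?d"
          using s(2)[OF a] pow[OF a] by simp
        ultimately have "pev e z ?r a = eval ?H a \<otimes> (mval e z c [^] m \<otimes> eval t a \<oplus> \<ominus> eval s a)"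
          using Hc[OF a] ta cm(2) by (intro remainder_solve)
        moreover have "eval ?N a = pev e z ?r a"
          using eval_normalize[of "map (mval e z) ?r" a] a mc by auto
        moreover have "eval (?H \<otimes>\<^bsub>?P\<^esub> ?u) a = eval ?H a \<otimes> (mval e z c [^] m \<otimes> eval t a \<oplus> \<ominus> eval s a)"
          using H C t(1) S eC eS by (simp del: eval.simps list.map)
        ultimately show "eval ?N a = eval (?H \<otimes>\<^bsub>?P\<^esub> ?u) a" by simp
      qed
      moreover have "?N \<noteq> []"
        using \<open>?R\<close> by (auto simp: normalize_eq_Nil_iff)
      ultimately have "?u \<noteq> []" using poly_mult_zero(2)[of ?H] mc
        by (metis H univ_poly_mult polynomial_in_carrier univ_poly_carrier carrier_is_subring)
      \<comment> \<open>A nonzero remainder divisible by \<open>?H\<close> has degree at least that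
        of \<open>?H\<close>, which is impossible with at most \<open>length cs\<close>
        coefficients.\<close>
      then have "degree ?N = degree ?H + degree ?u"
        using poly_mult_degree_eq[OF carrier_is_subring, of ?H ?u] H u \<open>?N = _\<close>
        by (simp add: univ_poly_carrier univ_poly_mult)
      moreover have "length ?N \<le> length cs"
        using normalize_length_le[of "map (mval e z) ?r"] length_prem[of c cs "tpow g ?d"] by simp
      moreover have "length ?N > 0" using \<open>?N \<noteq> []\<close> by simp
      moreover have "degree ?H = length cs" by simp
      ultimately show False by linarith
    qed
  qed
qed

text \<open>Bounding by the raw length gives a number that later depends only on the terms and not
  on the model.\<close>

lemma card_roots_le:
  assumes "set p \<subseteq> carrier L" "\<not> set p \<subseteq> {\<zero>}"
  shows "card {x \<in> carrier L. eval p x = \<zero>} \<le> length p"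
proof -
  let ?n = "normalize p"
  have n: "?n \<in> carrier (poly_ring L)" "?n \<noteq> []"
    using assms normalize_in_poly_ring by (auto simp: normalize_eq_Nil_iff)
  have "{x \<in> carrier L. eval p x = \<zero>} = set_mset (roots ?n)"
    using roots_mem_iff_is_root[OF n(1)] n(2) eval_normalize[OF assms(1)] by (auto simp: is_root_def)
  also have "card \<dots> \<le> size (roots ?n)"
    by (metis card_mono finite_set_mset mset_set_set_mset_msubset size_mset_mono size_mset_set)
  also have "\<dots> \<le> degree ?n" using size_roots_le_degree[OF n(1)] .
  also have "\<dots> \<le> length p" using normalize_length_le[of p] by linarith
  finally show ?thesis .
qed

end

section \<open>Models of the theory of pairs\<close>

lemma valid_Forall:
  "valid M (Forall x \<phi>) \<longleftrightarrow> valid M \<phi>"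
proof
  assume v: "valid M (Forall x \<phi>)"
  show "valid M \<phi>" unfolding valid_def
  proof (intro allI impI)
    fix e :: "nat \<Rightarrow> 'c" assume e: "range e \<subseteq> universe M"
    then have "sat M e (Forall x \<phi>)" using v by (simp add: valid_def)
    moreover have "e x \<in> universe M" using e by blast
    ultimately show "sat M e \<phi>" by (metis fun_upd_triv sat.simps(4,6))
  qed
next
  assume v: "valid M \<phi>"
  show "valid M (Forall x \<phi>)" unfolding valid_def
  proof (intro allI impI)
    fix e :: "nat \<Rightarrow> 'c" assume e: "range e \<subseteq> universe M"
    then have "sat M (e(x := a)) \<phi>" if "a \<in> universe M" for a
      using v that unfolding valid_def by (auto simp: image_subset_iff)
    then show "sat M e (Forall x \<phi>)" by simp
  qed
qed

lemma valid_Foralls: "valid M (Foralls xs \<phi>) \<longleftrightarrow> valid M \<phi>"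
  by (induction xs) (simp_all add: Foralls_def valid_Forall)

lemma sat_Existss:
  assumes "range e \<subseteq> universe M"
  shows "sat M e (Existss xs \<phi>) \<longleftrightarrow>
    (\<exists>d. range d \<subseteq> universe M \<and> (\<forall>i. i \<notin> set xs \<longrightarrow> d i = e i) \<and> sat M d \<phi>)"
  using assms
proof (induction xs arbitrary: e)
  case Nil
  have "d = e" if "\<forall>i. d i = e i" for d using that by auto
  then show ?case using Nil by (auto simp: Existss_def)
next
  case (Cons x xs)
  have eq: "sat M e (Existss (x # xs) \<phi>) \<longleftrightarrow> (\<exists>a\<in>universe M. sat M (e(x := a)) (Existss xs \<phi>))"
    by (simp add: Existss_def)
  have r: "range (e(x := a)) \<subseteq> universe M" if "a \<in> universe M" for a
    using Cons.prems that by auto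
  show ?case unfolding eq
  proof
    assume "\<exists>a\<in>universe M. sat M (e(x := a)) (Existss xs \<phi>)"
    then obtain a where a: "a \<in> universe M" "sat M (e(x := a)) (Existss xs \<phi>)" by blast
    then obtain d where "range d \<subseteq> universe M" "\<forall>i. i \<notin> set xs \<longrightarrow> d i = (e(x := a)) i" "sat M d \<phi>"
      using Cons.IH[OF r[OF a(1)]] by blast
    then show "\<exists>d. range d \<subseteq> universe M \<and> (\<forall>i. i \<notin> set (x # xs) \<longrightarrow> d i = e i) \<and> sat M d \<phi>"
      by (intro exI[of _ d]) auto
  next
    assume "\<exists>d. range d \<subseteq> universe M \<and> (\<forall>i. i \<notin> set (x # xs) \<longrightarrow> d i = e i) \<and> sat M d \<phi>"
    then obtain d where d: "range d \<subseteq> universe M" "\<forall>i. i \<notin> set (x # xs) \<longrightarrow> d i = e i" "sat M d \<phi>" by blast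
    have dx: "d x \<in> universe M" using d(1) by blast
    have "sat M (e(x := d x)) (Existss xs \<phi>)"
      unfolding Cons.IH[OF r[OF dx]] using d by (intro exI[of _ d]) auto
    then show "\<exists>a\<in>universe M. sat M (e(x := a)) (Existss xs \<phi>)" using dx by blast
  qed
qed

lemma sat_Foralls:
  assumes "range e \<subseteq> universe M"
  shows "sat M e (Foralls xs \<phi>) \<longleftrightarrow>
    (\<forall>d. range d \<subseteq> universe M \<and> (\<forall>i. i \<notin> set xs \<longrightarrow> d i = e i) \<longrightarrow> sat M d \<phi>)"
proof -
  have "sat M d (Foralls xs \<phi>) \<longleftrightarrow> \<not> sat M d (Existss xs (Neg \<phi>))" for d
    by (induction xs arbitrary: d) (auto simp: Foralls_def Existss_def)
  then show ?thesis using sat_Existss[OF assms, of xs "Neg \<phi>"] by (metis sat.simps(4))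
qed

lemma sat_Conjs: "sat M e (Conjs \<phi>s) \<longleftrightarrow> (\<forall>\<phi>\<in>set \<phi>s. sat M e \<phi>)"
  by (induction \<phi>s) (auto simp: Conjs_def)

lemma sat_all_in_P: "sat M e (all_in_P xs) \<longleftrightarrow> (\<forall>x\<in>set xs. rint M InP [e x])"
  by (simp add: all_in_P_def sat_Conjs)

lemma old_fm_Foralls: "old_fm (Foralls xs \<phi>) = Foralls xs (old_fm \<phi>)"
  by (induction xs) (auto simp: Foralls_def)

type_synonym ('f, 'r, 'm) pair = "('f rfun pfun, 'r prel, 'm) fo_structure"

text \<open>The ring record has no slot for negation, which HOL-Algebra derives from addition;
  \<open>minus_eq_a_inv\<close> reconciles it with the function symbol.\<close>

definition rg :: "('f, 'r, 'm) pair \<Rightarrow> 'm ring"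
  where "rg M = \<lparr>carrier = universe M,
    monoid.mult = (\<lambda>a b. fint M (OldF (Ring RTimes)) [a, b]), one = fint M (OldF (Ring ROne)) [],
    zero = fint M (OldF (Ring RZero)) [], add = (\<lambda>a b. fint M (OldF (Ring RPlus)) [a, b])\<rparr>"

definition P_of :: "('f, 'r, 'm) pair \<Rightarrow> 'm set"
  where "P_of M = {a \<in> universe M. rint M InP [a]}"

definition P_structure :: "('f, 'r, 'm) pair \<Rightarrow> ('f rfun, 'r, 'm) fo_structure"
  where "P_structure M = \<lparr>universe = P_of M, fint = (\<lambda>f. fint M (OldF f)), rint = (\<lambda>r. rint M (OldR r))\<rparr>"

lemma rg_sel:
  "carrier (rg M) = universe M"
  "a \<otimes>\<^bsub>rg M\<^esub> b = fint M (OldF (Ring RTimes)) [a, b]"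
  "a \<oplus>\<^bsub>rg M\<^esub> b = fint M (OldF (Ring RPlus)) [a, b]"
  "\<one>\<^bsub>rg M\<^esub> = fint M (OldF (Ring ROne)) []"
  "\<zero>\<^bsub>rg M\<^esub> = fint M (OldF (Ring RZero)) []"
  by (simp_all add: rg_def)

lemma eval_old_t: "eval M e (old_t t) = eval \<lparr>universe = U, fint = (\<lambda>f. fint M (OldF f)), rint = S\<rparr> e t"
  by (induction t) (auto simp: comp_def intro!: arg_cong[of _ _ "fint M _"])

lemma eval_P_structure: "eval (P_structure M) e t = eval M e (old_t t)"
  unfolding P_structure_def by (rule eval_old_t[symmetric])

lemma sat_relativize:
  assumes "range e \<subseteq> P_of M"
  shows "sat M e (relativize \<theta>) \<longleftrightarrow> sat (P_structure M) e \<theta>"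
  using assms
proof (induction \<theta> arbitrary: e)
  case (Exists x \<theta>)
  have "range (e(x := a)) \<subseteq> P_of M" if "a \<in> P_of M" for a using Exists.prems that by auto
  then have "sat M (e(x := a)) (relativize \<theta>) \<longleftrightarrow> sat (P_structure M) (e(x := a)) \<theta>" if "a \<in> P_of M" for a
    using Exists.IH that by blast
  then show ?case by (auto simp: P_structure_def P_of_def)
next
  case (Rel r ts)
  have "map (eval M e) (map old_t ts) = map (eval (P_structure M) e) ts" by (simp add: eval_P_structure)
  then show ?case by (simp add: P_structure_def del: map_map)
qed (auto simp: eval_P_structure)

locale field_pairs =
  fixes L :: "('f rfun, 'r) language" and T :: "('f rfun, 'r) fm set"
  assumes theory_fields: "theory_of_fields L T" and qe: "has_qe L T"

locale pair_model = field_pairs L T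
  for L :: "('f rfun, 'r) language" and T :: "('f rfun, 'r) fm set" +
  fixes M :: "('f, 'r, 'm) pair"
  assumes model: "is_model (L_f L) (ACF_T_f L T) M"
begin

abbreviation R where "R \<equiv> rg M"
abbreviation U where "U \<equiv> universe M"
abbreviation K where "K \<equiv> P_of M"

lemma ext: "extends_L_rings L" and is_th: "is_theory L T"
  using theory_fields by (auto simp: theory_of_fields_def)

lemma ax: "\<theta> \<in> ACF_T_f L T \<Longrightarrow> range e \<subseteq> U \<Longrightarrow> sat M e \<theta>"
  using model by (auto simp: is_model_def valid_def)

lemma ax_Foralls: "Foralls xs \<theta> \<in> ACF_T_f L T \<Longrightarrow> range e \<subseteq> U \<Longrightarrow> sat M e \<theta>"
  using model valid_Foralls[of M xs \<theta>] by (auto simp: is_model_def valid_def)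

lemma fun_closed:
  "f \<in> funs L \<Longrightarrow> length as = farity L f \<Longrightarrow> set as \<subseteq> U \<Longrightarrow> fint M (OldF f) as \<in> U"
  using model by (auto simp: is_model_def is_structure_def L_f_def L_ld_def L_P_def)

lemma ring_closed:
  "fint M (OldF (Ring RZero)) [] \<in> U" "fint M (OldF (Ring ROne)) [] \<in> U"
  "a \<in> U \<Longrightarrow> fint M (OldF (Ring RMinus)) [a] \<in> U"
  "a \<in> U \<Longrightarrow> b \<in> U \<Longrightarrow> fint M (OldF (Ring RPlus)) [a, b] \<in> U"
  "a \<in> U \<Longrightarrow> b \<in> U \<Longrightarrow> fint M (OldF (Ring RTimes)) [a, b] \<in> U"
  using ext by (auto intro!: fun_closed simp: extends_L_rings_def)

text \<open>Axioms are used by stripping their universal closure and evaluating at a list of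
  arguments; the remaining variables are set to zero.\<close>

definition asg :: "'m list \<Rightarrow> nat \<Rightarrow> 'm"
  where "asg as = list_assign (fint M (OldF (Ring RZero)) []) as"

lemma asg_range: "set as \<subseteq> U \<Longrightarrow> range (asg as) \<subseteq> U"
  using ring_closed(1) by (auto simp: asg_def list_assign_def)

lemma asg_nth: "i < length as \<Longrightarrow> asg as i = as ! i"
  by (simp add: asg_def list_assign_def)

lemma map_asg: "map (asg as) [0..<length as] = as"
  by (rule nth_equalityI) (auto simp: asg_nth)

lemma field_ax:
  assumes "Foralls xs \<theta> \<in> field_axioms" "set as \<subseteq> U"
  shows "sat M (asg as) (old_fm \<theta>)"
proof (rule ax_Foralls[OF _ asg_range[OF assms(2)]])
  have "old_fm (Foralls xs \<theta>) \<in> old_fm ` ACF" using assms by (auto simp: ACF_def)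
  then show "Foralls xs (old_fm \<theta>) \<in> ACF_T_f L T"
    by (auto simp: ACF_T_f_def ACF_T_ld_def ACF_T_def old_fm_Foralls)
qed

lemma field_rg: "field R"
proof -
  have assoc: "a \<oplus>\<^bsub>R\<^esub> b \<oplus>\<^bsub>R\<^esub> c = a \<oplus>\<^bsub>R\<^esub> (b \<oplus>\<^bsub>R\<^esub> c)"
    "a \<otimes>\<^bsub>R\<^esub> b \<otimes>\<^bsub>R\<^esub> c = a \<otimes>\<^bsub>R\<^esub> (b \<otimes>\<^bsub>R\<^esub> c)"
    "a \<otimes>\<^bsub>R\<^esub> (b \<oplus>\<^bsub>R\<^esub> c) = a \<otimes>\<^bsub>R\<^esub> b \<oplus>\<^bsub>R\<^esub> a \<otimes>\<^bsub>R\<^esub> c"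
    if "a \<in> U" "b \<in> U" "c \<in> U" for a b c
    using field_ax[of "[0,1,2]" "Eq (plus_t (plus_t (Var 0) (Var 1)) (Var 2)) (plus_t (Var 0) (plus_t (Var 1) (Var 2)))" "[a,b,c]"]
      field_ax[of "[0,1,2]" "Eq (times_t (times_t (Var 0) (Var 1)) (Var 2)) (times_t (Var 0) (times_t (Var 1) (Var 2)))" "[a,b,c]"]
      field_ax[of "[0,1,2]" "Eq (times_t (Var 0) (plus_t (Var 1) (Var 2))) (plus_t (times_t (Var 0) (Var 1)) (times_t (Var 0) (Var 2)))" "[a,b,c]"]
      that by (auto simp: field_axioms_def Let_def rg_sel asg_nth)
  have comm: "a \<oplus>\<^bsub>R\<^esub> b = b \<oplus>\<^bsub>R\<^esub> a" "a \<otimes>\<^bsub>R\<^esub> b = b \<otimes>\<^bsub>R\<^esub> a"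
    if "a \<in> U" "b \<in> U" for a b
    using field_ax[of "[0,1]" "Eq (plus_t (Var 0) (Var 1)) (plus_t (Var 1) (Var 0))" "[a,b]"]
      field_ax[of "[0,1]" "Eq (times_t (Var 0) (Var 1)) (times_t (Var 1) (Var 0))" "[a,b]"]
      that by (auto simp: field_axioms_def Let_def rg_sel asg_nth)
  have unit: "a \<oplus>\<^bsub>R\<^esub> \<zero>\<^bsub>R\<^esub> = a" "a \<otimes>\<^bsub>R\<^esub> \<one>\<^bsub>R\<^esub> = a"
    "a \<oplus>\<^bsub>R\<^esub> fint M (OldF (Ring RMinus)) [a] = \<zero>\<^bsub>R\<^esub>"
    "a \<noteq> \<zero>\<^bsub>R\<^esub> \<Longrightarrow> \<exists>b\<in>U. a \<otimes>\<^bsub>R\<^esub> b = \<one>\<^bsub>R\<^esub>"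
    if "a \<in> U" for a
    using field_ax[of "[0]" "Eq (plus_t (Var 0) zero_t) (Var 0)" "[a]"]
      field_ax[of "[0]" "Eq (times_t (Var 0) one_t) (Var 0)" "[a]"]
      field_ax[of "[0]" "Eq (plus_t (Var 0) (minus_t (Var 0))) zero_t" "[a]"]
      field_ax[of "[0]" "Imp (Neg (Eq (Var 0) zero_t)) (Exists 1 (Eq (times_t (Var 0) (Var 1)) one_t))" "[a]"]
      that by (auto simp: field_axioms_def Let_def rg_sel asg_nth)
  have "Foralls [] (Neg (Eq zero_t one_t)) \<in> (field_axioms :: ('f rfun, 'r) fm set)"
    by (simp add: field_axioms_def Let_def Foralls_def)
  from field_ax[OF this, of "[]"] have ne: "\<zero>\<^bsub>R\<^esub> \<noteq> \<one>\<^bsub>R\<^esub>" by (simp add: rg_sel)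
  have cl: "\<zero>\<^bsub>R\<^esub> \<in> U" "\<one>\<^bsub>R\<^esub> \<in> U" "a \<in> U \<Longrightarrow> b \<in> U \<Longrightarrow> a \<oplus>\<^bsub>R\<^esub> b \<in> U"
    "a \<in> U \<Longrightarrow> b \<in> U \<Longrightarrow> a \<otimes>\<^bsub>R\<^esub> b \<in> U" for a b
    using ring_closed by (auto simp: rg_sel)
  have "abelian_group R"
  proof (rule abelian_groupI)
    fix x assume "x \<in> carrier R"
    then show "\<exists>y\<in>carrier R. y \<oplus>\<^bsub>R\<^esub> x = \<zero>\<^bsub>R\<^esub>"
      using unit(3) comm(1) ring_closed(3) by (metis rg_sel(1))
  qed (use cl assoc comm unit in \<open>auto simp: rg_sel(1)\<close>)
  moreover have "comm_monoid R"
    by (rule comm_monoidI) (use cl assoc comm unit in \<open>auto simp: rg_sel(1)\<close>)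
  ultimately have "cring R"
    by (rule cringI) (use cl assoc comm in \<open>auto simp: rg_sel(1)\<close>)
  then show ?thesis
    by (rule cring.cring_fieldI2) (use ne unit in \<open>auto simp: rg_sel(1)\<close>)
qed

sublocale R: field R by (rule field_rg)

lemma minus_eq_a_inv: "a \<in> U \<Longrightarrow> fint M (OldF (Ring RMinus)) [a] = \<ominus>\<^bsub>R\<^esub> a"
proof -
  assume a: "a \<in> U"
  have "a \<oplus>\<^bsub>R\<^esub> fint M (OldF (Ring RMinus)) [a] = \<zero>\<^bsub>R\<^esub>"
    using field_ax[of "[0]" "Eq (plus_t (Var 0) (minus_t (Var 0))) zero_t" "[a]"] a
    by (auto simp: field_axioms_def Let_def rg_sel asg_nth)
  then show ?thesis using a ring_closed(3)[OF a] R.minus_equality R.a_comm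
    by (metis rg_sel(1))
qed

end

section \<open>Consequences of the axioms in a model\<close>

context pair_model
begin

lemma eval_closed: "is_tm (L_f L) t \<Longrightarrow> range e \<subseteq> U \<Longrightarrow> eval M e t \<in> U"
proof (induction t)
  case (Fun f ts)
  then show ?case using model unfolding is_model_def is_structure_def
    by (auto simp: list_all_iff image_subset_iff)
qed auto

lemma ring_add_foldr:
  assumes "set l \<subseteq> carrier R" "s \<in> carrier R"
  shows "foldr (\<oplus>\<^bsub>R\<^esub>) l s = foldr (\<oplus>\<^bsub>R\<^esub>) l \<zero>\<^bsub>R\<^esub> \<oplus>\<^bsub>R\<^esub> s"
    and "foldr (\<oplus>\<^bsub>R\<^esub>) l \<zero>\<^bsub>R\<^esub> \<in> carrier R"
  using assms by (induction l) (auto simp: R.a_assoc)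

lemma eval_old_sum:
  "eval M e (old_t (sum_t ts)) = foldr (\<oplus>\<^bsub>R\<^esub>) (map (\<lambda>t. eval M e (old_t t)) ts) \<zero>\<^bsub>R\<^esub>"
  by (induction ts) (auto simp: sum_t_def rg_sel)

lemma eval_old_power:
  assumes "eval M e (old_t t) \<in> U"
  shows "eval M e (old_t (power_t t n)) = eval M e (old_t t) [^]\<^bsub>R\<^esub> n"
proof (induction n)
  case 0
  then show ?case by (simp add: power_t_def rg_sel(4)[symmetric])
next
  case (Suc n)
  have "eval M e (old_t (power_t t (Suc n))) = eval M e (old_t t) \<otimes>\<^bsub>R\<^esub> eval M e (old_t (power_t t n))"
    by (simp add: power_t_def rg_sel)
  also have "\<dots> = eval M e (old_t t) [^]\<^bsub>R\<^esub> Suc n"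
    using Suc assms R.nat_pow_Suc2 by (simp add: rg_sel(1))
  finally show ?case .
qed

text \<open>The axioms list coefficients in ascending order, \<open>eval\<close> of HOL-Algebra
  reads them in descending order; hence \<open>rev\<close>.\<close>

lemma eval_rev_foldr:
  assumes "set as \<subseteq> carrier R" "x \<in> carrier R"
  shows "foldr (\<oplus>\<^bsub>R\<^esub>) (map (\<lambda>i. as ! i \<otimes>\<^bsub>R\<^esub> x [^]\<^bsub>R\<^esub> i) [0..<length as]) \<zero>\<^bsub>R\<^esub> = ring.eval R (rev as) x"
  using assms(1)
proof (induction as rule: rev_induct)
  case (snoc a as)
  have c: "set as \<subseteq> carrier R" "a \<in> carrier R" using snoc.prems by auto
  let ?l = "map (\<lambda>i. as ! i \<otimes>\<^bsub>R\<^esub> x [^]\<^bsub>R\<^esub> i) [0..<length as]"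
  have l: "set ?l \<subseteq> carrier R" using c assms(2) by (auto intro!: R.m_closed dest: nth_mem)
  have "map (\<lambda>i. (as @ [a]) ! i \<otimes>\<^bsub>R\<^esub> x [^]\<^bsub>R\<^esub> i) [0..<length (as @ [a])] = ?l @ [a \<otimes>\<^bsub>R\<^esub> x [^]\<^bsub>R\<^esub> length as]"
    by (auto simp: nth_append)
  then have "foldr (\<oplus>\<^bsub>R\<^esub>) (map (\<lambda>i. (as @ [a]) ! i \<otimes>\<^bsub>R\<^esub> x [^]\<^bsub>R\<^esub> i) [0..<length (as @ [a])]) \<zero>\<^bsub>R\<^esub> =
      foldr (\<oplus>\<^bsub>R\<^esub>) ?l (a \<otimes>\<^bsub>R\<^esub> x [^]\<^bsub>R\<^esub> length as)"
    using c assms(2) by (simp only: foldr_append) simp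
  also have "\<dots> = ring.eval R (rev as) x \<oplus>\<^bsub>R\<^esub> a \<otimes>\<^bsub>R\<^esub> x [^]\<^bsub>R\<^esub> length as"
    using ring_add_foldr(1)[OF l, of "a \<otimes>\<^bsub>R\<^esub> x [^]\<^bsub>R\<^esub> length as"] snoc.IH[OF c(1)] c assms(2) by simp
  also have "\<dots> = ring.eval R (rev (as @ [a])) x"
    using c assms(2) R.a_comm R.eval_in_carrier[of "rev as" x] by simp
  finally show ?case .
qed simp

lemma monic_root:
  assumes as: "set as \<subseteq> carrier R" "length as \<ge> 1"
  shows "\<exists>x\<in>carrier R. ring.eval R (\<one>\<^bsub>R\<^esub> # rev as) x = \<zero>\<^bsub>R\<^esub>"
proof -
  let ?n = "length as"
  let ?\<theta> = "Exists ?n (Eq (plus_t (power_t (Var ?n) ?n)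
              (sum_t (map (\<lambda>i. times_t (Var i) (power_t (Var ?n) i)) [0..<?n]))) zero_t) :: ('f rfun, 'r) fm"
  have "Foralls [0..<?n] (old_fm ?\<theta>) \<in> ACF_T_f L T"
  proof -
    have "Foralls [0..<?n] ?\<theta> \<in> ACF" using as(2) unfolding ACF_def by blast
    then have "old_fm (Foralls [0..<?n] ?\<theta>) \<in> old_fm ` ACF" by blast
    then show ?thesis by (simp add: ACF_T_f_def ACF_T_ld_def ACF_T_def old_fm_Foralls)
  qed
  from ax_Foralls[OF this asg_range[of as]] obtain x where x: "x \<in> U"
    "sat M ((asg as)(?n := x)) (old_fm (Eq (plus_t (power_t (Var ?n) ?n)
              (sum_t (map (\<lambda>i. times_t (Var i) (power_t (Var ?n) i)) [0..<?n]))) zero_t))"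
    using as(1) by (auto simp: rg_sel(1))
  let ?e = "(asg as)(?n := x)"
  have "eval M ?e (old_t (power_t (Var ?n) i)) = x [^]\<^bsub>R\<^esub> i" for i
    using eval_old_power[of ?e "Var ?n" i] x(1) by simp
  then have "map (\<lambda>t. eval M ?e (old_t t)) (map (\<lambda>i. times_t (Var i) (power_t (Var ?n) i)) [0..<?n]) =
      map (\<lambda>i. as ! i \<otimes>\<^bsub>R\<^esub> x [^]\<^bsub>R\<^esub> i) [0..<?n]"
    by (auto simp: rg_sel asg_nth)
  then have "x [^]\<^bsub>R\<^esub> ?n \<oplus>\<^bsub>R\<^esub> ring.eval R (rev as) x = \<zero>\<^bsub>R\<^esub>"
    using x(2) \<open>\<And>i. eval M ?e (old_t (power_t (Var ?n) i)) = _\<close> eval_rev_foldr[OF as(1), of x] x(1)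
    by (simp add: eval_old_sum rg_sel(3)[symmetric] rg_sel(5)[symmetric] rg_sel(1) del: map_map)
  moreover have xc: "x \<in> carrier R" using x(1) by (simp add: rg_sel(1))
  ultimately show ?thesis by (intro bexI[of _ x]) simp_all
qed

lemma alg_closed: "algebraically_closed R"
proof (rule R.algebraically_closedI)
  fix p assume p: "p \<in> carrier (poly_ring R)" "1 < length p - 1"
  then obtain c cs where ccs: "p = c # cs" by (cases p) auto
  have c: "c \<in> carrier R" "c \<noteq> \<zero>\<^bsub>R\<^esub>" "set cs \<subseteq> carrier R"
    using p(1) ccs by (auto simp: univ_poly_carrier[symmetric] polynomial_def)
  let ?i = "inv\<^bsub>R\<^esub> c"
  have i: "?i \<in> carrier R" "c \<otimes>\<^bsub>R\<^esub> ?i = \<one>\<^bsub>R\<^esub>" using c R.field_Units by auto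
  let ?as = "rev (map (\<lambda>a. ?i \<otimes>\<^bsub>R\<^esub> a) cs)"
  have as: "set ?as \<subseteq> carrier R" "length ?as \<ge> 1" using c i p(2) ccs by auto
  obtain x where x: "x \<in> carrier R" "ring.eval R (\<one>\<^bsub>R\<^esub> # rev ?as) x = \<zero>\<^bsub>R\<^esub>" using monic_root[OF as] by blast
  have "map (\<lambda>a. c \<otimes>\<^bsub>R\<^esub> a) (\<one>\<^bsub>R\<^esub> # rev ?as) = p"
    using c i by (auto simp: ccs R.m_assoc[symmetric] intro!: map_idI)
  then have "ring.eval R p x = c \<otimes>\<^bsub>R\<^esub> ring.eval R (\<one>\<^bsub>R\<^esub> # rev ?as) x"
    using R.eval_smult[of "\<one>\<^bsub>R\<^esub> # rev ?as" c x] as c x(1) by simp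
  then show "\<exists>x\<in>carrier R. ring.eval R p x = \<zero>\<^bsub>R\<^esub>" using x c by auto
qed

sublocale R: algebraically_closed R by (rule alg_closed)

lemma sub_ax:
  assumes "Foralls xs \<theta> \<in> subfield_axioms" "set as \<subseteq> U"
  shows "sat M (asg as) \<theta>"
proof (rule ax_Foralls[OF _ asg_range[OF assms(2)]])
  show "Foralls xs \<theta> \<in> ACF_T_f L T" using assms by (auto simp: ACF_T_f_def ACF_T_ld_def ACF_T_def)
qed

lemma subfield_P: "subfield K R"
proof -
  have "Foralls [] (P_fm (old_t zero_t)) \<in> (subfield_axioms :: ('f rfun pfun, 'r prel) fm set)"
    "Foralls [] (P_fm (old_t one_t)) \<in> (subfield_axioms :: ('f rfun pfun, 'r prel) fm set)"
    by (simp_all add: subfield_axioms_def Let_def Foralls_def)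
  from this[THEN sub_ax, of "[]"] have c: "\<zero>\<^bsub>R\<^esub> \<in> K" "\<one>\<^bsub>R\<^esub> \<in> K" 
    using ring_closed by (auto simp: P_of_def rg_sel)
  have bin: "a \<oplus>\<^bsub>R\<^esub> b \<in> K" "a \<otimes>\<^bsub>R\<^esub> b \<in> K" if "a \<in> K" "b \<in> K" for a b
    using sub_ax[of "[0,1]" "Imp (all_in_P [0,1]) (P_fm (old_t (plus_t (Var 0) (Var 1))))" "[a,b]"]
      sub_ax[of "[0,1]" "Imp (all_in_P [0,1]) (P_fm (old_t (times_t (Var 0) (Var 1))))" "[a,b]"]
      that ring_closed(4,5)[of a b]
    by (auto simp: subfield_axioms_def Let_def P_of_def rg_sel sat_all_in_P asg_nth)
  have un: "\<ominus>\<^bsub>R\<^esub> a \<in> K" "a \<noteq> \<zero>\<^bsub>R\<^esub> \<Longrightarrow> \<exists>b\<in>K. a \<otimes>\<^bsub>R\<^esub> b = \<one>\<^bsub>R\<^esub>" if "a \<in> K" for a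
  proof -
    have aU: "a \<in> U" using that by (simp add: P_of_def)
    show "\<ominus>\<^bsub>R\<^esub> a \<in> K"
      using sub_ax[of "[0]" "Imp (all_in_P [0]) (P_fm (old_t (minus_t (Var 0))))" "[a]"]
        that ring_closed(3)[of a] aU
      by (auto simp: subfield_axioms_def Let_def P_of_def sat_all_in_P asg_nth minus_eq_a_inv[OF aU, symmetric])
    assume ne: "a \<noteq> \<zero>\<^bsub>R\<^esub>"
    show "\<exists>b\<in>K. a \<otimes>\<^bsub>R\<^esub> b = \<one>\<^bsub>R\<^esub>"
      using sub_ax[of "[0]" "Imp (Conj (all_in_P [0]) (Neg (Eq (old_t (Var 0)) (old_t zero_t))))
       (Exists 1 (Conj (P_fm (old_t (Var 1))) (Eq (old_t (times_t (Var 0) (Var 1))) (old_t one_t))))" "[a]"]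
        that ne aU
      by (auto simp: subfield_axioms_def Let_def P_of_def sat_all_in_P asg_nth rg_sel)
  qed
  have KU: "K \<subseteq> carrier R" by (auto simp: P_of_def rg_sel(1))
  show ?thesis
  proof (rule R.subfieldI')
    show "subring K R" by (rule R.subringI) (use KU c bin un in auto)
    fix k assume k: "k \<in> K - {\<zero>\<^bsub>R\<^esub>}"
    then obtain b where b: "b \<in> K" "k \<otimes>\<^bsub>R\<^esub> b = \<one>\<^bsub>R\<^esub>" using un by blast
    then have "inv\<^bsub>R\<^esub> k = b" using k KU by (intro R.comm_inv_char) auto
    then show "inv\<^bsub>R\<^esub> k \<in> K" using b by simp
  qed
qed

lemma KU: "K \<subseteq> U"
  by (auto simp: P_of_def)

lemma eval_lincomb:
  "eval M e (lincomb_t ys xs) = ring.combine R (map e ys) (map e xs)"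
proof -
  have "eval M e (old_t (foldr plus_t (map2 (\<lambda>y x. times_t (Var y) (Var x)) ys xs) zero_t)) =
      ring.combine R (map e ys) (map e xs)"
    by (induction ys xs rule: list_induct2') (auto simp: rg_sel R.combine.simps)
  then show ?thesis by (simp add: lincomb_t_def sum_t_def)
qed

lemma sat_lin_indep_fm:
  assumes e: "range e \<subseteq> U"
  shows "sat M e (lin_indep_fm n) \<longleftrightarrow> ring.independent R K (map e [0..<n])"
proof -
  let ?xs = "[0..<n]" and ?ys = "[n..<2 * n]"
  let ?Us = "map e ?xs"
  have UsC: "set ?Us \<subseteq> carrier R" using e by (auto simp: rg_sel(1))
  have "sat M e (lin_indep_fm n) \<longleftrightarrow> (\<forall>d. range d \<subseteq> U \<and> (\<forall>i. i \<notin> set ?ys \<longrightarrow> d i = e i) \<longrightarrow>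
      (\<forall>y\<in>set ?ys. d y \<in> K) \<and> ring.combine R (map d ?ys) (map d ?xs) = \<zero>\<^bsub>R\<^esub> \<longrightarrow> (\<forall>y\<in>set ?ys. d y = \<zero>\<^bsub>R\<^esub>))"
    unfolding lin_indep_fm_def Let_def sat_Foralls[OF e]
    by (auto simp: sat_all_in_P sat_Conjs eval_lincomb rg_sel(5) P_of_def image_subset_iff)
  also have "\<dots> \<longleftrightarrow> (\<forall>Ks. length Ks = n \<longrightarrow> set Ks \<subseteq> K \<longrightarrow> ring.combine R Ks ?Us = \<zero>\<^bsub>R\<^esub> \<longrightarrow> set Ks \<subseteq> {\<zero>\<^bsub>R\<^esub>})"
    (is "?A \<longleftrightarrow> ?B")
  proof
    assume A: ?A
    show ?B
    proof (intro allI impI)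
      fix Ks assume Ks: "length Ks = n" "set Ks \<subseteq> K" "ring.combine R Ks ?Us = \<zero>\<^bsub>R\<^esub>"
      define d where "d i = (if i \<in> set ?ys then Ks ! (i - n) else e i)" for i
      have m: "map d ?ys = Ks" using Ks(1) by (intro nth_equalityI) (auto simp: d_def)
      have "map d ?xs = ?Us" by (auto simp: d_def)
      moreover have "range d \<subseteq> U"
      proof -
        have "Ks ! (i - n) \<in> U" if "i \<in> set ?ys" for i
        proof -
          have "i - n < length Ks" using that Ks(1) by auto
          then show ?thesis using nth_mem Ks(2) KU by blast
        qed
        then show ?thesis using e by (auto simp: d_def)
      qed
      moreover have "\<forall>y\<in>set ?ys. d y \<in> K" using Ks(2) m by (metis image_eqI set_map subsetD)
      moreover have "\<forall>i. i \<notin> set ?ys \<longrightarrow> d i = e i" by (simp add: d_def)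
      ultimately have "\<forall>y\<in>set ?ys. d y = \<zero>\<^bsub>R\<^esub>" using A Ks(3) m by metis
      then show "set Ks \<subseteq> {\<zero>\<^bsub>R\<^esub>}" unfolding m[symmetric] by auto
    qed
  next
    assume B: ?B
    show ?A
    proof (intro allI impI ballI)
      fix d y assume d: "range d \<subseteq> U \<and> (\<forall>i. i \<notin> set ?ys \<longrightarrow> d i = e i)"
        "(\<forall>y\<in>set ?ys. d y \<in> K) \<and> ring.combine R (map d ?ys) (map d ?xs) = \<zero>\<^bsub>R\<^esub>" "y \<in> set ?ys"
      have "map d ?xs = ?Us" using d(1) by auto
      then have "ring.combine R (map d ?ys) ?Us = \<zero>\<^bsub>R\<^esub>" using d(2) by metis
      moreover have "set (map d ?ys) \<subseteq> K" using d(2) by auto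
      ultimately have "set (map d ?ys) \<subseteq> {\<zero>\<^bsub>R\<^esub>}" using B by (metis length_map length_upt diff_add_inverse mult_2)
      then show "d y = \<zero>\<^bsub>R\<^esub>" using d(3) by (simp add: image_subset_iff)
    qed
  qed
  also have "\<dots> \<longleftrightarrow> ring.independent R K ?Us"
    using R.independent_iff_combine[OF subfield_P UsC] by simp
  finally show ?thesis .
qed

lemma LinInd_iff:
  assumes "length as \<ge> 1" "set as \<subseteq> U"
  shows "rint M (LinInd (length as)) as \<longleftrightarrow> ring.independent R K as"
proof -
  let ?n = "length as"
  have "Foralls [0..<?n] (Iff (Rel (LinInd ?n) (map Var [0..<?n])) (lin_indep_fm ?n)) \<in> ACF_T_f L T"
    using assms(1) unfolding ACF_T_f_def ACF_T_ld_def by blast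
  from ax_Foralls[OF this asg_range[OF assms(2)]]
  have "rint M (LinInd ?n) (map (asg as) [0..<?n]) \<longleftrightarrow> sat M (asg as) (lin_indep_fm ?n)"
    by (auto simp: comp_def)
  then show ?thesis using sat_lin_indep_fm[OF asg_range[OF assms(2)], of ?n] by (simp only: map_asg)
qed

lemma infinite_degree: "\<not> ring.finite_dimension R K (carrier R)"
proof
  assume "ring.finite_dimension R K (carrier R)"
  then obtain d where d: "ring.dimension R d K (carrier R)" by (auto simp: R.finite_dimension_def)
  have "Existss [0..<Suc d] (lin_indep_fm (Suc d)) \<in> ACF_T_f L T"
  proof -
    have "Existss [0..<Suc d] (lin_indep_fm (Suc d)) \<in> (infinite_degree_axioms :: ('f rfun pfun, 'r prel) fm set)"
      unfolding infinite_degree_axioms_def by (intro CollectI exI[of _ "Suc d"]) simp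
    then show ?thesis by (simp add: ACF_T_f_def ACF_T_ld_def ACF_T_def)
  qed
  from ax[OF this asg_range[of "[]"]] obtain e where e: "range e \<subseteq> U" "sat M e (lin_indep_fm (Suc d))"
    using sat_Existss[OF asg_range[of "[]"]] by auto
  have "ring.independent R K (map e [0..<Suc d])" using sat_lin_indep_fm[OF e(1)] e(2) by blast
  moreover have "set (map e [0..<Suc d]) \<subseteq> carrier R" using e(1) by (auto simp: rg_sel(1))
  ultimately have "length (map e [0..<Suc d]) \<le> d" by (rule R.independent_length_le_dimension[OF subfield_P d])
  then show False by simp
qed

lemma extra_fun:
  assumes "Extra f \<in> funs L" "length as = farity L (Extra f)" "set as \<subseteq> U"
  shows "set as \<subseteq> K \<Longrightarrow> fint M (OldF (Extra f)) as \<in> K"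
    "\<not> set as \<subseteq> K \<Longrightarrow> fint M (OldF (Extra f)) as = \<zero>\<^bsub>R\<^esub>"
proof -
  let ?xs = "[0..<farity L (Extra f)]"
  let ?t = "Fun (OldF (Extra f)) (map Var ?xs)"
  have "Foralls ?xs (Conj (Imp (all_in_P ?xs) (P_fm ?t))
      (Imp (Neg (all_in_P ?xs)) (Eq ?t (old_t zero_t)))) \<in> extra_fun_axioms L"
    using assms(1) unfolding extra_fun_axioms_def Let_def by blast
  then have "Foralls ?xs (Conj (Imp (all_in_P ?xs) (P_fm ?t))
      (Imp (Neg (all_in_P ?xs)) (Eq ?t (old_t zero_t)))) \<in> ACF_T_f L T"
    by (auto simp: ACF_T_f_def ACF_T_ld_def ACF_T_def)
  from ax_Foralls[OF this asg_range[OF assms(3)]]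
  have "((\<forall>x\<in>set ?xs. rint M InP [asg as x]) \<longrightarrow> rint M InP [fint M (OldF (Extra f)) as]) \<and>
    (\<not> (\<forall>x\<in>set ?xs. rint M InP [asg as x]) \<longrightarrow> fint M (OldF (Extra f)) as = \<zero>\<^bsub>R\<^esub>)"
    using map_asg[of as] assms(2) by (auto simp: sat_all_in_P comp_def rg_sel(5))
  moreover have "(\<forall>x\<in>set ?xs. rint M InP [asg as x]) \<longleftrightarrow> set as \<subseteq> K"
  proof -
    have "set as = asg as ` set ?xs" using map_asg[of as] assms(2) by (metis set_map)
    then show ?thesis using assms(3) by (auto simp: P_of_def)
  qed
  ultimately show "set as \<subseteq> K \<Longrightarrow> fint M (OldF (Extra f)) as \<in> K"
    "\<not> set as \<subseteq> K \<Longrightarrow> fint M (OldF (Extra f)) as = \<zero>\<^bsub>R\<^esub>"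
    using fun_closed[OF assms] by (auto simp: P_of_def)
qed

lemma rel_in_P:
  assumes "r \<in> rels L" "length as = rarity L r" "set as \<subseteq> U" "\<not> set as \<subseteq> K"
  shows "\<not> rint M (OldR r) as"
proof -
  let ?xs = "[0..<rarity L r]"
  have "Foralls ?xs (Imp (Neg (all_in_P ?xs)) (Neg (Rel (OldR r) (map Var ?xs)))) \<in> rel_axioms L"
    using assms(1) unfolding rel_axioms_def Let_def by blast
  then have "Foralls ?xs (Imp (Neg (all_in_P ?xs)) (Neg (Rel (OldR r) (map Var ?xs)))) \<in> ACF_T_f L T"
    by (auto simp: ACF_T_f_def ACF_T_ld_def ACF_T_def)
  from ax_Foralls[OF this asg_range[OF assms(3)]]
  have "\<not> (\<forall>x\<in>set ?xs. rint M InP [asg as x]) \<longrightarrow> \<not> rint M (OldR r) as"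
    using map_asg[of as] assms(2) by (auto simp: sat_all_in_P comp_def)
  moreover have "(\<forall>x\<in>set ?xs. rint M InP [asg as x]) \<longleftrightarrow> set as \<subseteq> K"
  proof -
    have "set as = asg as ` set ?xs" using map_asg[of as] assms(2) by (metis set_map)
    then show ?thesis using assms(3) by (auto simp: P_of_def)
  qed
  ultimately show ?thesis using assms(4) by blast
qed

text \<open>There is one axiom for each i, so the tuple \<open>ys\<close> may at first depend on i;
  uniqueness of coordinates over an independent family identifies these tuples later.\<close>

lemma coord:
  assumes "i < n" "length as = n" "set as \<subseteq> U" "b \<in> U"
  shows "rint M (LinInd n) as \<Longrightarrow> \<not> rint M (LinInd (n + 1)) (as @ [b]) \<Longrightarrow>
      \<exists>ys. length ys = n \<and> set ys \<subseteq> K \<and> b = ring.combine R ys as \<and> fint M (Coord n i) (b # as) = ys ! i"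
    "\<not> (rint M (LinInd n) as \<and> \<not> rint M (LinInd (n + 1)) (as @ [b])) \<Longrightarrow>
      fint M (Coord n i) (b # as) = \<zero>\<^bsub>R\<^esub>"
proof -
  let ?e = "asg (as @ [b])"
  define ys where "ys = [n + 1..<2 * n + 1]"
  have ys: "length ys = n" "\<And>j. j \<le> n \<Longrightarrow> j \<notin> set ys" by (auto simp: ys_def)
  have U: "set (as @ [b]) \<subseteq> U" using assms by auto
  note r = asg_range[OF U]
  have m: "map ?e [0..<n] = as" "?e n = b"
    using assms(2) by (auto intro!: nth_equalityI simp: asg_nth nth_append)
  define dep :: "('f rfun pfun, 'r prel) fm" where
    "dep = Conj (Rel (LinInd n) (map Var [0..<n])) (Neg (Rel (LinInd (n + 1)) (map Var ([0..<n] @ [n]))))"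
  define t where "t = (Fun (Coord n i) (map Var (n # [0..<n])) :: 'f rfun pfun tm)"
  have "coord_axiom n i \<in> ACF_T_f L T" using assms(1) by (auto simp: ACF_T_f_def)
  then have sax: "sat M ?e (Conj (Imp dep (Existss ys (Conj (all_in_P ys)
      (Conj (Eq (Var n) (lincomb_t ys [0..<n])) (Eq t (Var (ys ! i))))))) (Imp (Neg dep) (Eq t (old_t zero_t))))"
    unfolding coord_axiom_def Let_def dep_def t_def ys_def by (rule ax_Foralls[OF _ r])
  have sdep: "sat M ?e dep \<longleftrightarrow> rint M (LinInd n) as \<and> \<not> rint M (LinInd (n + 1)) (as @ [b])"
    using m by (simp add: dep_def comp_def)
  have et: "eval M ?e t = fint M (Coord n i) (b # as)" using m by (simp add: t_def comp_def)
  show "fint M (Coord n i) (b # as) = \<zero>\<^bsub>R\<^esub>"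
    if "\<not> (rint M (LinInd n) as \<and> \<not> rint M (LinInd (n + 1)) (as @ [b]))"
    using sax that sdep et by (auto simp: rg_sel(5))
  assume "rint M (LinInd n) as" "\<not> rint M (LinInd (n + 1)) (as @ [b])"
  then have "sat M ?e (Existss ys (Conj (all_in_P ys)
      (Conj (Eq (Var n) (lincomb_t ys [0..<n])) (Eq t (Var (ys ! i))))))" using sax sdep by simp
  then obtain d where d: "range d \<subseteq> U" "\<And>j. j \<notin> set ys \<Longrightarrow> d j = ?e j"
    "\<forall>y\<in>set ys. rint M InP [d y]" "d n = eval M d (lincomb_t ys [0..<n])" "eval M d t = d (ys ! i)"
    unfolding sat_Existss[OF r] by (auto simp: sat_all_in_P)
  have md: "map d [0..<n] = as" "d n = b"
  proof -
    have "map d [0..<n] = map ?e [0..<n]" using d(2) ys(2) by (intro map_cong) auto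
    then show "map d [0..<n] = as" using m(1) by simp
    show "d n = b" using d(2)[OF ys(2)[OF order_refl]] m(2) by simp
  qed
  have "eval M d t = fint M (Coord n i) (b # as)" using md by (simp add: t_def comp_def)
  then show "\<exists>ys. length ys = n \<and> set ys \<subseteq> K \<and> b = ring.combine R ys as \<and> fint M (Coord n i) (b # as) = ys ! i"
    using d md assms(1) ys(1) by (intro exI[of _ "map d ys"]) (auto simp: eval_lincomb P_of_def)
qed

lemma P_model: "is_model L T (P_structure M)"
  unfolding is_model_def
proof
  have "fint M (OldF f) as \<in> K" if f: "f \<in> funs L" "length as = farity L f" "set as \<subseteq> K" for f as
  proof (cases f)
    case (Extra g)
    then show ?thesis using extra_fun(1)[of g as] that KU by auto
  next
    case (Ring c)
    note S = R.subring_props[OF subfield_P]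
    have len: "length as = ring_arity c" using f(2) Ring ext by (simp add: extends_L_rings_def)
    have U: "set as \<subseteq> U" using f(3) KU by blast
    show ?thesis
    proof (cases c)
      case RZero
      then show ?thesis using Ring len S by (simp add: rg_sel)
    next
      case ROne
      then show ?thesis using Ring len S by (simp add: rg_sel)
    next
      case RPlus
      then obtain a b where "as = [a, b]" using len by (auto simp: length_Suc_conv numeral_2_eq_2)
      then show ?thesis using RPlus Ring f(3) S(7) by (simp add: rg_sel)
    next
      case RMinus
      then obtain a where "as = [a]" using len by (auto simp: length_Suc_conv)
      then show ?thesis using RMinus Ring f(3) S(5) U minus_eq_a_inv by simp
    next
      case RTimes
      then obtain a b where "as = [a, b]" using len by (auto simp: length_Suc_conv numeral_2_eq_2)
      then show ?thesis using RTimes Ring f(3) S(6) by (simp add: rg_sel)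
    qed
  qed
  moreover have "K \<noteq> {}" using R.subring_props(2)[OF subfield_P] by blast
  ultimately show "is_structure L (P_structure M)" by (simp add: is_structure_def P_structure_def)
  show "\<forall>\<theta>\<in>T. valid (P_structure M) \<theta>"
  proof (intro ballI)
    fix \<theta> assume \<theta>: "\<theta> \<in> T"
    show "valid (P_structure M) \<theta>" unfolding valid_def
    proof (intro allI impI)
      fix e :: "nat \<Rightarrow> 'm" assume "range e \<subseteq> universe (P_structure M)"
      then have e: "range e \<subseteq> K" by (simp add: P_structure_def)
      have "relativize \<theta> \<in> ACF_T_f L T" using \<theta> by (auto simp: ACF_T_f_def ACF_T_ld_def ACF_T_def)
      then have "sat M e (relativize \<theta>)" using e KU by (intro ax) auto
      then show "sat (P_structure M) e \<theta>" using sat_relativize[OF e] by blast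
    qed
  qed
qed

end

section \<open>Definability with quantifiers over the subfield\<close>

primrec pvs :: "mt \<Rightarrow> nat set" where
  "pvs (MV x) = {}"
| "pvs (PV i) = {i}"
| "pvs MZero = {}"
| "pvs MOne = {}"
| "pvs (MAdd s t) = pvs s \<union> pvs t"
| "pvs (MNeg s) = pvs s"
| "pvs (MMul s t) = pvs s \<union> pvs t"

lemma (in ring) mval_cong: "(\<And>i. i \<in> pvs t \<Longrightarrow> z i = y i) \<Longrightarrow> mval e z t = mval e y t"
  by (induction t) auto

lemma set_tadd:
  assumes "t \<in> set (tadd p q)"
  shows "\<exists>s\<in>insert MZero (set p). \<exists>s'\<in>insert MZero (set q). t = MAdd s s'"
proof -
  let ?p = "replicate (length q - length p) MZero @ p" and ?q = "replicate (length p - length q) MZero @ q"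
  obtain s s' where t: "t = MAdd s s'" "(s, s') \<in> set (zip ?p ?q)" using assms by (auto simp: tadd_def)
  have "s \<in> set ?p" "s' \<in> set ?q" using set_zip_leftD[OF t(2)] set_zip_rightD[OF t(2)] .
  moreover have "set ?p \<subseteq> insert MZero (set p)" "set ?q \<subseteq> insert MZero (set q)" by auto
  ultimately show ?thesis using t(1) by blast
qed

lemma pvs_tadd:
  "t \<in> set (tadd p q) \<Longrightarrow> pvs t \<subseteq> \<Union> (pvs ` set p) \<union> \<Union> (pvs ` set q)"
  by (drule set_tadd) auto

lemma pvs_tmul: "t \<in> set (tmul p q) \<Longrightarrow> pvs t \<subseteq> \<Union> (pvs ` set p) \<union> \<Union> (pvs ` set q)"
proof (induction p arbitrary: t)
  case (Cons c p)
  have "pvs s \<subseteq> pvs c \<union> \<Union> (pvs ` set q)" if "s \<in> set (map (MMul c) q @ replicate (length p) MZero)" for s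
    using that by auto
  moreover have "pvs s \<subseteq> \<Union> (pvs ` set p) \<union> \<Union> (pvs ` set q)" if "s \<in> set (tmul p q)" for s
    using Cons.IH[OF that] .
  ultimately show ?case using pvs_tadd[of t "map (MMul c) q @ replicate (length p) MZero" "tmul p q"] Cons.prems
    by (fastforce simp del: set_append set_map)
qed simp

lemma pvs_pcoef: "t \<in> set (pcoef x s) \<Longrightarrow> pvs t \<subseteq> pvs s"
proof (induction s arbitrary: t)
  case (MAdd s s')
  then show ?case using pvs_tadd[of t "pcoef x s" "pcoef x s'"] by fastforce
next
  case (MMul s s')
  then show ?case using pvs_tmul[of t "pcoef x s" "pcoef x s'"] by fastforce
next
  case (MNeg s)
  then show ?case by fastforce
qed (auto split: if_splits)

text \<open>The generic P-linear combination of the given terms, with the P-variables from b on as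
  its coefficients.\<close>

primrec glin :: "nat \<Rightarrow> mt list \<Rightarrow> mt" where
  "glin b [] = MZero"
| "glin b (m # ms) = MAdd (MMul (PV b) m) (glin (Suc b) ms)"

lemma pvs_glin: "(\<And>m. m \<in> set ms \<Longrightarrow> pvs m = {}) \<Longrightarrow> pvs (glin b ms) \<subseteq> {b..<b + length ms}"
proof (induction ms arbitrary: b)
  case (Cons m ms)
  have "pvs (glin (Suc b) ms) \<subseteq> {Suc b..<Suc b + length ms}" using Cons.IH[of "Suc b"] Cons.prems by simp
  moreover have "pvs m = {}" using Cons.prems by simp
  ultimately show ?case by auto
qed simp

definition gprod :: "mt list \<Rightarrow> mt"
  where "gprod ts = foldr MMul ts MOne"

lemma (in ring) mval_glin:
  "mval e z (glin b ms) = combine (map z [b..<b + length ms]) (map (mval e z) ms)"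
proof (induction ms arbitrary: b)
  case (Cons m ms)
  have "[b..<b + length (m # ms)] = b # [Suc b..<Suc b + length ms]" by (simp add: upt_rec)
  then show ?case using Cons by simp
qed simp

lemma (in domain) mval_gprod:
  assumes "range e \<subseteq> carrier R" "range z \<subseteq> carrier R"
  shows "mval e z (gprod ts) = \<zero> \<longleftrightarrow> (\<exists>t\<in>set ts. mval e z t = \<zero>)"
  using mval_closed[OF assms] by (induction ts) (auto simp: gprod_def integral_iff)

text \<open>Formulas whose quantifiers range over P. The only atoms that mention elements of the
  model are polynomial equations; symbols of L outside the ring language occur only in statements
  about P, and those may contain quantifiers of their own.\<close>

datatype ('f, 'r) pb = PEq mt | PLF "('f rfun, 'r) fm" | PNeg "('f, 'r) pb"
  | PAnd "('f, 'r) pb" "('f, 'r) pb" | PEx nat "('f, 'r) pb"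

primrec wfP :: "('f rfun, 'r) language \<Rightarrow> ('f, 'r) pb \<Rightarrow> bool" where
  "wfP L (PEq t) = True"
| "wfP L (PLF \<phi>) = is_fm L \<phi>"
| "wfP L (PNeg \<chi>) = wfP L \<chi>"
| "wfP L (PAnd \<chi> \<xi>) = (wfP L \<chi> \<and> wfP L \<xi>)"
| "wfP L (PEx i \<chi>) = wfP L \<chi>"

abbreviation mv :: "('f, 'r, 'm) pair \<Rightarrow> (nat \<Rightarrow> 'm) \<Rightarrow> (nat \<Rightarrow> 'm) \<Rightarrow> mt \<Rightarrow> 'm"
  where "mv M \<equiv> ring.mval (rg M)"

abbreviation pv :: "('f, 'r, 'm) pair \<Rightarrow> (nat \<Rightarrow> 'm) \<Rightarrow> (nat \<Rightarrow> 'm) \<Rightarrow> mt list \<Rightarrow> 'm \<Rightarrow> 'm"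
  where "pv M e z p \<equiv> ring.eval (rg M) (map (mv M e z) p)"

primrec satP :: "('f, 'r, 'm) pair \<Rightarrow> (nat \<Rightarrow> 'm) \<Rightarrow> (nat \<Rightarrow> 'm) \<Rightarrow> ('f, 'r) pb \<Rightarrow> bool" where
  "satP M e z (PEq t) = (mv M e z t = \<zero>\<^bsub>rg M\<^esub>)"
| "satP M e z (PLF \<phi>) = sat (P_structure M) z \<phi>"
| "satP M e z (PNeg \<chi>) = (\<not> satP M e z \<chi>)"
| "satP M e z (PAnd \<chi> \<xi>) = (satP M e z \<chi> \<and> satP M e z \<xi>)"
| "satP M e z (PEx i \<chi>) = (\<exists>a\<in>P_of M. satP M e (z(i := a)) \<chi>)"

text \<open>Definability quantifies over all models, hence over one universe type at a time; this
  type is a parameter of the locale.\<close>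

locale field_pairs_typed = field_pairs L T
  for L :: "('f rfun, 'r) language" and T :: "('f rfun, 'r) fm set" +
  fixes univ_type :: "'m itself"
begin

definition adm :: "('f, 'r, 'm) pair \<Rightarrow> (nat \<Rightarrow> 'm) \<Rightarrow> (nat \<Rightarrow> 'm) \<Rightarrow> bool"
  where "adm M e z \<longleftrightarrow> is_model (L_f L) (ACF_T_f L T) M \<and> range e \<subseteq> universe M \<and> range z \<subseteq> P_of M"

text \<open>Relations definable, uniformly in all models, by a formula whose quantifiers range over \<open>P\<close>;
  \<open>e\<close> interprets variables for elements of the model and \<open>z\<close> variables for elements of \<open>P\<close>.\<close>

definition pbdef :: "(('f, 'r, 'm) pair \<Rightarrow> (nat \<Rightarrow> 'm) \<Rightarrow> (nat \<Rightarrow> 'm) \<Rightarrow> bool) \<Rightarrow> bool"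
  where "pbdef R \<longleftrightarrow> (\<exists>\<chi>. wfP L \<chi> \<and> (\<forall>M e z. adm M e z \<longrightarrow> (R M e z \<longleftrightarrow> satP M e z \<chi>)))"

lemma adm_pair: "adm M e z \<Longrightarrow> pair_model L T M"
  unfolding pair_model_def pair_model_axioms_def adm_def using field_pairs_axioms by blast

lemma pbdef_cong:
  "pbdef R \<Longrightarrow> (\<And>M e z. adm M e z \<Longrightarrow> R M e z \<longleftrightarrow> S M e z) \<Longrightarrow> pbdef S"
  unfolding pbdef_def by meson

lemma pbdef_eq: "pbdef (\<lambda>M e z. mv M e z t = \<zero>\<^bsub>rg M\<^esub>)"
  unfolding pbdef_def by (intro exI[of _ "PEq t"]) simp

lemma pbdef_LF: "is_fm L \<phi> \<Longrightarrow> pbdef (\<lambda>M e z. sat (P_structure M) z \<phi>)"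
  unfolding pbdef_def by (intro exI[of _ "PLF \<phi>"]) simp

lemma pbdef_not: "pbdef R \<Longrightarrow> pbdef (\<lambda>M e z. \<not> R M e z)"
  unfolding pbdef_def
proof (elim exE)
  fix \<chi> assume "wfP L \<chi> \<and> (\<forall>M e z. adm M e z \<longrightarrow> R M e z = satP M e z \<chi>)"
  then show "\<exists>\<chi>. wfP L \<chi> \<and> (\<forall>M e z. adm M e z \<longrightarrow> (\<not> R M e z) = satP M e z \<chi>)"
    by (intro exI[of _ "PNeg \<chi>"]) simp
qed

lemma pbdef_and: "pbdef R \<Longrightarrow> pbdef S \<Longrightarrow> pbdef (\<lambda>M e z. R M e z \<and> S M e z)"
  unfolding pbdef_def
proof (elim exE)
  fix \<chi> \<xi> assume "wfP L \<chi> \<and> (\<forall>M e z. adm M e z \<longrightarrow> R M e z = satP M e z \<chi>)"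
    "wfP L \<xi> \<and> (\<forall>M e z. adm M e z \<longrightarrow> S M e z = satP M e z \<xi>)"
  then show "\<exists>\<chi>. wfP L \<chi> \<and> (\<forall>M e z. adm M e z \<longrightarrow> (R M e z \<and> S M e z) = satP M e z \<chi>)"
    by (intro exI[of _ "PAnd \<chi> \<xi>"]) simp
qed

lemma pbdef_or: "pbdef R \<Longrightarrow> pbdef S \<Longrightarrow> pbdef (\<lambda>M e z. R M e z \<or> S M e z)"
  using pbdef_not[OF pbdef_and[OF pbdef_not pbdef_not], of R S] by simp

lemma pbdef_False: "pbdef (\<lambda>M e z. False)"
  unfolding pbdef_def by (intro exI[of _ "PLF Falsum"]) simp

lemma pbdef_bex: "(\<And>x. x \<in> set xs \<Longrightarrow> pbdef (R x)) \<Longrightarrow> pbdef (\<lambda>M e z. \<exists>x\<in>set xs. R x M e z)"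
  by (induction xs) (auto simp: pbdef_False pbdef_or)

lemma pbdef_ball: "(\<And>x. x \<in> set xs \<Longrightarrow> pbdef (R x)) \<Longrightarrow> pbdef (\<lambda>M e z. \<forall>x\<in>set xs. R x M e z)"
  using pbdef_not[OF pbdef_bex[of xs "\<lambda>x M e z. \<not> R x M e z"]] by (simp add: pbdef_not)

lemma pbdef_exP: "pbdef R \<Longrightarrow> pbdef (\<lambda>M e z. \<exists>a\<in>P_of M. R M e (z(i := a)))"
  unfolding pbdef_def
proof (elim exE)
  fix \<chi> assume \<chi>: "wfP L \<chi> \<and> (\<forall>M e z. adm M e z \<longrightarrow> R M e z = satP M e z \<chi>)"
  have "(\<exists>a\<in>P_of M. R M e (z(i := a))) = satP M e z (PEx i \<chi>)" if "adm M e z" for M e z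
  proof -
    have "adm M e (z(i := a))" if "a \<in> P_of M" for a using that \<open>adm M e z\<close> by (auto simp: adm_def)
    then show ?thesis using \<chi> by auto
  qed
  then show "\<exists>\<chi>. wfP L \<chi> \<and> (\<forall>M e z. adm M e z \<longrightarrow> (\<exists>a\<in>P_of M. R M e (z(i := a))) = satP M e z \<chi>)"
    using \<chi> by (intro exI[of _ "PEx i \<chi>"]) auto
qed

lemma pbdef_block:
  assumes "pbdef R"
  shows "pbdef (\<lambda>M e z. \<exists>y. range y \<subseteq> P_of M \<and> (\<forall>i. i \<notin> set is \<longrightarrow> y i = z i) \<and> R M e y)"
proof (induction "is")
  case Nil
  have "R M e z \<longleftrightarrow> (\<exists>y. range y \<subseteq> P_of M \<and> (\<forall>i. y i = z i) \<and> R M e y)" if "adm M e z" for M e z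
  proof -
    have "y = z" if "\<forall>i. y i = z i" for y using that by auto
    then show ?thesis using that by (auto simp: adm_def)
  qed
  then show ?case using pbdef_cong[OF assms] by auto
next
  case (Cons j "is")
  show ?case
  proof (rule pbdef_cong[OF pbdef_exP[OF Cons, of j]])
    fix M e z assume a: "adm M e z"
    show "(\<exists>a\<in>P_of M. \<exists>y. range y \<subseteq> P_of M \<and> (\<forall>i. i \<notin> set is \<longrightarrow> y i = (z(j := a)) i) \<and> R M e y) \<longleftrightarrow>
      (\<exists>y. range y \<subseteq> P_of M \<and> (\<forall>i. i \<notin> set (j # is) \<longrightarrow> y i = z i) \<and> R M e y)" (is "?A \<longleftrightarrow> ?B")
    proof
      assume ?A
      then obtain a y where "a \<in> P_of M" "range y \<subseteq> P_of M" "\<forall>i. i \<notin> set is \<longrightarrow> y i = (z(j := a)) i" "R M e y"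
        by blast
      then show ?B by (intro exI[of _ y]) auto
    next
      assume ?B
      then obtain y where "range y \<subseteq> P_of M" "\<forall>i. i \<notin> set (j # is) \<longrightarrow> y i = z i" "R M e y" by blast
      then show ?A by (intro bexI[of _ "y j"] exI[of _ y]) auto
    qed
  qed
qed

section \<open>Elimination for systems of polynomials in one variable\<close>

abbreviation ex_poly :: "mt list list \<Rightarrow> mt list \<Rightarrow> ('f, 'r, 'm) pair \<Rightarrow> (nat \<Rightarrow> 'm) \<Rightarrow> (nat \<Rightarrow> 'm) \<Rightarrow> bool"
  where "ex_poly hs g M e z \<equiv> \<exists>a\<in>universe M. (\<forall>h\<in>set hs. pv M e z h a = \<zero>\<^bsub>rg M\<^esub>) \<and> pv M e z g a \<noteq> \<zero>\<^bsub>rg M\<^esub>"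

text \<open>Without equations it only matters that g is not the zero polynomial, since the field is
  infinite.\<close>

lemma ex_poly_Nil: "pbdef (ex_poly [] g)"
proof (rule pbdef_cong[OF pbdef_bex[of g "\<lambda>t M e z. mv M e z t \<noteq> \<zero>\<^bsub>rg M\<^esub>"]])
  show "pbdef (\<lambda>M e z. mv M e z t \<noteq> \<zero>\<^bsub>rg M\<^esub>)" for t by (rule pbdef_not[OF pbdef_eq])
  fix M :: "('f, 'r, 'm) pair" and e z assume a: "adm M e z"
  interpret pair_model L T M using adm_pair[OF a] .
  have ez: "range e \<subseteq> carrier R" "range z \<subseteq> carrier R" using a KU by (auto simp: adm_def rg_sel(1))
  have c: "set (map (mv M e z) g) \<subseteq> carrier R" using R.mval_closed[OF ez] by auto
  show "(\<exists>t\<in>set g. mv M e z t \<noteq> \<zero>\<^bsub>R\<^esub>) \<longleftrightarrow> ex_poly [] g M e z"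
  proof
    assume "\<exists>t\<in>set g. mv M e z t \<noteq> \<zero>\<^bsub>R\<^esub>"
    then have "\<not> set (map (mv M e z) g) \<subseteq> {\<zero>\<^bsub>R\<^esub>}" by auto
    then have "finite {a \<in> carrier R. pv M e z g a = \<zero>\<^bsub>R\<^esub>}" using R.finite_roots_list[OF c] by blast
    then have "{a \<in> carrier R. pv M e z g a = \<zero>\<^bsub>R\<^esub>} \<noteq> carrier R" using R.infinite_carrier by metis
    then show "ex_poly [] g M e z" by (auto simp: rg_sel(1))
  next
    assume "ex_poly [] g M e z"
    then obtain a where a: "a \<in> carrier R" "pv M e z g a \<noteq> \<zero>\<^bsub>R\<^esub>" by (auto simp: rg_sel(1))
    show "\<exists>t\<in>set g. mv M e z t \<noteq> \<zero>\<^bsub>R\<^esub>"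
    proof (rule ccontr)
      assume "\<not> ?thesis"
      then have "set (map (mv M e z) g) \<subseteq> {\<zero>\<^bsub>R\<^esub>}" by auto
      then show False using a R.eval_zero_list by blast
    qed
  qed
qed

text \<open>A vanishing leading coefficient is dropped, otherwise the remainder criterion decides.
  The case distinction is part of the formula, because c may vanish at some assignments
  only.\<close>

lemma ex_poly_single:
  assumes IH: "pbdef (ex_poly [cs] g)"
  shows "pbdef (ex_poly [c # cs] g)"
proof (rule pbdef_cong[OF pbdef_or[OF pbdef_and[OF pbdef_eq[of c] IH]
      pbdef_and[OF pbdef_not[OF pbdef_eq[of c]]
        pbdef_bex[of "prem c cs (tpow g (length cs))" "\<lambda>t M e z. mv M e z t \<noteq> \<zero>\<^bsub>rg M\<^esub>"]]]])
  show "pbdef (\<lambda>M e z. mv M e z t \<noteq> \<zero>\<^bsub>rg M\<^esub>)" for t by (rule pbdef_not[OF pbdef_eq])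
  fix M :: "('f, 'r, 'm) pair" and e z assume a: "adm M e z"
  interpret pair_model L T M using adm_pair[OF a] .
  have ez: "range e \<subseteq> carrier R" "range z \<subseteq> carrier R" using a KU by (auto simp: adm_def rg_sel(1))
  note mc = R.mval_closed[OF ez]
  have drop: "pv M e z (c # cs) a = pv M e z cs a" if "mv M e z c = \<zero>\<^bsub>R\<^esub>" "a \<in> universe M" for a
  proof -
    have "a \<in> carrier R" using that(2) by (simp add: rg_sel(1))
    then show ?thesis using that(1) R.pev_closed[OF ez, of a cs] by simp
  qed
  show "(mv M e z c = \<zero>\<^bsub>R\<^esub> \<and> ex_poly [cs] g M e z \<or>
      mv M e z c \<noteq> \<zero>\<^bsub>R\<^esub> \<and> (\<exists>t\<in>set (prem c cs (tpow g (length cs))). mv M e z t \<noteq> \<zero>\<^bsub>R\<^esub>)) \<longleftrightarrow>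
    ex_poly [c # cs] g M e z"
  proof (cases "mv M e z c = \<zero>\<^bsub>R\<^esub>")
    case True
    then show ?thesis using drop[OF True] by auto
  next
    case False
    then show ?thesis using R.pev_prem_zero_iff[OF ez False, of cs g] by (auto simp: rg_sel(1))
  qed
qed

text \<open>The Euclidean step. Where c is nonzero and the first polynomial vanishes, the reduced
  second polynomial takes c times the value of the original one, so the common roots are
  unchanged.\<close>

lemma ex_poly_reduce:
  assumes IH: "pbdef (ex_poly (cs # (c' # cs') # hs) g)"
      "pbdef (ex_poly ((c # cs) # tstep c cs c' cs' # hs) g)"
    and le: "length cs \<le> length cs'"
  shows "pbdef (ex_poly ((c # cs) # (c' # cs') # hs) g)"
proof (rule pbdef_cong[OF pbdef_or[OF pbdef_and[OF pbdef_eq[of c] IH(1)] pbdef_and[OF pbdef_not[OF pbdef_eq[of c]] IH(2)]]])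
  fix M :: "('f, 'r, 'm) pair" and e z assume a: "adm M e z"
  interpret pair_model L T M using adm_pair[OF a] .
  have ez: "range e \<subseteq> carrier R" "range z \<subseteq> carrier R" using a KU by (auto simp: adm_def rg_sel(1))
  note mc = R.mval_closed[OF ez]
  have pc: "pv M e z h a \<in> carrier R" if "a \<in> universe M" for h a
    using R.pev_closed[OF ez, of a h] that by (simp add: rg_sel(1))
  have drop: "pv M e z (c # cs) a = pv M e z cs a" if "mv M e z c = \<zero>\<^bsub>R\<^esub>" "a \<in> universe M" for a
  proof -
    have "a \<in> carrier R" using that(2) by (simp add: rg_sel(1))
    then show ?thesis using that(1) R.pev_closed[OF ez, of a cs] by simp
  qed
  have step: "pv M e z (tstep c cs c' cs') a = \<zero>\<^bsub>R\<^esub> \<longleftrightarrow> pv M e z (c' # cs') a = \<zero>\<^bsub>R\<^esub>"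
    if "mv M e z c \<noteq> \<zero>\<^bsub>R\<^esub>" "a \<in> universe M" "pv M e z (c # cs) a = \<zero>\<^bsub>R\<^esub>" for a
  proof -
    have a: "a \<in> carrier R" using that(2) by (simp add: rg_sel(1))
    have "pv M e z (tstep c cs c' cs') a = mv M e z c \<otimes>\<^bsub>R\<^esub> pv M e z (c' # cs') a"
      using R.pev_tstep[OF ez a le, of c c'] that(3) pc[OF that(2), of "c' # cs'"] mc[of c] mc[of c'] a
      by (simp add: a_minus_def del: list.map R.eval.simps)
    then show ?thesis using that(1) mc pc[OF that(2), of "c' # cs'"] R.integral_iff
      by (simp del: list.map R.eval.simps)
  qed
  show "(mv M e z c = \<zero>\<^bsub>R\<^esub> \<and> ex_poly (cs # (c' # cs') # hs) g M e z \<or>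
      mv M e z c \<noteq> \<zero>\<^bsub>R\<^esub> \<and> ex_poly ((c # cs) # tstep c cs c' cs' # hs) g M e z) \<longleftrightarrow>
    ex_poly ((c # cs) # (c' # cs') # hs) g M e z"
  proof (cases "mv M e z c = \<zero>\<^bsub>R\<^esub>")
    case True
    then show ?thesis using drop[OF True] by (auto simp del: list.map R.eval.simps)
  next
    case False
    then show ?thesis using step[OF False] by (auto simp del: list.map R.eval.simps)
  qed
qed

lemma pbdef_ex_poly: "pbdef (ex_poly hs g)"
\<comment> \<open>Counting every list with \<open>Suc\<close> lets the removal of an empty
  polynomial decrease the measure as well.\<close>
proof (induction "sum_list (map (\<lambda>h. Suc (length h)) hs)" arbitrary: hs rule: less_induct)
  case less
  have perm: "pbdef (ex_poly hs' g)" if "pbdef (ex_poly hs g)" "set hs' = set hs" for hs hs' :: "mt list list"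
    using that by (rule_tac pbdef_cong[OF that(1)]) simp
  consider "hs = []" | h where "hs = [h]" | h h' hs' where "hs = h # h' # hs'"
    by (cases hs; cases "tl hs") auto
  then show ?case
  proof cases
    case 1
    then show ?thesis using ex_poly_Nil by simp
  next
    case (2 h)
    show ?thesis
    proof (cases h)
      case Nil
      have "pbdef (ex_poly [] g)" by (rule ex_poly_Nil)
      then show ?thesis
      proof (rule pbdef_cong)
        fix M :: "('f, 'r, 'm) pair" and e z assume a: "adm M e z"
        interpret pair_model L T M using adm_pair[OF a] .
        show "ex_poly [] g M e z \<longleftrightarrow> ex_poly hs g M e z" using 2 Nil by simp
      qed
    next
      case (Cons c cs)
      then show ?thesis using ex_poly_single[OF less.hyps[of "[cs]"]] 2 by simp
    qed
  next
    case (3 h h' hs')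
    have nil: "pbdef (ex_poly ([] # h # hs') g)" if "pbdef (ex_poly (h # hs') g)" for h
    proof (rule pbdef_cong[OF that])
      fix M :: "('f, 'r, 'm) pair" and e z assume a: "adm M e z"
      interpret pair_model L T M using adm_pair[OF a] .
      show "ex_poly (h # hs') g M e z \<longleftrightarrow> ex_poly ([] # h # hs') g M e z" by simp
    qed
    have red: "pbdef (ex_poly (h # h' # hs') g)"
      if le: "length h \<le> length h'" and IH: "\<And>hs''. sum_list (map (\<lambda>h. Suc (length h)) hs'') <
        sum_list (map (\<lambda>h. Suc (length h)) (h # h' # hs')) \<Longrightarrow> pbdef (ex_poly hs'' g)" for h h'
    proof (cases h)
      case Nil
      then show ?thesis using nil IH[of "h' # hs'"] by simp
    next
      case (Cons c cs)
      then obtain c' cs' where h': "h' = c' # cs'" using le by (cases h') auto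
      have le': "length cs \<le> length cs'" using le Cons h' by simp
      show ?thesis unfolding Cons h'
        using le' Cons h' by (intro ex_poly_reduce IH) auto
    qed
    show ?thesis
    proof (cases "length h \<le> length h'")
      case True
      then show ?thesis using red[OF True] less.hyps 3 by simp
    next
      case False
      then have "pbdef (ex_poly (h' # h # hs') g)" using red[of h' h] less.hyps 3 by simp
      then show ?thesis by (rule perm) (auto simp: 3)
    qed
  qed
qed

end

text \<open>The coefficients in x of a P-linear combination are P-linear combinations of the
  coefficients of the terms. They stay in one finitely generated span whatever the combination is,
  so a single generic element avoids all of them.\<close>

lemma (in ring) mval_pcoef_glin_Span:
  assumes K: "subfield K R" and W: "set W \<subseteq> carrier R" and y: "range y \<subseteq> K"
    and m: "\<And>m t. m \<in> set ms \<Longrightarrow> t \<in> set (pcoef x m) \<Longrightarrow> mval e y t \<in> Span K W"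
  shows "t \<in> set (pcoef x (glin b ms)) \<Longrightarrow> mval e y t \<in> Span K W"
  using m
proof (induction ms arbitrary: b t)
  case (Cons m ms)
  note S = Span_subgroup_props[OF K W] and sm = Span_smult_closed[OF K W]
  obtain s s' where t: "t = MAdd s s'" "s \<in> insert MZero (set (tmul [PV b] (pcoef x m)))"
    "s' \<in> insert MZero (set (pcoef x (glin (Suc b) ms)))"
    using set_tadd Cons.prems(1) by fastforce
  have "mval e y s' \<in> Span K W" using t(3) Cons.IH[of s' "Suc b"] Cons.prems(2) S(2) by fastforce
  moreover have "mval e y s \<in> Span K W"
  proof (cases "s = MZero")
    case True
    then show ?thesis using S(2) by simp
  next
    case False
    then have "s \<in> set (tadd (map (MMul (PV b)) (pcoef x m)) [])" using t(2) by simp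
    then obtain u u' where u: "s = MAdd u u'" "u \<in> insert MZero (set (map (MMul (PV b)) (pcoef x m)))"
        "u' \<in> insert MZero (set ([] :: mt list))"
      using set_tadd by blast
    have "mval e y u \<in> Span K W"
    proof (cases "u = MZero")
      case False
      then obtain v where "u = MMul (PV b) v" "v \<in> set (pcoef x m)" using u(2) by auto
      then show ?thesis using sm[of "y b"] Cons.prems(2)[of m v] y by auto
    qed (use S(2) in simp)
    then show ?thesis using u S(2,3) by simp
  qed
  ultimately show ?case using t(1) S(3) by simp
qed simp

section \<open>Independence of given terms at a common root\<close>

context field_pairs_typed
begin

context
  fixes x :: nat and hs I :: "mt list" and B :: nat
  assumes I: "I \<noteq> []" "\<And>m. m \<in> set I \<Longrightarrow> pvs m = {}" and B: "\<And>h i. h \<in> set hs \<Longrightarrow> i \<in> pvs h \<Longrightarrow> i < B"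
begin

abbreviation ex_indep :: "('f, 'r, 'm) pair \<Rightarrow> (nat \<Rightarrow> 'm) \<Rightarrow> (nat \<Rightarrow> 'm) \<Rightarrow> bool"
  where "ex_indep M e z \<equiv> \<exists>a\<in>universe M. (\<forall>h\<in>set hs. mv M (e(x := a)) z h = \<zero>\<^bsub>rg M\<^esub>) \<and>
    ring.independent (rg M) (P_of M) (map (mv M (e(x := a)) z) I)"

abbreviation all_zero :: "('f, 'r, 'm) pair \<Rightarrow> (nat \<Rightarrow> 'm) \<Rightarrow> (nat \<Rightarrow> 'm) \<Rightarrow> bool"
  where "all_zero M e z \<equiv> \<forall>t\<in>set (concat (map (pcoef x) hs)). mv M e z t = \<zero>\<^bsub>rg M\<^esub>"

abbreviation nonzero_block :: "nat \<Rightarrow> ('f, 'r, 'm) pair \<Rightarrow> (nat \<Rightarrow> 'm) \<Rightarrow> (nat \<Rightarrow> 'm) \<Rightarrow> bool"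
  where "nonzero_block j M e y \<equiv> \<exists>i\<in>set [B + j * length I..<B + j * length I + length I]. mv M e y (PV i) \<noteq> \<zero>\<^bsub>rg M\<^esub>"

text \<open>Linear dependence over P of the terms \<open>I\<close> read as polynomials in
  \<open>x\<close>; block 0 holds the coefficients of the relation.\<close>

abbreviation dep_identically :: "('f, 'r, 'm) pair \<Rightarrow> (nat \<Rightarrow> 'm) \<Rightarrow> (nat \<Rightarrow> 'm) \<Rightarrow> bool"
  where "dep_identically M e z \<equiv> \<exists>y. range y \<subseteq> P_of M \<and> (\<forall>i. i \<notin> set [B..<B + length I] \<longrightarrow> y i = z i) \<and>
    nonzero_block 0 M e y \<and> (\<forall>t\<in>set (pcoef x (glin B I)). mv M e y t = \<zero>\<^bsub>rg M\<^esub>)"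

text \<open>Which of the polynomials is nonzero depends on the model; the sum of the lengths bounds
  the number of roots of any of them.\<close>

definition root_bound :: nat
  where "root_bound = sum_list (map (\<lambda>h. length (pcoef x h)) hs)"

text \<open>One factor per tuple: the product vanishes exactly when some tuple is a relation among
  the values of \<open>I\<close>.\<close>

definition lin_product :: mt
  where "lin_product = gprod (map (\<lambda>j. glin (B + j * length I) I) [0..<root_bound])"

text \<open>Finitely many tuples witness that every common root of \<open>hs\<close> makes \<open>I\<close> linearly dependent.\<close>

abbreviation dep_at_roots :: "('f, 'r, 'm) pair \<Rightarrow> (nat \<Rightarrow> 'm) \<Rightarrow> (nat \<Rightarrow> 'm) \<Rightarrow> bool"
  where "dep_at_roots M e z \<equiv> \<exists>y. range y \<subseteq> P_of M \<and>
    (\<forall>i. i \<notin> set [B..<B + root_bound * length I] \<longrightarrow> y i = z i) \<and>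
    ((\<forall>j\<in>set [0..<root_bound]. nonzero_block j M e y) \<and>
     \<not> ex_poly (map (pcoef x) hs) (pcoef x lin_product) M e y)"

lemma ex_indep_iff:
  assumes a: "adm M e z"
  shows "ex_indep M e z \<longleftrightarrow>
    all_zero M e z \<and> \<not> dep_identically M e z \<or> \<not> all_zero M e z \<and> \<not> dep_at_roots M e z"
proof -
  interpret pair_model L T M using adm_pair[OF a] .
  have eR: "range e \<subseteq> carrier R" and zK: "range z \<subseteq> K" using a by (auto simp: adm_def rg_sel(1))
  have KR: "K \<subseteq> carrier R" using KU by (simp add: rg_sel(1))
  let ?n = "length I"
  let ?v = "\<lambda>a. map (mv M (e(x := a)) z) I"
  have ea: "range (e(x := a)) \<subseteq> carrier R" if "a \<in> carrier R" for a using eR that by auto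
  have vC: "set (?v a) \<subseteq> carrier R" if "a \<in> carrier R" for a
    using R.mval_closed[OF ea[OF that]] zK KR by auto
  have vy: "map (mv M (e(x := a)) y) I = ?v a" for a y
  proof -
    have "mv M (e(x := a)) y m = mv M (e(x := a)) z m" if "m \<in> set I" for m
      using I(2)[OF that] by (intro R.mval_cong) simp
    then show ?thesis by simp
  qed
  have glin_at: "mv M (e(x := a)) y (glin b I) = ring.combine R (map y [b..<b + ?n]) (?v a)" for a b y
    using R.mval_glin[of "e(x := a)" y b I] by (simp only: vy[of a y])
  have poly_at: "mv M (e(x := a)) y t = pv M e y (pcoef x t) a"
    if "range y \<subseteq> K" "a \<in> carrier R" for a y t
  proof -
    have "range y \<subseteq> carrier R" using that(1) KR by (rule subset_trans)
    then show ?thesis by (rule R.pev_pcoef[OF eR _ that(2)])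
  qed
  have h_y: "mv M (e(x := a)) y h = mv M (e(x := a)) z h" if "h \<in> set hs" "\<And>i. i < B \<Longrightarrow> y i = z i" for a y h
    using that B R.mval_cong by metis
  have blk: "nonzero_block j M e y \<longleftrightarrow> \<not> set (map y [B + j * ?n..<B + j * ?n + ?n]) \<subseteq> {\<zero>\<^bsub>R\<^esub>}" for j y
    by (simp add: image_subset_iff)
  have ind: "ring.independent R K (?v a) \<longleftrightarrow> (\<forall>Ks. length Ks = ?n \<longrightarrow> set Ks \<subseteq> K \<longrightarrow>
      ring.combine R Ks (?v a) = \<zero>\<^bsub>R\<^esub> \<longrightarrow> set Ks \<subseteq> {\<zero>\<^bsub>R\<^esub>})" if "a \<in> carrier R" for a
    using R.independent_iff_combine[OF subfield_P vC[OF that]] by simp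
  have ind_y: "mv M (e(x := a)) y (glin (B + j * ?n) I) \<noteq> \<zero>\<^bsub>R\<^esub>"
    if "a \<in> carrier R" "ring.independent R K (?v a)" "range y \<subseteq> K" "nonzero_block j M e y" for a y j
  proof
    assume "mv M (e(x := a)) y (glin (B + j * ?n) I) = \<zero>\<^bsub>R\<^esub>"
    then have "ring.combine R (map y [B + j * ?n..<B + j * ?n + ?n]) (?v a) = \<zero>\<^bsub>R\<^esub>" using glin_at by simp
    moreover have "set (map y [B + j * ?n..<B + j * ?n + ?n]) \<subseteq> K" using that(3) by auto
    ultimately have "set (map y [B + j * ?n..<B + j * ?n + ?n]) \<subseteq> {\<zero>\<^bsub>R\<^esub>}"
      using ind[OF that(1)] that(2) by (simp del: set_map)
    then show False using that(4) blk by blast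
  qed
  show ?thesis
  proof (cases "all_zero M e z")
    case True
    have hz: "mv M (e(x := a)) z h = \<zero>\<^bsub>R\<^esub>" if "h \<in> set hs" "a \<in> carrier R" for h a
    proof -
      have "set (map (mv M e z) (pcoef x h)) \<subseteq> {\<zero>\<^bsub>R\<^esub>}" using True that(1) by auto
      then show ?thesis unfolding poly_at[OF zK that(2)] using that(2) by (rule R.eval_zero_list)
    qed
    have "ex_indep M e z \<longleftrightarrow> \<not> dep_identically M e z"
    proof
      assume "ex_indep M e z"
      then obtain a where a: "a \<in> carrier R" "ring.independent R K (?v a)" by (auto simp: rg_sel(1))
      show "\<not> dep_identically M e z"
      proof (rule notI, elim exE conjE)
        fix y assume y: "range y \<subseteq> K" "nonzero_block 0 M e y"
          "\<forall>t\<in>set (pcoef x (glin B I)). mv M e y t = \<zero>\<^bsub>R\<^esub>"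
        have "set (map (mv M e y) (pcoef x (glin B I))) \<subseteq> {\<zero>\<^bsub>R\<^esub>}" using y(3) by auto
        then have "mv M (e(x := a)) y (glin B I) = \<zero>\<^bsub>R\<^esub>"
          unfolding poly_at[OF y(1) a(1)] using a(1) by (rule R.eval_zero_list)
        then show False using ind_y[OF a y(1,2)] by simp
      qed
    next
      assume nd: "\<not> dep_identically M e z"
      \<comment> \<open>The terms in \<open>I\<close> contain no P-variables, so their coefficients
        in \<open>x\<close> do not change with the tuple \<open>y\<close> that is tested
        below.\<close>
      define W where "W = map (mv M e z) (concat (map (pcoef x) I))"
      have W: "set W \<subseteq> carrier R" using R.mval_closed[OF eR] zK KR by (auto simp: W_def)
      have WS: "mv M e y t \<in> ring.Span R K W" if "m \<in> set I" "t \<in> set (pcoef x m)" for m t y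
      proof -
        have "pvs t = {}" using pvs_pcoef[OF that(2)] I(2)[OF that(1)] by simp
        then have "mv M e y t = mv M e z t" using R.mval_cong[of t y z] by simp
        moreover have "mv M e z t \<in> set W" using that by (auto simp: W_def)
        ultimately show ?thesis using R.Span_base_incl[OF subfield_P W] by auto
      qed
      \<comment> \<open>The element \<open>a\<close> is fixed before any relation \<open>Ks\<close>:
        it is a root of no nonzero polynomial over the span with as many coefficients as a
        combination of \<open>I\<close> can have.\<close>
      obtain a where a: "a \<in> carrier R" "\<And>p. set p \<subseteq> ring.Span R K W \<Longrightarrow>
          length p \<le> length (pcoef x (glin B I)) \<Longrightarrow> ring.eval R p a = \<zero>\<^bsub>R\<^esub> \<Longrightarrow> set p \<subseteq> {\<zero>\<^bsub>R\<^esub>}"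
        using R.generic_element[OF subfield_P infinite_degree W] by metis
      have "ring.independent R K (?v a)"
        unfolding ind[OF a(1)]
      proof (intro allI impI)
        fix Ks assume Ks: "length Ks = ?n" "set Ks \<subseteq> K" "ring.combine R Ks (?v a) = \<zero>\<^bsub>R\<^esub>"
        define y where "y i = (if i \<in> set [B..<B + ?n] then Ks ! (i - B) else z i)" for i
        have m: "map y [B..<B + ?n] = Ks" using Ks(1) by (intro nth_equalityI) (auto simp: y_def)
        have yK: "range y \<subseteq> K"
        proof -
          have "y i \<in> K" for i
          proof (cases "i \<in> set [B..<B + ?n]")
            case True
            then have "Ks ! (i - B) \<in> set Ks" using Ks(1) by (intro nth_mem) auto
            then show ?thesis using True Ks(2) by (auto simp: y_def)
          next
            case False
            then show ?thesis using zK by (auto simp: y_def)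
          qed
          then show ?thesis by blast
        qed
        have "pv M e y (pcoef x (glin B I)) a = \<zero>\<^bsub>R\<^esub>"
          using Ks(3) poly_at[OF yK a(1), of "glin B I"] glin_at[of a y B] m by simp
        moreover have "set (map (mv M e y) (pcoef x (glin B I))) \<subseteq> ring.Span R K W"
          using R.mval_pcoef_glin_Span[OF subfield_P W yK, of I x e _ B] WS by auto
        ultimately have "set (map (mv M e y) (pcoef x (glin B I))) \<subseteq> {\<zero>\<^bsub>R\<^esub>}" by (intro a(2)) auto
        then have "\<forall>t\<in>set (pcoef x (glin B I)). mv M e y t = \<zero>\<^bsub>R\<^esub>" by (simp add: image_subset_iff)
        moreover have "\<forall>i. i \<notin> set [B..<B + ?n] \<longrightarrow> y i = z i" by (simp add: y_def)
        ultimately have "\<not> nonzero_block 0 M e y" using nd yK by blast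
        then show "set Ks \<subseteq> {\<zero>\<^bsub>R\<^esub>}" using blk[of 0 y] m by simp
      qed
      then show "ex_indep M e z" using a(1) hz by (auto simp: rg_sel(1))
    qed
    then show ?thesis using True by simp
  next
    case False
    define A where "A = {a \<in> carrier R. \<forall>h\<in>set hs. mv M (e(x := a)) z h = \<zero>\<^bsub>R\<^esub>}"
    obtain h0 where h0: "h0 \<in> set hs" "\<not> set (map (mv M e z) (pcoef x h0)) \<subseteq> {\<zero>\<^bsub>R\<^esub>}" using False by auto
    have c0: "set (map (mv M e z) (pcoef x h0)) \<subseteq> carrier R"
      using R.mval_closed[OF eR] zK KR by auto
    have Asub: "A \<subseteq> {a \<in> carrier R. pv M e z (pcoef x h0) a = \<zero>\<^bsub>R\<^esub>}"
      using h0(1) poly_at[OF zK] by (auto simp: A_def)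
    have finA: "finite A" using R.finite_roots_list[OF c0 h0(2)] Asub finite_subset by blast
    have "card A \<le> length (pcoef x h0)"
      using card_mono[OF R.finite_roots_list[OF c0 h0(2)] Asub] R.card_roots_le[OF c0 h0(2)] by simp
    also have "\<dots> \<le> root_bound" unfolding root_bound_def using h0(1) by (intro member_le_sum_list) auto
    finally have cardA: "card A \<le> root_bound" .
    have prod0: "mv M (e(x := a)) y lin_product = \<zero>\<^bsub>R\<^esub> \<longleftrightarrow>
      (\<exists>j<root_bound. mv M (e(x := a)) y (glin (B + j * ?n) I) = \<zero>\<^bsub>R\<^esub>)"
      if "a \<in> carrier R" "range y \<subseteq> K" for a y
      unfolding lin_product_def using R.mval_gprod[OF ea[OF that(1)], of y] that(2) KR by auto
    have exp: "ex_poly (map (pcoef x) hs) (pcoef x lin_product) M e y \<longleftrightarrow>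
        (\<exists>a\<in>A. mv M (e(x := a)) y lin_product \<noteq> \<zero>\<^bsub>R\<^esub>)"
      if "range y \<subseteq> K" "\<And>i. i < B \<Longrightarrow> y i = z i" for y
    proof -
      have "pv M e y (pcoef x h) a = mv M (e(x := a)) z h" if "h \<in> set hs" "a \<in> carrier R" for h a
        using poly_at[OF \<open>range y \<subseteq> K\<close> that(2), of h] h_y[OF that(1), of y a] \<open>\<And>i. i < B \<Longrightarrow> y i = z i\<close> by simp
      moreover have "pv M e y (pcoef x lin_product) a = mv M (e(x := a)) y lin_product" if "a \<in> carrier R" for a
        using poly_at[OF \<open>range y \<subseteq> K\<close> that, of lin_product] by simp
      ultimately show ?thesis by (auto simp: A_def rg_sel(1))
    qed
    have "ex_indep M e z \<longleftrightarrow> \<not> dep_at_roots M e z"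
    proof
      assume "ex_indep M e z"
      then obtain a where a: "a \<in> carrier R" "ring.independent R K (?v a)" "a \<in> A"
        by (auto simp: rg_sel(1) A_def)
      show "\<not> dep_at_roots M e z"
      proof (rule notI, elim exE conjE)
        fix y assume y: "range y \<subseteq> K" "\<forall>i. i \<notin> set [B..<B + root_bound * ?n] \<longrightarrow> y i = z i"
          "\<forall>j\<in>set [0..<root_bound]. nonzero_block j M e y"
          "\<not> ex_poly (map (pcoef x) hs) (pcoef x lin_product) M e y"
        have "mv M (e(x := a)) y lin_product = \<zero>\<^bsub>R\<^esub>" using exp[OF y(1)] y(2,4) a(3) by auto
        then obtain j where "j < root_bound" "mv M (e(x := a)) y (glin (B + j * ?n) I) = \<zero>\<^bsub>R\<^esub>"
          using prod0[OF a(1) y(1)] by blast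
        then show False using ind_y[OF a(1,2) y(1), of j] y(3) by auto
      qed
    next
      assume nd: "\<not> dep_at_roots M e z"
      show "ex_indep M e z"
      proof (rule ccontr)
        assume no: "\<not> ex_indep M e z"
        have "\<exists>Ks. length Ks = ?n \<and> set Ks \<subseteq> K \<and> ring.combine R Ks (?v a) = \<zero>\<^bsub>R\<^esub> \<and> \<not> set Ks \<subseteq> {\<zero>\<^bsub>R\<^esub>}"
          if "a \<in> A" for a
        proof -
          have a: "a \<in> carrier R" using that by (simp add: A_def)
          have "\<not> ring.independent R K (?v a)" using no that unfolding A_def rg_sel(1) by blast
          then show ?thesis unfolding ind[OF a] by blast
        qed
        then obtain u where u: "\<And>a. a \<in> A \<Longrightarrow> length (u a) = ?n \<and> set (u a) \<subseteq> K \<and>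
          ring.combine R (u a) (?v a) = \<zero>\<^bsub>R\<^esub> \<and> \<not> set (u a) \<subseteq> {\<zero>\<^bsub>R\<^esub>}" by metis
        obtain al where al: "set al = A" "distinct al" using finite_distinct_list[OF finA] by blast
        have lal: "length al \<le> root_bound" using cardA al distinct_card by metis
        \<comment> \<open>One relation for each common root. The blocks left over are filled with
          ones, a nonzero tuple because \<open>I\<close> is nonempty.\<close>
        define w where "w j = (if j < length al then u (al ! j) else replicate ?n \<one>\<^bsub>R\<^esub>)" for j
        have w: "length (w j) = ?n \<and> set (w j) \<subseteq> K \<and> \<not> set (w j) \<subseteq> {\<zero>\<^bsub>R\<^esub>}" for j
        proof (cases "j < length al")
          case True
          then show ?thesis using u[of "al ! j"] al(1) nth_mem by (auto simp: w_def)
        next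
          case False
          then show ?thesis using I(1) R.subring_props(3)[OF subfield_P] by (auto simp: w_def)
        qed
        define y where "y i = (if i \<in> set [B..<B + root_bound * ?n] then w ((i - B) div ?n) ! ((i - B) mod ?n) else z i)" for i
        have npos: "?n > 0" using I(1) by simp
        have yK: "range y \<subseteq> K"
        proof -
          have "w ((i - B) div ?n) ! ((i - B) mod ?n) \<in> K" for i
            using w[of "(i - B) div ?n"] npos by (metis mod_less_divisor nth_mem subsetD)
          then show ?thesis using zK by (auto simp: y_def)
        qed
        have ym: "map y [B + j * ?n..<B + j * ?n + ?n] = w j" if j: "j < root_bound" for j
        proof (rule nth_equalityI)
          fix i assume i: "i < length (map y [B + j * ?n..<B + j * ?n + ?n])"
          then have i': "i < ?n" by simp
          have "Suc j * ?n \<le> root_bound * ?n" using j by (intro mult_le_mono1) simp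
          then have "B + j * ?n + i \<in> set [B..<B + root_bound * ?n]" using i' by simp
          moreover have "(j * ?n + i) div ?n = j" "(j * ?n + i) mod ?n = i" using i' npos by simp_all
          ultimately show "map y [B + j * ?n..<B + j * ?n + ?n] ! i = w j ! i"
            using i' by (simp add: y_def add.assoc)
        qed (simp add: w)
        have "\<forall>j\<in>set [0..<root_bound]. nonzero_block j M e y"
        proof
          fix j assume "j \<in> set [0..<root_bound]"
          then have "\<not> set (map y [B + j * ?n..<B + j * ?n + ?n]) \<subseteq> {\<zero>\<^bsub>R\<^esub>}" using ym[of j] w[of j] by (simp del: set_map)
          then show "nonzero_block j M e y" unfolding blk .
        qed
        moreover have "\<not> ex_poly (map (pcoef x) hs) (pcoef x lin_product) M e y"
        proof -
          have "mv M (e(x := a)) y lin_product = \<zero>\<^bsub>R\<^esub>" if aA: "a \<in> A" for a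
          proof -
            obtain j where j: "j < length al" "al ! j = a" using aA al(1) by (metis in_set_conv_nth)
            have aR: "a \<in> carrier R" using aA by (simp add: A_def)
            have "mv M (e(x := a)) y (glin (B + j * ?n) I) = \<zero>\<^bsub>R\<^esub>"
              unfolding glin_at using ym[of j] j lal u[OF aA] by (simp add: w_def)
            then show ?thesis using prod0[OF aR yK] j lal by (meson less_le_trans)
          qed
          moreover have "y i = z i" if "i < B" for i using that by (simp add: y_def)
          ultimately show ?thesis using exp[OF yK] by blast
        qed
        moreover have "\<forall>i. i \<notin> set [B..<B + root_bound * ?n] \<longrightarrow> y i = z i" by (simp add: y_def)
        ultimately show False using nd yK by blast
      qed
    qed
    then show ?thesis using False by blast
  qed
qed

lemma pbdef_ex_indep: "pbdef ex_indep"
proof -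
  have nb: "pbdef (nonzero_block j)" for j
    by (rule pbdef_bex[OF pbdef_not[OF pbdef_eq]])
  have az: "pbdef all_zero" by (rule pbdef_ball[OF pbdef_eq])
  have di: "pbdef dep_identically"
    by (rule pbdef_block[OF pbdef_and[OF nb pbdef_ball[OF pbdef_eq]]])
  have dr: "pbdef dep_at_roots"
    by (rule pbdef_block[OF pbdef_and[OF pbdef_ball[OF nb] pbdef_not[OF pbdef_ex_poly]]])
  show ?thesis
    by (rule pbdef_cong[OF pbdef_or[OF pbdef_and[OF az pbdef_not[OF di]]
          pbdef_and[OF pbdef_not[OF az] pbdef_not[OF dr]]] ex_indep_iff[symmetric]])
qed

end

end

section \<open>Elimination of a quantifier over the model\<close>

primrec mvs :: "mt \<Rightarrow> nat set" where
  "mvs (MV x) = {x}"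
| "mvs (PV i) = {}"
| "mvs MZero = {}"
| "mvs MOne = {}"
| "mvs (MAdd s t) = mvs s \<union> mvs t"
| "mvs (MNeg s) = mvs s"
| "mvs (MMul s t) = mvs s \<union> mvs t"

text \<open>Separation of variables: a term becomes a sum of products of a scalar in P-variables and
  a term in model variables. Only the second factors have to be expressed in a basis.\<close>

primrec expand :: "mt \<Rightarrow> (mt \<times> mt) list" where
  "expand (MV x) = [(MOne, MV x)]"
| "expand (PV i) = [(PV i, MOne)]"
| "expand MZero = []"
| "expand MOne = [(MOne, MOne)]"
| "expand (MAdd s t) = expand s @ expand t"
| "expand (MNeg s) = map (\<lambda>(q, m). (MNeg q, m)) (expand s)"
| "expand (MMul s t) = concat (map (\<lambda>(q, m). map (\<lambda>(q', m'). (MMul q q', MMul m m')) (expand t)) (expand s))"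

lemma expand_separates: "(q, m) \<in> set (expand t) \<Longrightarrow> mvs q = {} \<and> pvs m = {}"
  by (induction t arbitrary: q m) fastforce+

definition (in ring) sum_products :: "(nat \<Rightarrow> 'a) \<Rightarrow> (nat \<Rightarrow> 'a) \<Rightarrow> (mt \<times> mt) list \<Rightarrow> 'a"
  where "sum_products e z l = foldr (\<lambda>(q, m) s. mval e z q \<otimes> mval e z m \<oplus> s) l \<zero>"

lemma (in cring) mval_expand:
  assumes ez: "range e \<subseteq> carrier R" "range z \<subseteq> carrier R"
  shows "mval e z t = sum_products e z (expand t)"
proof -
  note mc = mval_closed[OF ez]
  have cl: "sum_products e z l \<in> carrier R" for l
    by (induction l) (auto simp: sum_products_def mc)
  have nil: "sum_products e z [] = \<zero>" by (simp add: sum_products_def)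
  have cons: "sum_products e z ((q, m) # l) = mval e z q \<otimes> mval e z m \<oplus> sum_products e z l" for q m l
    by (simp add: sum_products_def)
  have app: "sum_products e z (l @ l') = sum_products e z l \<oplus> sum_products e z l'" for l l'
    by (induction l) (auto simp: nil cons cl mc a_assoc)
  have neg: "sum_products e z (map (\<lambda>(q, m). (MNeg q, m)) l) = \<ominus> sum_products e z l" for l
    by (induction l) (auto simp: nil cons cl mc minus_add l_minus)
  have mul1: "sum_products e z (map (\<lambda>(q', m'). (MMul q q', MMul m m')) l) =
      (mval e z q \<otimes> mval e z m) \<otimes> sum_products e z l" for q m l
    by (induction l) (auto simp: nil cons cl mc r_distr m_ac)
  have mul: "sum_products e z (concat (map (\<lambda>(q, m). map (\<lambda>(q', m'). (MMul q q', MMul m m')) l') l)) =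
      sum_products e z l \<otimes> sum_products e z l'" for l l'
    by (induction l) (auto simp: nil cons app mul1 cl mc l_distr)
  have var: "e x \<in> carrier R" "z x \<in> carrier R" for x using ez by auto
  show ?thesis by (induction t) (auto simp: nil cons app neg mul cl mc var)
qed

primrec mons :: "('f, 'r) pb \<Rightarrow> mt list" where
  "mons (PEq t) = map snd (expand t)"
| "mons (PLF \<phi>) = []"
| "mons (PNeg \<chi>) = mons \<chi>"
| "mons (PAnd \<chi> \<xi>) = mons \<chi> @ mons \<xi>"
| "mons (PEx i \<chi>) = mons \<chi>"

lemma pvs_mons: "m \<in> set (mons \<chi>) \<Longrightarrow> pvs m = {}"
  by (induction \<chi>) (auto dest: expand_separates)

primrec bvs :: "('f, 'r) pb \<Rightarrow> nat set" where
  "bvs (PEq t) = {}"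
| "bvs (PLF \<phi>) = {}"
| "bvs (PNeg \<chi>) = bvs \<chi>"
| "bvs (PAnd \<chi> \<xi>) = bvs \<chi> \<union> bvs \<xi>"
| "bvs (PEx i \<chi>) = insert i (bvs \<chi>)"

lemma finite_bvs: "finite (bvs \<chi>)"
  by (induction \<chi>) auto

text \<open>The value for \<open>MV x\<close> is a placeholder; the translation is meant for the
  scalars of \<open>expand\<close>, in which no model variable occurs.\<close>

primrec toL :: "mt \<Rightarrow> 'f rfun tm" where
  "toL (MV x) = zero_t"
| "toL (PV i) = Var i"
| "toL MZero = zero_t"
| "toL MOne = one_t"
| "toL (MAdd s t) = plus_t (toL s) (toL t)"
| "toL (MNeg s) = minus_t (toL s)"
| "toL (MMul s t) = times_t (toL s) (toL t)"

text \<open>Variables from \<open>B\<close> on stand for the coordinates of the monomials \<open>ms\<close> in terms of \<open>n\<close> basis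
  elements.\<close>

definition midx :: "mt list \<Rightarrow> mt \<Rightarrow> nat"
  where "midx ms m = (LEAST k. k < length ms \<and> ms ! k = m)"

definition cvar :: "mt list \<Rightarrow> nat \<Rightarrow> nat \<Rightarrow> mt \<Rightarrow> nat \<Rightarrow> nat"
  where "cvar ms B n m i = B + midx ms m * n + i"

lemma midx: "m \<in> set ms \<Longrightarrow> midx ms m < length ms \<and> ms ! midx ms m = m"
  unfolding midx_def by (rule LeastI_ex) (auto simp: in_set_conv_nth)

lemma cvar_bounds:
  assumes "m \<in> set ms" "i < n"
  shows "B \<le> cvar ms B n m i" "cvar ms B n m i < B + length ms * n"
    "(cvar ms B n m i - B) div n = midx ms m" "(cvar ms B n m i - B) mod n = i"
proof -
  have "Suc (midx ms m) * n \<le> length ms * n" using midx[OF assms(1)] by (intro mult_le_mono1) simp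
  then show "cvar ms B n m i < B + length ms * n" using assms(2) by (simp add: cvar_def)
  show "B \<le> cvar ms B n m i" by (simp add: cvar_def)
  show "(cvar ms B n m i - B) div n = midx ms m" "(cvar ms B n m i - B) mod n = i"
    using assms(2) by (simp_all add: cvar_def)
qed

text \<open>An equation between elements of the model is replaced by one equation in P for each of
  the \<open>n\<close> coordinates; the scalars from \<open>expand\<close> multiply the coordinate
  variables of their monomials.\<close>

primrec tr :: "mt list \<Rightarrow> nat \<Rightarrow> nat \<Rightarrow> ('f, 'r) pb \<Rightarrow> ('f rfun, 'r) fm" where
  "tr ms B n (PEq t) = Conjs (map (\<lambda>i. Eq (sum_t (map (\<lambda>(q, m).
     times_t (toL q) (Var (cvar ms B n m i))) (expand t))) zero_t) [0..<n])"
| "tr ms B n (PLF \<phi>) = \<phi>"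
| "tr ms B n (PNeg \<chi>) = Neg (tr ms B n \<chi>)"
| "tr ms B n (PAnd \<chi> \<xi>) = Conj (tr ms B n \<chi>) (tr ms B n \<xi>)"
| "tr ms B n (PEx i \<chi>) = Exists i (tr ms B n \<chi>)"

lemma is_fm_Conjs: "is_fm L (Conjs \<phi>s) \<longleftrightarrow> (\<forall>\<phi>\<in>set \<phi>s. is_fm L \<phi>)"
  by (induction \<phi>s) (auto simp: Conjs_def)

lemma qfree_Conjs: "qfree (Conjs \<phi>s) \<longleftrightarrow> (\<forall>\<phi>\<in>set \<phi>s. qfree \<phi>)"
  by (induction \<phi>s) (auto simp: Conjs_def)

lemma is_tm_toL: "extends_L_rings L \<Longrightarrow> is_tm L (toL t)"
  by (induction t) (auto simp: extends_L_rings_def)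

lemma is_fm_tr:
  assumes L: "extends_L_rings L" shows "wfP L \<chi> \<Longrightarrow> is_fm L (tr ms B n \<chi>)"
proof (induction \<chi>)
  case (PEq t)
  have z: "is_tm L zero_t" using L by (auto simp: extends_L_rings_def)
  have sum: "is_tm L (sum_t ts)" if "\<forall>t\<in>set ts. is_tm L t" for ts
    using that L by (induction ts) (auto simp: sum_t_def extends_L_rings_def)
  have tim: "is_tm L (times_t (toL q) (Var j))" for q j
    using L is_tm_toL[OF L, of q] by (auto simp: extends_L_rings_def)
  have "is_tm L (sum_t (map (\<lambda>(q, m). times_t (toL q) (Var (cvar ms B n m i))) (expand t)))" for i
    by (rule sum) (use tim in \<open>auto simp del: is_tm.simps\<close>)
  then show ?case using z by (auto simp: is_fm_Conjs)
qed auto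

text \<open>Greedy choice from the right end of the list. Bases are sought among subsequences
  because these form a finite list fixed in advance, over which a formula can take a
  disjunction.\<close>

lemma (in ring) exists_basis_subseq:
  assumes K: "subfield K R" and "\<And>m. m \<in> set ms \<Longrightarrow> v m \<in> carrier R"
  shows "\<exists>I\<in>set (subseqs ms). independent K (map v I) \<and> (\<forall>m\<in>set ms. v m \<in> Span K (map v I))"
  using assms(2)
proof (induction ms)
  case (Cons m ms)
  then obtain I where I: "I \<in> set (subseqs ms)" "independent K (map v I)" "\<forall>m\<in>set ms. v m \<in> Span K (map v I)"
    by auto
  show ?case
  proof (cases "v m \<in> Span K (map v I)")
    case True
    then show ?thesis using I by (intro bexI[of _ I]) (auto simp: Let_def)
  next
    case False
    have IC: "set (map v I) \<subseteq> carrier R" using independent_in_carrier[OF I(2)] .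
    have m: "v m \<in> carrier R" using Cons.prems by simp
    have "independent K (map v (m # I))" using False I(2) m by (simp add: independent.li_Cons)
    moreover have "Span K (map v I) \<subseteq> Span K (map v (m # I))" using mono_Span[OF K IC m] by simp
    moreover have "v m \<in> Span K (map v (m # I))"
      using Span_base_incl[OF K, of "map v (m # I)"] IC m by auto
    ultimately show ?thesis using I by (intro bexI[of _ "m # I"]) (auto simp: Let_def simp del: Span.simps)
  qed
qed auto

section \<open>Coordinates of monomials in a model\<close>

context pair_model
begin

lemma eval_toL:
  assumes ez: "range e \<subseteq> U" "range z \<subseteq> K" and "mvs q = {}"
  shows "eval M z (old_t (toL q)) = mv M e z q"
  using assms(3)
proof (induction q)
  case (MNeg s)
  have "mv M e z s \<in> U"
    using R.mval_closed[of e z s] ez KU by (auto simp: rg_sel(1))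
  then show ?case using MNeg minus_eq_a_inv by simp
qed (auto simp: rg_sel)

text \<open>The basis is evaluated at a separate assignment \<open>z0\<close> so that it stays
  literally fixed while \<open>z\<close> changes under quantifiers over P.\<close>

definition has_coords :: "(nat \<Rightarrow> 'm) \<Rightarrow> mt list \<Rightarrow> mt list \<Rightarrow> nat \<Rightarrow> (nat \<Rightarrow> 'm) \<Rightarrow> (nat \<Rightarrow> 'm) \<Rightarrow> bool"
  where "has_coords e ms I B z0 z \<longleftrightarrow> (\<forall>m\<in>set ms. mv M e z m =
    ring.combine R (map (\<lambda>i. z (cvar ms B (length I) m i)) [0..<length I]) (map (mv M e z0) I))"

context
  fixes e z0 :: "nat \<Rightarrow> 'm" and ms I :: "mt list" and B :: nat
  assumes e: "range e \<subseteq> U" and I: "set I \<subseteq> set ms" and ms: "\<And>m. m \<in> set ms \<Longrightarrow> pvs m = {}"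
    and ind: "ring.independent R K (map (mv M e z0) I)"
begin

lemma basis_closed: "set (map (mv M e z0) I) \<subseteq> carrier R"
  using R.independent_in_carrier[OF ind] .

text \<open>The scalars lie in K because they contain only P-variables, so taking coordinates
  commutes with the sum of products.\<close>

lemma sum_products_coords:
  assumes z: "range z \<subseteq> K" and c: "has_coords e ms I B z0 z"
    and l: "\<And>q m. (q, m) \<in> set l \<Longrightarrow> m \<in> set ms \<and> mvs q = {}"
  shows "ring.sum_products R e z l = ring.combine R
    (map (\<lambda>i. foldr (\<oplus>\<^bsub>R\<^esub>) (map (\<lambda>(q, m). mv M e z q \<otimes>\<^bsub>R\<^esub> z (cvar ms B (length I) m i)) l) \<zero>\<^bsub>R\<^esub>) [0..<length I])
    (map (mv M e z0) I) \<and>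
    (\<forall>i. foldr (\<oplus>\<^bsub>R\<^esub>) (map (\<lambda>(q, m). mv M e z q \<otimes>\<^bsub>R\<^esub> z (cvar ms B (length I) m i)) l) \<zero>\<^bsub>R\<^esub> \<in> K)"
  using l
proof (induction l)
  case Nil
  have "map (\<lambda>i. \<zero>\<^bsub>R\<^esub>) [0..<length I] = replicate (length (map (mv M e z0) I)) \<zero>\<^bsub>R\<^esub>"
    by (simp add: map_replicate_const)
  then show ?case using R.combine_replicate[OF basis_closed] R.subring_props(2)[OF subfield_P]
    by (simp add: R.sum_products_def)
next
  case (Cons p l)
  obtain q m where p: "p = (q, m)" by fastforce
  let ?n = "length I"
  let ?Us = "map (mv M e z0) I"
  let ?S = "\<lambda>i. foldr (\<oplus>\<^bsub>R\<^esub>) (map (\<lambda>(q, m). mv M e z q \<otimes>\<^bsub>R\<^esub> z (cvar ms B ?n m i)) l) \<zero>\<^bsub>R\<^esub>"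
  let ?C = "\<lambda>i. z (cvar ms B ?n m i)"
  note sp = R.subring_props[OF subfield_P]
  have qm: "m \<in> set ms" "mvs q = {}" using Cons.prems p by auto
  have IH: "ring.sum_products R e z l = ring.combine R (map ?S [0..<?n]) ?Us" "\<And>i. ?S i \<in> K"
    using Cons by auto
  have zK: "z i \<in> K" for i using z by auto
  have KC: "K \<subseteq> carrier R" using KU by (simp add: rg_sel(1))
  have qK: "mv M e z q \<in> K" using qm(2)
  proof (induction q)
    case (PV i)
    then show ?case using zK by simp
  qed (use sp in auto)
  have c1: "set (map ?C [0..<?n]) \<subseteq> carrier R" "set (map ?S [0..<?n]) \<subseteq> carrier R"
    "set (map ((\<otimes>\<^bsub>R\<^esub>) (mv M e z q)) (map ?C [0..<?n])) \<subseteq> carrier R"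
    using zK IH(2) KC qK by (auto intro!: R.m_closed)
  have "ring.sum_products R e z (p # l) = mv M e z q \<otimes>\<^bsub>R\<^esub> mv M e z m \<oplus>\<^bsub>R\<^esub> ring.sum_products R e z l"
    by (simp add: p R.sum_products_def)
  also have "mv M e z m = ring.combine R (map ?C [0..<?n]) ?Us" using c qm(1) by (simp add: has_coords_def)
  also have "mv M e z q \<otimes>\<^bsub>R\<^esub> \<dots> = ring.combine R (map ((\<otimes>\<^bsub>R\<^esub>) (mv M e z q)) (map ?C [0..<?n])) ?Us"
    using R.combine_r_distr[OF c1(1) basis_closed] qK KC by blast
  also have "\<dots> \<oplus>\<^bsub>R\<^esub> ring.sum_products R e z l =
      ring.combine R (map2 (\<oplus>\<^bsub>R\<^esub>) (map ((\<otimes>\<^bsub>R\<^esub>) (mv M e z q)) (map ?C [0..<?n])) (map ?S [0..<?n])) ?Us"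
    unfolding IH(1) by (rule R.combine_add[OF _ _ c1(3,2) basis_closed]) simp_all
  also have "map2 (\<oplus>\<^bsub>R\<^esub>) (map ((\<otimes>\<^bsub>R\<^esub>) (mv M e z q)) (map ?C [0..<?n])) (map ?S [0..<?n]) =
      map (\<lambda>i. mv M e z q \<otimes>\<^bsub>R\<^esub> ?C i \<oplus>\<^bsub>R\<^esub> ?S i) [0..<?n]"
    unfolding map_map comp_def by (rule map2_map_map)
  finally show ?case using IH(2) qK zK sp by (simp add: p)
qed

text \<open>Over an independent family an element vanishes exactly when all its coordinates do; this
  settles the equations, and the other cases are structural.\<close>

lemma sat_tr:
  assumes "range z \<subseteq> K" "has_coords e ms I B z0 z" "set (mons \<chi>) \<subseteq> set ms" "\<And>i. i \<in> bvs \<chi> \<Longrightarrow> i < B"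
  shows "satP M e z \<chi> \<longleftrightarrow> sat (P_structure M) z (tr ms B (length I) \<chi>)"
  using assms
proof (induction \<chi> arbitrary: z)
  case (PEq t)
  let ?n = "length I"
  let ?S = "\<lambda>i. foldr (\<oplus>\<^bsub>R\<^esub>) (map (\<lambda>(q, m). mv M e z q \<otimes>\<^bsub>R\<^esub> z (cvar ms B ?n m i)) (expand t)) \<zero>\<^bsub>R\<^esub>"
  let ?Us = "map (mv M e z0) I"
  have l: "m \<in> set ms \<and> mvs q = {}" if "(q, m) \<in> set (expand t)" for q m
    using that PEq.prems(3) expand_separates by force
  have ez: "range e \<subseteq> carrier R" "range z \<subseteq> carrier R" using e PEq.prems(1) KU by (auto simp: rg_sel(1))
  have v: "mv M e z t = ring.combine R (map ?S [0..<?n]) ?Us" and SK: "\<And>i. ?S i \<in> K"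
    using sum_products_coords[OF PEq.prems(1,2) l] R.mval_expand[OF ez, of t] by auto
  have indB: "set Ks \<subseteq> {\<zero>\<^bsub>R\<^esub>}" if "length Ks = length ?Us" "set Ks \<subseteq> K" "ring.combine R Ks ?Us = \<zero>\<^bsub>R\<^esub>" for Ks
    using R.independent_iff_combine[OF subfield_P basis_closed] ind that by blast
  have "mv M e z t = \<zero>\<^bsub>R\<^esub> \<longleftrightarrow> set (map ?S [0..<?n]) \<subseteq> {\<zero>\<^bsub>R\<^esub>}"
  proof
    assume 0: "mv M e z t = \<zero>\<^bsub>R\<^esub>"
    show "set (map ?S [0..<?n]) \<subseteq> {\<zero>\<^bsub>R\<^esub>}"
    proof (rule indB)
      show "set (map ?S [0..<?n]) \<subseteq> K" using SK by auto
      show "ring.combine R (map ?S [0..<?n]) ?Us = \<zero>\<^bsub>R\<^esub>" using 0 v by (rule trans[OF sym, rotated])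
    qed simp
  next
    assume "set (map ?S [0..<?n]) \<subseteq> {\<zero>\<^bsub>R\<^esub>}"
    then have "map ?S [0..<?n] = map (\<lambda>_. \<zero>\<^bsub>R\<^esub>) [0..<?n]" by (intro map_cong) (auto simp: image_subset_iff)
    also have "\<dots> = replicate (length ?Us) \<zero>\<^bsub>R\<^esub>" by (simp add: map_replicate_const)
    finally show "mv M e z t = \<zero>\<^bsub>R\<^esub>" using R.combine_replicate[OF basis_closed] v by metis
  qed
  also have "\<dots> \<longleftrightarrow> (\<forall>i\<in>set [0..<?n]. ?S i = \<zero>\<^bsub>R\<^esub>)" by (simp only: set_map) blast
  also have "\<dots> \<longleftrightarrow> sat (P_structure M) z (tr ms B ?n (PEq t))"
  proof -
    have "eval (P_structure M) z (sum_t (map (\<lambda>(q, m). times_t (toL q) (Var (cvar ms B ?n m i))) (expand t))) = ?S i" for i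
    proof -
      have "map (\<lambda>t. eval M z (old_t t)) (map (\<lambda>(q, m). times_t (toL q) (Var (cvar ms B ?n m i))) (expand t)) =
          map (\<lambda>(q, m). mv M e z q \<otimes>\<^bsub>R\<^esub> z (cvar ms B ?n m i)) (expand t)"
        using eval_toL[OF e PEq.prems(1)] l by (auto simp: rg_sel)
      then show ?thesis unfolding eval_P_structure eval_old_sum by (simp only:)
    qed
    moreover have "eval (P_structure M) z zero_t = \<zero>\<^bsub>R\<^esub>" by (simp add: P_structure_def rg_sel(5))
    ultimately show ?thesis by (simp add: sat_Conjs del: eval.simps)
  qed
  finally show ?case by simp
next
  case (PEx j \<chi>)
  have "satP M e (z(j := a)) \<chi> \<longleftrightarrow> sat (P_structure M) (z(j := a)) (tr ms B (length I) \<chi>)" if a: "a \<in> K" for a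
  proof (rule PEx.IH)
    show "range (z(j := a)) \<subseteq> K" using PEx.prems(1) a by auto
    \<comment> \<open>Bound variables lie below \<open>B\<close> and coordinate variables from
      \<open>B\<close> on, so the quantifier does not disturb the coordinates.\<close>
    have "cvar ms B (length I) m i \<noteq> j" for m i using PEx.prems(4)[of j] by (simp add: cvar_def)
    moreover have "mv M e (z(j := a)) m = mv M e z m" if "m \<in> set ms" for m
      using ms[OF that] by (intro R.mval_cong) simp
    ultimately show "has_coords e ms I B z0 (z(j := a))" using PEx.prems(2) by (simp add: has_coords_def)
  qed (use PEx.prems in auto)
  then show ?case by (simp add: P_structure_def)
qed auto

end

lemma exists_coords:
  assumes e: "range e \<subseteq> U" and ms: "\<And>m. m \<in> set ms \<Longrightarrow> pvs m = {}" "MOne \<in> set ms" and z: "range z \<subseteq> K"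
  shows "\<exists>I\<in>set (subseqs ms). I \<noteq> [] \<and> ring.independent R K (map (mv M e z) I) \<and>
    (\<exists>y. range y \<subseteq> K \<and> (\<forall>i. i \<notin> set [B..<B + length ms * length I] \<longrightarrow> y i = z i) \<and>
      has_coords e ms I B z y)"
proof -
  have ez: "range e \<subseteq> carrier R" "range z \<subseteq> carrier R" using e z KU by (auto simp: rg_sel(1))
  obtain I where I: "I \<in> set (subseqs ms)" "ring.independent R K (map (mv M e z) I)"
    "\<forall>m\<in>set ms. mv M e z m \<in> ring.Span R K (map (mv M e z) I)"
    using R.exists_basis_subseq[OF subfield_P, of ms "mv M e z"] R.mval_closed[OF ez] by blast
  let ?n = "length I" and ?Us = "map (mv M e z) I"
  have UC: "set ?Us \<subseteq> carrier R" using R.mval_closed[OF ez] by auto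
  \<comment> \<open>One is the value of a member of \<open>ms\<close>, and the empty family does not
    span it.\<close>
  have ne: "I \<noteq> []" using I(3) ms(2) by auto
  have "\<forall>m\<in>set ms. \<exists>Ks. set Ks \<subseteq> K \<and> length Ks = ?n \<and> mv M e z m = ring.combine R Ks ?Us"
    using I(3) R.Span_mem_iff_length_version[OF subfield_P UC] by simp
  then obtain c where c: "\<And>m. m \<in> set ms \<Longrightarrow> set (c m) \<subseteq> K \<and> length (c m) = ?n \<and> mv M e z m = ring.combine R (c m) ?Us"
    by metis
  define y where "y j = (if j \<in> set [B..<B + length ms * ?n] then c (ms ! ((j - B) div ?n)) ! ((j - B) mod ?n) else z j)" for j
  have "y j \<in> K" for j
  proof (cases "j \<in> set [B..<B + length ms * ?n]")
    case True
    then have "j - B < length ms * ?n" by auto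
    then have "(j - B) div ?n < length ms" using ne by (simp add: div_less_iff_less_mult)
    then have "set (c (ms ! ((j - B) div ?n))) \<subseteq> K" "length (c (ms ! ((j - B) div ?n))) = ?n" using c by simp_all
    moreover have "(j - B) mod ?n < ?n" using ne by simp
    ultimately have "c (ms ! ((j - B) div ?n)) ! ((j - B) mod ?n) \<in> K" by (metis nth_mem subsetD)
    then show ?thesis using True by (simp add: y_def)
  next
    case False
    then show ?thesis using z by (auto simp: y_def)
  qed
  then have yK: "range y \<subseteq> K" by blast
  have "map (\<lambda>i. y (cvar ms B ?n m i)) [0..<?n] = c m" if m: "m \<in> set ms" for m
  proof (rule nth_equalityI)
    fix i assume "i < length (map (\<lambda>i. y (cvar ms B ?n m i)) [0..<?n])"
    then have i: "i < ?n" by simp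
    then show "map (\<lambda>i. y (cvar ms B ?n m i)) [0..<?n] ! i = c m ! i"
      using cvar_bounds[OF m i, of B] midx[OF m] by (simp add: y_def)
  qed (simp add: c[OF m])
  moreover have "mv M e y m = mv M e z m" if "m \<in> set ms" for m using ms(1)[OF that] by (intro R.mval_cong) simp
  ultimately have "has_coords e ms I B z y" using c by (simp add: has_coords_def)
  then show ?thesis using I ne yK by (intro bexI[of _ I] conjI exI[of _ y]) (auto simp: y_def)
qed

end

section \<open>The existential quantifier over the universe\<close>

context field_pairs_typed
begin

text \<open>The basis \<open>I\<close> and the coordinates y are quantified before x. That they are
  right for x means that \<open>I\<close> is independent at x and that certain polynomials in x with
  parameters y vanish, which is the shape of \<open>ex_indep\<close>. What remains is an L-formula
  about y alone, from which x has disappeared.\<close>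

lemma pbdef_exM:
  assumes "pbdef (\<lambda>M e z. Q M e)"
  shows "pbdef (\<lambda>M e z. \<exists>a\<in>universe M. Q M (e(x := a)))"
proof -
  obtain \<chi> where \<chi>: "wfP L \<chi>" "\<And>M e z. adm M e z \<Longrightarrow> Q M e \<longleftrightarrow> satP M e z \<chi>"
    using assms unfolding pbdef_def by blast
  \<comment> \<open>\<open>MOne\<close> makes every spanning basis nonempty, as
    \<open>pbdef_ex_indep\<close> demands of \<open>I\<close>.\<close>
  define ms where "ms = MOne # mons \<chi>"
  have ms: "\<And>m. m \<in> set ms \<Longrightarrow> pvs m = {}" "MOne \<in> set ms" "set (mons \<chi>) \<subseteq> set ms"
    using pvs_mons by (auto simp: ms_def)
  obtain B where B: "\<And>i. i \<in> bvs \<chi> \<Longrightarrow> i < B"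
    using finite_bvs[of \<chi>] finite_nat_set_iff_bounded by auto
  have ext: "extends_L_rings L" using theory_fields by (simp add: theory_of_fields_def)
  \<comment> \<open>The equation for \<open>m\<close> says that the variables from
    \<open>cvar ms B (length I) m 0\<close> on are its coordinates with respect to
    \<open>I\<close>.\<close>
  define hs where "hs I = map (\<lambda>m. MAdd m (MNeg (glin (cvar ms B (length I) m 0) I))) ms" for I
  define Is where "Is = filter (\<lambda>I. I \<noteq> []) (subseqs ms)"
  have Is: "I \<noteq> [] \<and> set I \<subseteq> set ms" if "I \<in> set Is" for I
  proof -
    have "set I \<in> Pow (set ms)" using that unfolding subseqs_powset[symmetric] Is_def by auto
    then show ?thesis using that by (simp add: Is_def)
  qed
  have hsB: "i < B + length ms * length I" if I: "I \<in> set Is" and h: "h \<in> set (hs I)" "i \<in> pvs h" for I h i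
  proof -
    obtain m where m: "m \<in> set ms" "h = MAdd m (MNeg (glin (cvar ms B (length I) m 0) I))" using h(1) by (auto simp: hs_def)
    have "i \<in> {cvar ms B (length I) m 0..<cvar ms B (length I) m 0 + length I}"
    proof -
      have "pvs (glin (cvar ms B (length I) m 0) I) \<subseteq> {cvar ms B (length I) m 0..<cvar ms B (length I) m 0 + length I}"
        using Is[OF I] ms(1) by (intro pvs_glin) blast
      moreover have "i \<in> pvs (glin (cvar ms B (length I) m 0) I)" using h(2) m ms(1) by simp
      ultimately show ?thesis by blast
    qed
    then obtain k where "i = cvar ms B (length I) m k" "k < length I"
      by (auto simp: cvar_def) (metis add.commute le_Suc_ex less_add_eq_less nat_add_left_cancel_less)
    then show ?thesis using cvar_bounds[OF m(1)] by blast
  qed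
  let ?E = "\<lambda>I M e z. \<exists>a\<in>universe M. (\<forall>h\<in>set (hs I). mv M (e(x := a)) z h = \<zero>\<^bsub>rg M\<^esub>) \<and>
    ring.independent (rg M) (P_of M) (map (mv M (e(x := a)) z) I)"
  let ?S = "\<lambda>M e z. \<exists>I\<in>set Is. \<exists>y. range y \<subseteq> P_of M \<and>
    (\<forall>i. i \<notin> set [B..<B + length ms * length I] \<longrightarrow> y i = z i) \<and>
    (?E I M e y \<and> sat (P_structure M) y (tr ms B (length I) \<chi>))"
  have "pbdef ?S"
  proof (rule pbdef_bex, rule pbdef_block, rule pbdef_and)
    fix I assume I: "I \<in> set Is"
    show "pbdef (?E I)"
    proof (rule pbdef_ex_indep)
      show "I \<noteq> []" using Is[OF I] by simp
      show "pvs m = {}" if "m \<in> set I" for m using that Is[OF I] ms(1) by blast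
      show "i < B + length ms * length I" if "h \<in> set (hs I)" "i \<in> pvs h" for h i using hsB[OF I that] .
    qed
    show "pbdef (\<lambda>M e z. sat (P_structure M) z (tr ms B (length I) \<chi>))"
      by (rule pbdef_LF[OF is_fm_tr[OF ext \<chi>(1)]])
  qed
  then show ?thesis
  proof (rule pbdef_cong)
    fix M :: "('f, 'r, 'm) pair" and e z assume adm: "adm M e z"
    interpret pair_model L T M using adm_pair[OF adm] .
    have e: "range e \<subseteq> U" and z: "range z \<subseteq> K" using adm by (auto simp: adm_def)
    have ea: "range (e(x := a)) \<subseteq> U" if "a \<in> U" for a using e that by auto
    have coords_iff: "has_coords (e(x := a)) ms I B y y \<longleftrightarrow> (\<forall>h\<in>set (hs I). mv M (e(x := a)) y h = \<zero>\<^bsub>R\<^esub>)"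
      if "a \<in> U" "range y \<subseteq> K" "ring.independent R K (map (mv M (e(x := a)) y) I)" "set I \<subseteq> set ms" for a y I
    proof -
      have yR: "range y \<subseteq> carrier R" and er: "range (e(x := a)) \<subseteq> carrier R"
        using that(2) ea[OF that(1)] KU by (auto simp: rg_sel(1))
      have "map (\<lambda>i. y (cvar ms B (length I) m i)) [0..<length I] =
          map y [cvar ms B (length I) m 0..<cvar ms B (length I) m 0 + length I]" for m
        by (rule nth_equalityI) (auto simp: cvar_def)
      then have "mv M (e(x := a)) y (glin (cvar ms B (length I) m 0) I) =
          ring.combine R (map (\<lambda>i. y (cvar ms B (length I) m i)) [0..<length I]) (map (mv M (e(x := a)) y) I)" for m
        using R.mval_glin by simp
      moreover have "mv M (e(x := a)) y (MAdd s (MNeg t)) = \<zero>\<^bsub>R\<^esub> \<longleftrightarrow> mv M (e(x := a)) y s = mv M (e(x := a)) y t" for s t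
        using R.mval_closed[OF er yR] R.r_right_minus_eq by (simp add: a_minus_def[symmetric])
      ultimately show ?thesis
        by (simp add: has_coords_def hs_def del: R.mval.simps)
    qed
    show "?S M e z \<longleftrightarrow> (\<exists>a\<in>U. Q M (e(x := a)))"
    proof
      assume "?S M e z"
      then obtain I y a where I: "I \<in> set Is" and y: "range y \<subseteq> K" and a: "a \<in> U"
        and h: "\<forall>h\<in>set (hs I). mv M (e(x := a)) y h = \<zero>\<^bsub>R\<^esub>"
        and ind: "ring.independent R K (map (mv M (e(x := a)) y) I)"
        and t: "sat (P_structure M) y (tr ms B (length I) \<chi>)" by (elim bexE exE conjE)
      have "has_coords (e(x := a)) ms I B y y" using coords_iff[OF a y ind] Is[OF I] h by blast
      then have "satP M (e(x := a)) y \<chi>"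
        using sat_tr[OF ea[OF a] _ ms(1) ind y _ ms(3) B] Is[OF I] t by blast
      moreover have "adm M (e(x := a)) y" using adm y ea[OF a] by (simp add: adm_def)
      ultimately show "\<exists>a\<in>U. Q M (e(x := a))" using \<chi>(2) a by blast
    next
      assume "\<exists>a\<in>U. Q M (e(x := a))"
      then obtain a where a: "a \<in> U" "Q M (e(x := a))" by blast
      obtain I y where I: "I \<in> set (subseqs ms)" "I \<noteq> []" "ring.independent R K (map (mv M (e(x := a)) z) I)"
        and y: "range y \<subseteq> K" "\<forall>i. i \<notin> set [B..<B + length ms * length I] \<longrightarrow> y i = z i"
        and c: "has_coords (e(x := a)) ms I B z y"
        using exists_coords[OF ea[OF a(1)] ms(1,2) z, of B] by blast
      have IIs: "I \<in> set Is" using I by (simp add: Is_def)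
      have eq: "map (mv M (e(x := a)) z) I = map (mv M (e(x := a)) y) I"
      proof -
        have "mv M (e(x := a)) z m = mv M (e(x := a)) y m" if "m \<in> set I" for m
        proof -
          have "pvs m = {}" using Is[OF IIs] ms(1) that by blast
          then show ?thesis by (intro R.mval_cong) simp
        qed
        then show ?thesis by simp
      qed
      have ind: "ring.independent R K (map (mv M (e(x := a)) y) I)" using I(3) eq by simp
      have c': "has_coords (e(x := a)) ms I B y y"
        using c Is[OF IIs] unfolding has_coords_def eq by blast
      have "adm M (e(x := a)) y" using adm y ea[OF a(1)] by (simp add: adm_def)
      then have "satP M (e(x := a)) y \<chi>" using \<chi>(2) a(2) by blast
      then have "sat (P_structure M) y (tr ms B (length I) \<chi>)"
        using sat_tr[OF ea[OF a(1)] _ ms(1) ind y(1) c' ms(3) B] Is[OF IIs] by blast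
      moreover have "?E I M e y" using a(1) ind coords_iff[OF a(1) y(1) ind] Is[OF IIs] c' by blast
      ultimately show "?S M e z" using IIs y by (intro bexI[of _ I] exI[of _ y] conjI)
    qed
  qed
qed

end

section \<open>Elimination of quantifiers over the subfield\<close>

text \<open>The value for \<open>PV i\<close> is a placeholder; the translation is meant for
  monomials, in which no P-variable occurs.\<close>

primrec toF :: "mt \<Rightarrow> 'f rfun pfun tm" where
  "toF (MV x) = Var x"
| "toF (PV i) = old_t zero_t"
| "toF MZero = old_t zero_t"
| "toF MOne = old_t one_t"
| "toF (MAdd s t) = Fun (OldF (Ring RPlus)) [toF s, toF t]"
| "toF (MNeg s) = Fun (OldF (Ring RMinus)) [toF s]"
| "toF (MMul s t) = Fun (OldF (Ring RTimes)) [toF s, toF t]"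

text \<open>Turns an L-term about coordinates into a term about the model, by inserting terms that
  compute the coordinates.\<close>

primrec subst_tm :: "(nat \<Rightarrow> 'f pfun tm) \<Rightarrow> 'f tm \<Rightarrow> 'f pfun tm" where
  "subst_tm \<sigma> (Var x) = \<sigma> x"
| "subst_tm \<sigma> (Fun f ts) = Fun (OldF f) (map (subst_tm \<sigma>) ts)"

text \<open>Only meant for quantifier-free formulas.\<close>

primrec subst_fm :: "(nat \<Rightarrow> 'f pfun tm) \<Rightarrow> ('f, 'r) fm \<Rightarrow> ('f pfun, 'r prel) fm" where
  "subst_fm \<sigma> Falsum = Falsum"
| "subst_fm \<sigma> (Eq s t) = Eq (subst_tm \<sigma> s) (subst_tm \<sigma> t)"
| "subst_fm \<sigma> (Rel r ts) = Rel (OldR r) (map (subst_tm \<sigma>) ts)"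
| "subst_fm \<sigma> (Neg \<phi>) = Neg (subst_fm \<sigma> \<phi>)"
| "subst_fm \<sigma> (Conj \<phi> \<psi>) = Conj (subst_fm \<sigma> \<phi>) (subst_fm \<sigma> \<psi>)"
| "subst_fm \<sigma> (Exists x \<phi>) = Falsum"

text \<open>Substitution within one language; at the end it removes free variables that the defining
  formula has in excess.\<close>

primrec isubst_tm :: "(nat \<Rightarrow> 'f tm) \<Rightarrow> 'f tm \<Rightarrow> 'f tm" where
  "isubst_tm \<sigma> (Var x) = \<sigma> x"
| "isubst_tm \<sigma> (Fun f ts) = Fun f (map (isubst_tm \<sigma>) ts)"

primrec isubst_fm :: "(nat \<Rightarrow> 'f tm) \<Rightarrow> ('f, 'r) fm \<Rightarrow> ('f, 'r) fm" where
  "isubst_fm \<sigma> Falsum = Falsum"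
| "isubst_fm \<sigma> (Eq s t) = Eq (isubst_tm \<sigma> s) (isubst_tm \<sigma> t)"
| "isubst_fm \<sigma> (Rel r ts) = Rel r (map (isubst_tm \<sigma>) ts)"
| "isubst_fm \<sigma> (Neg \<phi>) = Neg (isubst_fm \<sigma> \<phi>)"
| "isubst_fm \<sigma> (Conj \<phi> \<psi>) = Conj (isubst_fm \<sigma> \<phi>) (isubst_fm \<sigma> \<psi>)"
| "isubst_fm \<sigma> (Exists x \<phi>) = Falsum"

lemma eval_isubst: "eval M e (isubst_tm \<sigma> t) = eval M (\<lambda>x. eval M e (\<sigma> x)) t"
  by (induction t) (auto intro!: arg_cong[of _ _ "fint M _"])

lemma sat_isubst:
  assumes "qfree \<phi>"
  shows "sat M e (isubst_fm \<sigma> \<phi>) \<longleftrightarrow> sat M (\<lambda>x. eval M e (\<sigma> x)) \<phi>"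
  using assms by (induction \<phi>) (auto simp: eval_isubst comp_def)

lemma isubst_props:
  assumes "\<And>x. is_tm L (\<sigma> x)" "qfree \<phi>" "is_fm L \<phi>" "\<And>x. fv_tm (\<sigma> x) \<subseteq> V"
  shows "is_fm L (isubst_fm \<sigma> \<phi>)" "qfree (isubst_fm \<sigma> \<phi>)" "fv (isubst_fm \<sigma> \<phi>) \<subseteq> V"
proof -
  have tm: "is_tm L t \<Longrightarrow> is_tm L (isubst_tm \<sigma> t)" for t
    using assms(1) by (induction t) (auto simp: list_all_iff)
  have v: "fv_tm (isubst_tm \<sigma> t) \<subseteq> V" for t
    using assms(4) by (induction t) auto
  show "is_fm L (isubst_fm \<sigma> \<phi>)" using assms(2,3) by (induction \<phi>) (auto simp: tm list_all_iff)
  show "qfree (isubst_fm \<sigma> \<phi>)" using assms(2) by (induction \<phi>) auto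
  show "fv (isubst_fm \<sigma> \<phi>) \<subseteq> V" using assms(2) v by (induction \<phi>) auto
qed

lemma is_tm_old: "f \<in> funs L \<Longrightarrow> OldF f \<in> funs (L_f L) \<and> farity (L_f L) (OldF f) = farity L f"
  by (simp add: L_f_def L_ld_def L_P_def)

lemma is_tm_toF: "extends_L_rings L \<Longrightarrow> is_tm (L_f L) (toF t)"
  by (induction t) (auto simp: extends_L_rings_def is_tm_old)

lemma subst_fm_props:
  assumes "\<And>x. is_tm (L_f L) (\<sigma> x)" "qfree \<phi>" "is_fm L \<phi>"
  shows "is_fm (L_f L) (subst_fm \<sigma> \<phi>)" "qfree (subst_fm \<sigma> \<phi>)"
proof -
  have tm: "is_tm L t \<Longrightarrow> is_tm (L_f L) (subst_tm \<sigma> t)" for t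
    using assms(1) by (induction t) (auto simp: list_all_iff is_tm_old)
  have rel: "r \<in> rels L \<Longrightarrow> OldR r \<in> rels (L_f L) \<and> rarity (L_f L) (OldR r) = rarity L r" for r
    by (simp add: L_f_def L_ld_def L_P_def)
  show "is_fm (L_f L) (subst_fm \<sigma> \<phi>)" using assms(2,3)
    by (induction \<phi>) (auto simp: tm list_all_iff rel)
  show "qfree (subst_fm \<sigma> \<phi>)" using assms(2) by (induction \<phi>) auto
qed

lemma sat_subst_fm:
  assumes "qfree \<phi>"
  shows "sat M e (subst_fm \<sigma> \<phi>) \<longleftrightarrow> sat (P_structure M) (\<lambda>x. eval M e (\<sigma> x)) \<phi>"
proof -
  have tm: "eval M e (subst_tm \<sigma> t) = eval (P_structure M) (\<lambda>x. eval M e (\<sigma> x)) t" for t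
    by (induction t) (auto simp: P_structure_def intro!: arg_cong[of _ _ "fint M _"])
  show ?thesis using assms by (induction \<phi>) (auto simp: tm comp_def P_structure_def)
qed

definition Disjs :: "('f, 'r) fm list \<Rightarrow> ('f, 'r) fm"
  where "Disjs \<phi>s = Neg (Conjs (map Neg \<phi>s))"

lemma Disjs_props:
  "sat M e (Disjs \<phi>s) \<longleftrightarrow> (\<exists>\<phi>\<in>set \<phi>s. sat M e \<phi>)"
  "is_fm L (Disjs \<phi>s) \<longleftrightarrow> (\<forall>\<phi>\<in>set \<phi>s. is_fm L \<phi>)"
  "qfree (Disjs \<phi>s) \<longleftrightarrow> (\<forall>\<phi>\<in>set \<phi>s. qfree \<phi>)"
  by (simp_all add: Disjs_def sat_Conjs is_fm_Conjs qfree_Conjs)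

context pair_model
begin

lemma eval_toF:
  assumes ez: "range e \<subseteq> U" "range z \<subseteq> K" and "pvs t = {}"
  shows "eval M e (toF t) = mv M e z t"
  using assms(3)
proof (induction t)
  case (MNeg s)
  have "mv M e z s \<in> U"
    using R.mval_closed[of e z s] ez KU by (auto simp: rg_sel(1))
  then show ?case using MNeg minus_eq_a_inv by simp
qed (auto simp: rg_sel)

text \<open>The symbols \<open>LinInd\<close> express spanning through dependence of the extended
  family. \<open>independent\<close> adds vectors in front and the axioms add them at the end, hence
  the comparison of lists with equal sets.\<close>

lemma span_iff_dependent:
  assumes as: "as \<noteq> []" "set as \<subseteq> U" and b: "b \<in> U" and ind: "ring.independent R K as"
  shows "b \<in> ring.Span R K as \<longleftrightarrow> \<not> ring.independent R K (as @ [b])"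
proof
  have asC: "set as \<subseteq> carrier R" and bC: "b \<in> carrier R" using as b by (auto simp: rg_sel(1))
  have same: "ring.independent R K (b # as) \<longleftrightarrow> ring.independent R K (as @ [b])"
    using R.independent_same_set[OF subfield_P, of "b # as" "as @ [b]"]
      R.independent_same_set[OF subfield_P, of "as @ [b]" "b # as"] by auto
  show "\<not> ring.independent R K (as @ [b])" if "b \<in> ring.Span R K as"
    using that same R.independent_backwards(1) by blast
  show "b \<in> ring.Span R K as" if "\<not> ring.independent R K (as @ [b])"
    using that same ind bC R.independent.li_Cons by blast
qed

end

context field_pairs_typed
begin

text \<open>\<open>entails\<close> speaks of a single universe type;
  \<open>entails_all_models\<close> carries the equivalence over to P inside a model over the type
  at hand.\<close>

lemma qe_P_structure:
  assumes "is_fm L \<phi>"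
  obtains \<psi> where "is_fm L \<psi>" "qfree \<psi>"
    "\<And>M z. is_model L T (P_structure (M :: ('f, 'r, 'm) pair)) \<Longrightarrow> range z \<subseteq> P_of M \<Longrightarrow>
      sat (P_structure M) z \<phi> \<longleftrightarrow> sat (P_structure M) z \<psi>"
proof -
  obtain \<psi> where \<psi>: "is_fm L \<psi>" "qfree \<psi>" "entails L T (Iff \<phi> \<psi>)"
    using qe assms unfolding has_qe_def by blast
  have "sat (P_structure M) z \<phi> \<longleftrightarrow> sat (P_structure M) z \<psi>"
    if "is_model L T (P_structure M)" "range z \<subseteq> P_of M" for M :: "('f, 'r, 'm) pair" and z
  proof -
    have "\<forall>\<theta>\<in>T. is_fm L \<theta>" using theory_fields by (auto simp: theory_of_fields_def is_theory_def)
    moreover have "is_fm L (Iff \<phi> \<psi>)" using assms \<psi>(1) by simp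
    ultimately have "valid (P_structure M) (Iff \<phi> \<psi>)" using entails_all_models[OF \<psi>(3) _ _ that(1)] by blast
    then show ?thesis using that(2) by (auto simp: valid_def P_structure_def)
  qed
  with \<psi> show thesis using that by blast
qed

lemma pbdef_imp_qfree:
  assumes "pbdef (\<lambda>M e z. Q M e)"
  shows "\<exists>\<psi>. is_fm (L_f L) \<psi> \<and> qfree \<psi> \<and>
    (\<forall>M e. is_model (L_f L) (ACF_T_f L T) M \<longrightarrow> range e \<subseteq> universe M \<longrightarrow> (Q M e \<longleftrightarrow> sat M e \<psi>))"
proof -
  obtain \<chi> where \<chi>: "wfP L \<chi>" "\<And>M e z. adm M e z \<Longrightarrow> Q M e \<longleftrightarrow> satP M e z \<chi>"
    using assms unfolding pbdef_def by blast
  \<comment> \<open>\<open>MOne\<close> makes the basis nonempty, so that \<open>LinInd\<close>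
    applies to it; its index starts at 1.\<close>
  define ms where "ms = MOne # mons \<chi>"
  have ms: "\<And>m. m \<in> set ms \<Longrightarrow> pvs m = {}" "MOne \<in> set ms" "set (mons \<chi>) \<subseteq> set ms"
    using pvs_mons by (auto simp: ms_def)
  obtain B where B: "\<And>i. i \<in> bvs \<chi> \<Longrightarrow> i < B"
    using finite_bvs[of \<chi>] finite_nat_set_iff_bounded by auto
  have ext: "extends_L_rings L" using theory_fields by (simp add: theory_of_fields_def)
  have "\<exists>\<psi>. is_fm L \<psi> \<and> qfree \<psi> \<and> (\<forall>(M :: ('f, 'r, 'm) pair) z. is_model L T (P_structure M) \<longrightarrow> range z \<subseteq> P_of M \<longrightarrow>
      (sat (P_structure M) z (tr ms B n \<chi>) \<longleftrightarrow> sat (P_structure M) z \<psi>))" for n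
    by (rule qe_P_structure[OF is_fm_tr[OF ext \<chi>(1)]]) blast
  then obtain \<Phi> where \<Phi>: "\<And>n. is_fm L (\<Phi> n)" "\<And>n. qfree (\<Phi> n)"
    "\<And>n (M :: ('f, 'r, 'm) pair) z. is_model L T (P_structure M) \<Longrightarrow> range z \<subseteq> P_of M \<Longrightarrow>
      sat (P_structure M) z (tr ms B n \<chi>) \<longleftrightarrow> sat (P_structure M) z (\<Phi> n)" by metis
  \<comment> \<open>Decodes a variable: index \<open>cvar\<close> yields the \<open>Coord\<close>
    term for its monomial and basis position. All other variables become zero, so that every
    variable takes a value in P.\<close>
  define \<sigma> :: "mt list \<Rightarrow> nat \<Rightarrow> 'f rfun pfun tm" where
    "\<sigma> I j = (if I \<noteq> [] \<and> B \<le> j \<and> (j - B) div length I < length ms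
      then Fun (Coord (length I) ((j - B) mod length I)) (toF (ms ! ((j - B) div length I)) # map toF I)
      else old_t zero_t)" for I j
  \<comment> \<open>Independent, and dependent after adding any member of \<open>ms\<close>, where a
    member of \<open>I\<close> itself counts as well.\<close>
  define basis :: "mt list \<Rightarrow> ('f rfun pfun, 'r prel) fm" where
    "basis I = Conj (Rel (LinInd (length I)) (map toF I))
      (Conjs (map (\<lambda>m. Neg (Rel (LinInd (length I + 1)) (map toF I @ [toF m]))) ms))" for I
  define Is where "Is = filter (\<lambda>I. I \<noteq> []) (subseqs ms)"
  have Is: "I \<noteq> [] \<and> set I \<subseteq> set ms" if "I \<in> set Is" for I
  proof -
    have "set I \<in> Pow (set ms)" using that unfolding subseqs_powset[symmetric] Is_def by auto
    then show ?thesis using that by (simp add: Is_def)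
  qed
  define \<psi> where "\<psi> = Disjs (map (\<lambda>I. Conj (basis I) (subst_fm (\<sigma> I) (\<Phi> (length I)))) Is)"
  have \<sigma>tm: "is_tm (L_f L) (\<sigma> I j)" for I j
  proof -
    have "is_tm (L_f L) (old_t zero_t)" using ext by (auto simp: extends_L_rings_def is_tm_old)
    moreover have "Coord n i \<in> funs (L_f L) \<and> farity (L_f L) (Coord n i) = n + 1" if "i < n" for n i
      using that by (auto simp: L_f_def L_ld_def L_P_def)
    ultimately show ?thesis unfolding \<sigma>_def using is_tm_toF[OF ext] by (auto simp: list_all_iff)
  qed
  have basis: "is_fm (L_f L) (basis I)" "qfree (basis I)" if "I \<in> set Is" for I
  proof -
    have lin: "LinInd n \<in> rels (L_f L) \<and> rarity (L_f L) (LinInd n) = n" if "n \<ge> 1" for n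
      using that by (auto simp: L_f_def L_ld_def L_P_def)
    have "length I \<ge> 1" using Is[OF that] by (cases I) auto
    then show "is_fm (L_f L) (basis I)"
      using lin[of "length I"] lin[of "length I + 1"] is_tm_toF[OF ext]
      by (auto simp: basis_def is_fm_Conjs list_all_iff)
    show "qfree (basis I)" by (auto simp: basis_def qfree_Conjs)
  qed
  have "is_fm (L_f L) \<psi> \<and> qfree \<psi>"
    using basis subst_fm_props[OF \<sigma>tm \<Phi>(2,1)] by (auto simp: \<psi>_def Disjs_props)
  moreover have "Q M e \<longleftrightarrow> sat M e \<psi>"
    if M: "is_model (L_f L) (ACF_T_f L T) M" and e: "range e \<subseteq> universe M" for M :: "('f, 'r, 'm) pair" and e
  proof -
    interpret pair_model L T M
      unfolding pair_model_def pair_model_axioms_def using field_pairs_axioms M by blast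
    \<comment> \<open>The monomials contain no P-variables, so any assignment in P gives them the
      same values.\<close>
    define z0 :: "nat \<Rightarrow> 'm" where "z0 = (\<lambda>_. \<zero>\<^bsub>R\<^esub>)"
    have z0: "range z0 \<subseteq> K" using R.subring_props(2)[OF subfield_P] by (auto simp: z0_def)
    have ez: "range e \<subseteq> carrier R" "range z0 \<subseteq> carrier R" using e z0 KU by (auto simp: rg_sel(1))
    have mU: "mv M e z0 m \<in> U" for m using R.mval_closed[OF ez] by (simp add: rg_sel(1))
    have toFI: "map (eval M e) (map toF I) = map (mv M e z0) I" if "set I \<subseteq> set ms" for I
      using eval_toF[OF e z0] ms(1) that by auto
    have basis_iff: "sat M e (basis I) \<longleftrightarrow> ring.independent R K (map (mv M e z0) I) \<and>
        (\<forall>m\<in>set ms. mv M e z0 m \<in> ring.Span R K (map (mv M e z0) I))" if I: "I \<in> set Is" for I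
    proof -
      let ?Us = "map (mv M e z0) I"
      have UsU: "set ?Us \<subseteq> U" using mU by auto
      have len: "length ?Us \<ge> 1" using Is[OF I] by (cases I) auto
      have tF: "eval M e (toF m) = mv M e z0 m" if "m \<in> set ms" for m using eval_toF[OF e z0] ms(1)[OF that] .
      have "sat M e (basis I) \<longleftrightarrow> rint M (LinInd (length ?Us)) ?Us \<and>
          (\<forall>m\<in>set ms. \<not> rint M (LinInd (length (?Us @ [mv M e z0 m]))) (?Us @ [mv M e z0 m]))"
        using toFI[of I] Is[OF I] tF by (simp add: basis_def sat_Conjs del: map_map)
      also have "\<dots> \<longleftrightarrow> ring.independent R K ?Us \<and> (\<forall>m\<in>set ms. \<not> ring.independent R K (?Us @ [mv M e z0 m]))"
        using LinInd_iff[OF len UsU] LinInd_iff[of "?Us @ [mv M e z0 _]"] UsU mU by simp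
      also have "\<dots> \<longleftrightarrow> ring.independent R K ?Us \<and> (\<forall>m\<in>set ms. mv M e z0 m \<in> ring.Span R K ?Us)"
        using span_iff_dependent[of ?Us] Is[OF I] UsU mU by (metis list.map_disc_iff)
      finally show ?thesis .
    qed
    have main: "sat M e (subst_fm (\<sigma> I) (\<Phi> (length I))) \<longleftrightarrow> Q M e" if I: "I \<in> set Is" and bI: "sat M e (basis I)" for I
    proof -
      let ?n = "length I"
      let ?Us = "map (mv M e z0) I"
      let ?y = "\<lambda>j. eval M e (\<sigma> I j)"
      have UsU: "set ?Us \<subseteq> U" using mU by auto
      have ind: "ring.independent R K ?Us" using basis_iff[OF I] bI by blast
      have n: "?n \<ge> 1" using Is[OF I] by (cases I) auto
      have tF: "eval M e (toF m) = mv M e z0 m" if "m \<in> set ms" for m using eval_toF[OF e z0] ms(1)[OF that] .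
      have dep: "rint M (LinInd ?n) ?Us \<and> \<not> rint M (LinInd (?n + 1)) (?Us @ [mv M e z0 m])" if "m \<in> set ms" for m
        using bI toFI[of I] Is[OF I] tF that by (simp add: basis_def sat_Conjs del: map_map)
      \<comment> \<open>\<open>coord\<close> yields a tuple for each index separately; uniqueness
        makes it one tuple for all indices.\<close>
      have unique: "ys = ys'" if "set ys \<subseteq> K" "length ys = ?n" "set ys' \<subseteq> K" "length ys' = ?n"
        "ring.combine R ys ?Us = ring.combine R ys' ?Us" for ys ys'
      proof -
        have "ring.combine R ys ?Us \<in> ring.Span R K ?Us"
          using R.Span_mem_iff_length_version[OF subfield_P R.independent_in_carrier[OF ind]] that by auto
        from R.unique_decomposition[OF subfield_P ind this] that show ?thesis by (metis length_map)
      qed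
      have co: "\<exists>ys. length ys = ?n \<and> set ys \<subseteq> K \<and> mv M e z0 m = ring.combine R ys ?Us \<and>
          (\<forall>i<?n. fint M (Coord ?n i) (mv M e z0 m # ?Us) = ys ! i)" if m: "m \<in> set ms" for m
      proof -
        have "\<exists>ys. length ys = ?n \<and> set ys \<subseteq> K \<and> mv M e z0 m = ring.combine R ys ?Us \<and>
            fint M (Coord ?n i) (mv M e z0 m # ?Us) = ys ! i" if "i < ?n" for i
          using coord(1)[OF that _ UsU mU] dep[OF m] by simp
        then obtain ys where ys: "\<And>i. i < ?n \<Longrightarrow> length (ys i) = ?n \<and> set (ys i) \<subseteq> K \<and>
            mv M e z0 m = ring.combine R (ys i) ?Us \<and> fint M (Coord ?n i) (mv M e z0 m # ?Us) = ys i ! i" by metis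
        have npos: "0 < ?n" using n by linarith
        have "ys i = ys 0" if "i < ?n" for i using ys[OF that] ys[OF npos] by (intro unique) auto
        then show ?thesis using ys ys[OF npos] by (intro exI[of _ "ys 0"]) auto
      qed
      have ycv: "?y (cvar ms B ?n m i) = fint M (Coord ?n i) (mv M e z0 m # ?Us)" if m: "m \<in> set ms" "i < ?n" for m i
      proof -
        have "\<sigma> I (cvar ms B ?n m i) = Fun (Coord ?n i) (toF m # map toF I)"
          using cvar_bounds[OF m, of B] midx[OF m(1)] n by (auto simp: \<sigma>_def)
        then show ?thesis using tF[OF m(1)] toFI[of I] Is[OF I] by (simp del: map_map)
      qed
      have yK: "range ?y \<subseteq> K"
      proof -
        have "?y j \<in> K" for j
        proof (cases "I \<noteq> [] \<and> B \<le> j \<and> (j - B) div ?n < length ms")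
          case True
          let ?m = "ms ! ((j - B) div ?n)"
          have m: "?m \<in> set ms" using True by simp
          have i: "(j - B) mod ?n < ?n" using n by (intro mod_less_divisor) linarith
          have "?y j = fint M (Coord ?n ((j - B) mod ?n)) (mv M e z0 ?m # ?Us)"
            using True tF[OF m] toFI[of I] Is[OF I] by (simp add: \<sigma>_def del: map_map)
          then show ?thesis using co[OF m] i by (metis nth_mem subsetD)
        next
          case False
          then have "?y j = \<zero>\<^bsub>R\<^esub>" by (auto simp: \<sigma>_def rg_sel(5))
          then show ?thesis using R.subring_props(2)[OF subfield_P] by simp
        qed
        then show ?thesis by blast
      qed
      have eq: "mv M e ?y m = mv M e z0 m" if "m \<in> set ms" for m using ms(1)[OF that] by (intro R.mval_cong) simp
      have "has_coords e ms I B z0 ?y"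
        unfolding has_coords_def
      proof
        fix m assume m: "m \<in> set ms"
        obtain ys where ys: "length ys = ?n" "set ys \<subseteq> K" "mv M e z0 m = ring.combine R ys ?Us"
          "\<forall>i<?n. fint M (Coord ?n i) (mv M e z0 m # ?Us) = ys ! i" using co[OF m] by blast
        have "map (\<lambda>i. ?y (cvar ms B ?n m i)) [0..<?n] = ys"
          using ycv[OF m] ys(1,4) by (intro nth_equalityI) auto
        then show "mv M e ?y m = ring.combine R (map (\<lambda>i. ?y (cvar ms B ?n m i)) [0..<?n]) ?Us"
          using ys(3) eq[OF m] by simp
      qed
      then have "satP M e ?y \<chi> \<longleftrightarrow> sat (P_structure M) ?y (tr ms B ?n \<chi>)"
        using sat_tr[OF e _ ms(1) ind yK _ ms(3) B] Is[OF I] by blast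
      moreover have "adm M e ?y" using M e yK by (simp add: adm_def)
      ultimately show ?thesis using \<chi>(2) \<Phi>(3)[OF P_model yK] sat_subst_fm[OF \<Phi>(2)] by blast
    qed
    have "\<exists>I\<in>set Is. sat M e (basis I)"
    proof -
      obtain I where I: "I \<in> set (subseqs ms)" "ring.independent R K (map (mv M e z0) I)"
        "\<forall>m\<in>set ms. mv M e z0 m \<in> ring.Span R K (map (mv M e z0) I)"
        using R.exists_basis_subseq[OF subfield_P, of ms "mv M e z0"] R.mval_closed[OF ez] by blast
      have "I \<noteq> []" using I(3) ms(2) by auto
      then have "I \<in> set Is" using I(1) by (simp add: Is_def)
      then show ?thesis using basis_iff I by blast
    qed
    then show ?thesis using main by (auto simp: \<psi>_def Disjs_props)
  qed
  ultimately show ?thesis by blast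
qed

section \<open>Definable relations without P-variables\<close>

definition mdef :: "(('f, 'r, 'm) pair \<Rightarrow> (nat \<Rightarrow> 'm) \<Rightarrow> bool) \<Rightarrow> bool"
  where "mdef Q \<longleftrightarrow> pbdef (\<lambda>M e z. Q M e)"

lemma mdef_cong:
  assumes "mdef Q" "\<And>M e. pair_model L T M \<Longrightarrow> range e \<subseteq> universe M \<Longrightarrow> Q M e \<longleftrightarrow> S M e"
  shows "mdef S"
  unfolding mdef_def
  by (rule pbdef_cong[OF assms(1)[unfolded mdef_def]]) (use assms(2) adm_pair in \<open>auto simp: adm_def\<close>)

lemma mdef_not: "mdef Q \<Longrightarrow> mdef (\<lambda>M e. \<not> Q M e)"
  unfolding mdef_def by (rule pbdef_not)

lemma mdef_and: "mdef Q \<Longrightarrow> mdef S \<Longrightarrow> mdef (\<lambda>M e. Q M e \<and> S M e)"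
  unfolding mdef_def by (rule pbdef_and)

lemma mdef_or: "mdef Q \<Longrightarrow> mdef S \<Longrightarrow> mdef (\<lambda>M e. Q M e \<or> S M e)"
  unfolding mdef_def by (rule pbdef_or)

lemma mdef_ball: "(\<And>x. x \<in> set xs \<Longrightarrow> mdef (Q x)) \<Longrightarrow> mdef (\<lambda>M e. \<forall>x\<in>set xs. Q x M e)"
  unfolding mdef_def by (rule pbdef_ball)

lemma mdef_ex: "mdef Q \<Longrightarrow> mdef (\<lambda>M e. \<exists>a\<in>universe M. Q M (e(x := a)))"
  unfolding mdef_def by (rule pbdef_exM)

lemma mdef_block:
  assumes "mdef Q"
  shows "mdef (\<lambda>M e. \<exists>d. range d \<subseteq> universe M \<and> (\<forall>i. i \<notin> set is \<longrightarrow> d i = e i) \<and> Q M d)"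
proof (induction "is")
  case Nil
  have "Q M e \<longleftrightarrow> (\<exists>d. range d \<subseteq> universe M \<and> (\<forall>i. d i = e i) \<and> Q M d)"
    if "range e \<subseteq> universe M" for M e
  proof -
    have "d = e" if "\<forall>i. d i = e i" for d using that by auto
    then show ?thesis using that by auto
  qed
  then show ?case using mdef_cong[OF assms] by auto
next
  case (Cons j "is")
  show ?case
  proof (rule mdef_cong[OF mdef_ex[OF Cons, of j]])
    fix M e
    show "(\<exists>a\<in>universe M. \<exists>d. range d \<subseteq> universe M \<and> (\<forall>i. i \<notin> set is \<longrightarrow> d i = (e(j := a)) i) \<and> Q M d) \<longleftrightarrow>
      (\<exists>d. range d \<subseteq> universe M \<and> (\<forall>i. i \<notin> set (j # is) \<longrightarrow> d i = e i) \<and> Q M d)" (is "?A \<longleftrightarrow> ?B")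
    proof
      assume ?A
      then obtain a d where "range d \<subseteq> universe M" "\<forall>i. i \<notin> set is \<longrightarrow> d i = (e(j := a)) i" "Q M d"
        by blast
      then show ?B by (intro exI[of _ d]) auto
    next
      assume ?B
      then obtain d where "range d \<subseteq> universe M" "\<forall>i. i \<notin> set (j # is) \<longrightarrow> d i = e i" "Q M d" by blast
      then show ?A by (intro bexI[of _ "d j"] exI[of _ d]) auto
    qed
  qed
qed

end

section \<open>Definability of formulas\<close>

context field_pairs_typed
begin

lemma ext_L: "extends_L_rings L"
  using theory_fields by (simp add: theory_of_fields_def)

lemma mdef_eq: "pvs t = {} \<Longrightarrow> mdef (\<lambda>M e. mv M e (\<lambda>_. \<zero>\<^bsub>rg M\<^esub>) t = \<zero>\<^bsub>rg M\<^esub>)"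
  unfolding mdef_def
proof (rule pbdef_cong[OF pbdef_eq[of t]])
  fix M :: "('f, 'r, 'm) pair" and e z assume p: "pvs t = {}" and a: "adm M e z"
  interpret pair_model L T M using adm_pair[OF a] .
  show "mv M e z t = \<zero>\<^bsub>R\<^esub> \<longleftrightarrow> mv M e (\<lambda>_. \<zero>\<^bsub>R\<^esub>) t = \<zero>\<^bsub>R\<^esub>"
    using p R.mval_cong[of t z "\<lambda>_. \<zero>\<^bsub>R\<^esub>"] by simp
qed

lemma mdef_diff: "pvs s = {} \<Longrightarrow> pvs t = {} \<Longrightarrow>
    mdef (\<lambda>M e. mv M e (\<lambda>_. \<zero>\<^bsub>rg M\<^esub>) s = mv M e (\<lambda>_. \<zero>\<^bsub>rg M\<^esub>) t)"
proof (rule mdef_cong[OF mdef_eq[of "MAdd s (MNeg t)"]])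
  fix M :: "('f, 'r, 'm) pair" and e :: "nat \<Rightarrow> 'm" assume "pair_model L T M" and e: "range e \<subseteq> universe M"
  then interpret pair_model L T M by simp
  have eC: "range e \<subseteq> carrier R" using e by (simp add: rg_sel(1))
  have "mv M e (\<lambda>_. \<zero>\<^bsub>R\<^esub>) t \<in> carrier R" for t by (rule R.mval_closed[OF eC]) auto
  then show "mv M e (\<lambda>_. \<zero>\<^bsub>R\<^esub>) (MAdd s (MNeg t)) = \<zero>\<^bsub>R\<^esub> \<longleftrightarrow>
      mv M e (\<lambda>_. \<zero>\<^bsub>R\<^esub>) s = mv M e (\<lambda>_. \<zero>\<^bsub>R\<^esub>) t"
    using R.r_right_minus_eq by (simp add: a_minus_def[symmetric])
qed simp

text \<open>Assignments in P are traded for the list of their first n values, the form in which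
  linear algebra states its witnesses; the second hypothesis says that only these values matter to
  \<open>S\<close>.\<close>

lemma mdef_P_block:
  assumes "pbdef S"
    and "\<And>M e z y. pair_model L T M \<Longrightarrow> range e \<subseteq> universe M \<Longrightarrow> range z \<subseteq> P_of M \<Longrightarrow> range y \<subseteq> P_of M \<Longrightarrow>
      (\<And>i. i < n \<Longrightarrow> z i = y i) \<Longrightarrow> S M e z \<Longrightarrow> S M e y"
  shows "mdef (\<lambda>M e. \<exists>ws. length ws = n \<and> set ws \<subseteq> P_of M \<and> S M e (list_assign \<zero>\<^bsub>rg M\<^esub> ws))"
  unfolding mdef_def
proof (rule pbdef_cong[OF pbdef_block[OF assms(1), of "[0..<n]"]])
  fix M :: "('f, 'r, 'm) pair" and e z assume a: "adm M e z"
  interpret pair_model L T M using adm_pair[OF a] .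
  have e: "range e \<subseteq> U" and z: "range z \<subseteq> K" using a by (auto simp: adm_def)
  have rl: "range (list_assign \<zero>\<^bsub>R\<^esub> ws) \<subseteq> K" if "set ws \<subseteq> K" for ws
    using that R.subring_props(2)[OF subfield_P] by (auto simp: list_assign_def)
  show "(\<exists>y. range y \<subseteq> K \<and> (\<forall>i. i \<notin> set [0..<n] \<longrightarrow> y i = z i) \<and> S M e y) \<longleftrightarrow>
    (\<exists>ws. length ws = n \<and> set ws \<subseteq> K \<and> S M e (list_assign \<zero>\<^bsub>R\<^esub> ws))" (is "?A \<longleftrightarrow> ?B")
  proof
    assume ?A
    then obtain y where y: "range y \<subseteq> K" "S M e y" by blast
    have s: "set (map y [0..<n]) \<subseteq> K" using y(1) by auto
    have "S M e (list_assign \<zero>\<^bsub>R\<^esub> (map y [0..<n]))"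
      using assms(2)[OF pair_model_axioms e y(1) rl[OF s] _ y(2)] by (simp add: list_assign_def)
    then show ?B using s by (intro exI[of _ "map y [0..<n]"]) simp
  next
    assume ?B
    then obtain ws where ws: "length ws = n" "set ws \<subseteq> K" "S M e (list_assign \<zero>\<^bsub>R\<^esub> ws)" by blast
    define y where "y i = (if i < n then ws ! i else z i)" for i
    have yK: "range y \<subseteq> K" using ws(1,2) z by (auto simp: y_def)
    have "S M e y"
      using assms(2)[OF pair_model_axioms e rl[OF ws(2)] yK _ ws(3)] ws(1) by (simp add: list_assign_def y_def)
    then show ?A using yK by (intro exI[of _ y]) (auto simp: y_def)
  qed
qed

lemma mdef_indep: "mdef (\<lambda>M e. ring.independent (rg M) (P_of M) (map e xs))"
proof -
  let ?n = "length xs" and ?ms = "map MV xs"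
  let ?S = "\<lambda>M e z. mv M e z (glin 0 ?ms) = \<zero>\<^bsub>rg M\<^esub> \<and> (\<exists>i\<in>set [0..<?n]. mv M e z (PV i) \<noteq> \<zero>\<^bsub>rg M\<^esub>)"
  have S: "pbdef ?S" by (rule pbdef_and[OF pbdef_eq pbdef_bex[OF pbdef_not[OF pbdef_eq]]])
  have "mdef (\<lambda>M e. \<exists>ws. length ws = ?n \<and> set ws \<subseteq> P_of M \<and> ?S M e (list_assign \<zero>\<^bsub>rg M\<^esub> ws))"
  proof (rule mdef_P_block[OF S])
    fix M :: "('f, 'r, 'm) pair" and e z y :: "nat \<Rightarrow> 'm"
    assume "pair_model L T M" and zy: "\<And>i. i < ?n \<Longrightarrow> z i = y i" and S: "?S M e z"
    then interpret pair_model L T M by simp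
    have "i < ?n" if "i \<in> pvs (glin 0 ?ms)" for i using pvs_glin[of ?ms 0] that by force
    then have "mv M e z (glin 0 ?ms) = mv M e y (glin 0 ?ms)" using zy by (intro R.mval_cong) blast
    then show "?S M e y" using S zy by auto
  qed
  from mdef_not[OF this] show ?thesis
  proof (rule mdef_cong)
    fix M :: "('f, 'r, 'm) pair" and e :: "nat \<Rightarrow> 'm" assume "pair_model L T M" and e: "range e \<subseteq> universe M"
    then interpret pair_model L T M by simp
    have la: "map (list_assign \<zero>\<^bsub>R\<^esub> ws) [0..<?n] = ws" if "length ws = ?n" for ws
      using that by (intro nth_equalityI) (auto simp: list_assign_def)
    have C: "set (map e xs) \<subseteq> carrier R" using e by (auto simp: rg_sel(1))
    have "mv M e z (glin 0 ?ms) = ring.combine R (map z [0..<?n]) (map e xs)" for z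
      using R.mval_glin[of e z 0 ?ms] by (simp add: comp_def)
    moreover have "(\<exists>i\<in>set [0..<?n]. mv M e z (PV i) \<noteq> \<zero>\<^bsub>R\<^esub>) \<longleftrightarrow> \<not> set (map z [0..<?n]) \<subseteq> {\<zero>\<^bsub>R\<^esub>}" for z
      by (auto simp: image_subset_iff)
    ultimately have "?S M e (list_assign \<zero>\<^bsub>R\<^esub> ws) \<longleftrightarrow> ring.combine R ws (map e xs) = \<zero>\<^bsub>R\<^esub> \<and> \<not> set ws \<subseteq> {\<zero>\<^bsub>R\<^esub>}"
      if "length ws = ?n" for ws
      by (simp only: la[OF that])
    then show "(\<not> (\<exists>ws. length ws = ?n \<and> set ws \<subseteq> K \<and> ?S M e (list_assign \<zero>\<^bsub>R\<^esub> ws))) \<longleftrightarrow>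
        ring.independent R K (map e xs)"
      unfolding R.independent_iff_combine[OF subfield_P C] by (metis (no_types, lifting) length_map)
  qed
qed

text \<open>The proper case of the graph of a \<open>Coord\<close> symbol, with the coordinates as
  P-variables and the chosen one read off by an equation.\<close>

lemma mdef_combine:
  assumes "i < length xs"
  shows "mdef (\<lambda>M e. \<exists>ws. length ws = length xs \<and> set ws \<subseteq> P_of M \<and>
    e b = ring.combine (rg M) ws (map e xs) \<and> e y = ws ! i)"
proof -
  let ?n = "length xs" and ?ms = "map MV xs"
  let ?S = "\<lambda>M e z. mv M e z (MAdd (MV b) (MNeg (glin 0 ?ms))) = \<zero>\<^bsub>rg M\<^esub> \<and> mv M e z (MAdd (MV y) (MNeg (PV i))) = \<zero>\<^bsub>rg M\<^esub>"
  have S: "pbdef ?S" by (rule pbdef_and[OF pbdef_eq pbdef_eq])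
  have "mdef (\<lambda>M e. \<exists>ws. length ws = ?n \<and> set ws \<subseteq> P_of M \<and> ?S M e (list_assign \<zero>\<^bsub>rg M\<^esub> ws))"
  proof (rule mdef_P_block[OF S])
    fix M :: "('f, 'r, 'm) pair" and e z y' :: "nat \<Rightarrow> 'm"
    assume "pair_model L T M" and zy: "\<And>i. i < ?n \<Longrightarrow> z i = y' i" and S: "?S M e z"
    then interpret pair_model L T M by simp
    have "i < ?n" if "i \<in> pvs (glin 0 ?ms)" for i using pvs_glin[of ?ms 0] that by force
    then have "mv M e z (glin 0 ?ms) = mv M e y' (glin 0 ?ms)" using zy by (intro R.mval_cong) blast
    then show "?S M e y'" using S zy[OF assms] by simp
  qed
  then show ?thesis
  proof (rule mdef_cong)
    fix M :: "('f, 'r, 'm) pair" and e :: "nat \<Rightarrow> 'm" assume "pair_model L T M" and e: "range e \<subseteq> universe M"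
    then interpret pair_model L T M by simp
    have la: "map (list_assign \<zero>\<^bsub>R\<^esub> ws) [0..<?n] = ws" if "length ws = ?n" for ws
      using that by (intro nth_equalityI) (auto simp: list_assign_def)
    have eC: "e j \<in> carrier R" for j using e by (auto simp: rg_sel(1))
    have sub: "s \<oplus>\<^bsub>R\<^esub> \<ominus>\<^bsub>R\<^esub> t = \<zero>\<^bsub>R\<^esub> \<longleftrightarrow> s = t" if "s \<in> carrier R" "t \<in> carrier R" for s t
      using R.r_right_minus_eq[OF that] by (simp add: a_minus_def)
    have KC: "K \<subseteq> carrier R" using KU by (simp add: rg_sel(1))
    have "?S M e (list_assign \<zero>\<^bsub>R\<^esub> ws) \<longleftrightarrow> e b = ring.combine R ws (map e xs) \<and> e y = ws ! i"
      if ws: "length ws = ?n" "set ws \<subseteq> K" for ws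
    proof -
      have g: "mv M e (list_assign \<zero>\<^bsub>R\<^esub> ws) (glin 0 ?ms) = ring.combine R ws (map e xs)"
        using R.mval_glin[of e "list_assign \<zero>\<^bsub>R\<^esub> ws" 0 ?ms] la[OF ws(1)] by (simp add: comp_def)
      have "set ws \<subseteq> carrier R" using ws(2) KC by blast
      then have c: "ring.combine R ws (map e xs) \<in> carrier R" using eC by (intro R.combine_in_carrier) auto
      have i: "list_assign \<zero>\<^bsub>R\<^esub> ws i = ws ! i" using assms ws(1) by (simp add: list_assign_def)
      have "ws ! i \<in> set ws" using assms ws(1) by simp
      then have "ws ! i \<in> carrier R" using \<open>set ws \<subseteq> carrier R\<close> by blast
      then show ?thesis using sub[OF eC c] sub[OF eC] g i by simp
    qed
    then show "(\<exists>ws. length ws = ?n \<and> set ws \<subseteq> K \<and> ?S M e (list_assign \<zero>\<^bsub>R\<^esub> ws)) \<longleftrightarrow>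
      (\<exists>ws. length ws = ?n \<and> set ws \<subseteq> K \<and> e b = ring.combine R ws (map e xs) \<and> e y = ws ! i)"
      by blast
  qed
qed

text \<open>Equations force P-variable i to equal \<open>e (xs ! i)\<close>. This puts the elements
  into P and at the same time lets an L-formula speak about them.\<close>

lemma mdef_L_formula:
  assumes \<phi>: "is_fm L \<phi>" "\<And>i. i \<in> fv \<phi> \<Longrightarrow> i < length xs"
  shows "mdef (\<lambda>M e. e ` set xs \<subseteq> P_of M \<and> sat (P_structure M) (list_assign \<zero>\<^bsub>rg M\<^esub> (map e xs)) \<phi>)"
proof -
  let ?n = "length xs"
  let ?S = "\<lambda>M e z. (\<forall>i\<in>set [0..<?n]. mv M e z (MAdd (MV (xs ! i)) (MNeg (PV i))) = \<zero>\<^bsub>rg M\<^esub>) \<and> sat (P_structure M) z \<phi>"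
  have S: "pbdef ?S" by (rule pbdef_and[OF pbdef_ball[OF pbdef_eq] pbdef_LF[OF \<phi>(1)]])
  have "mdef (\<lambda>M e. \<exists>ws. length ws = ?n \<and> set ws \<subseteq> P_of M \<and> ?S M e (list_assign \<zero>\<^bsub>rg M\<^esub> ws))"
  proof (rule mdef_P_block[OF S])
    fix M :: "('f, 'r, 'm) pair" and e z y :: "nat \<Rightarrow> 'm"
    assume "pair_model L T M" and zy: "\<And>i. i < ?n \<Longrightarrow> z i = y i" and S: "?S M e z"
    then interpret pair_model L T M by simp
    have "sat (P_structure M) z \<phi> \<longleftrightarrow> sat (P_structure M) y \<phi>" using zy \<phi>(2) by (intro sat_cong) blast
    then show "?S M e y" using S zy by auto
  qed
  then show ?thesis
  proof (rule mdef_cong)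
    fix M :: "('f, 'r, 'm) pair" and e :: "nat \<Rightarrow> 'm" assume "pair_model L T M" and e: "range e \<subseteq> universe M"
    then interpret pair_model L T M by simp
    have eC: "e j \<in> carrier R" for j using e by (auto simp: rg_sel(1))
    have sub: "s \<oplus>\<^bsub>R\<^esub> \<ominus>\<^bsub>R\<^esub> t = \<zero>\<^bsub>R\<^esub> \<longleftrightarrow> s = t" if "s \<in> carrier R" "t \<in> carrier R" for s t
      using R.r_right_minus_eq[OF that] by (simp add: a_minus_def)
    have KC: "K \<subseteq> carrier R" using KU by (simp add: rg_sel(1))
    have "?S M e (list_assign \<zero>\<^bsub>R\<^esub> ws) \<longleftrightarrow> ws = map e xs \<and> sat (P_structure M) (list_assign \<zero>\<^bsub>R\<^esub> ws) \<phi>"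
      if ws: "length ws = ?n" "set ws \<subseteq> K" for ws
    proof -
      have "mv M e (list_assign \<zero>\<^bsub>R\<^esub> ws) (MAdd (MV (xs ! i)) (MNeg (PV i))) = \<zero>\<^bsub>R\<^esub> \<longleftrightarrow> ws ! i = e (xs ! i)" if i: "i < ?n" for i
      proof -
        have "ws ! i \<in> set ws" using ws(1) i by simp
        then have "ws ! i \<in> carrier R" using ws(2) KC by blast
        then show ?thesis using sub[OF eC] ws(1) i by (auto simp: list_assign_def)
      qed
      then have "(\<forall>i\<in>set [0..<?n]. mv M e (list_assign \<zero>\<^bsub>R\<^esub> ws) (MAdd (MV (xs ! i)) (MNeg (PV i))) = \<zero>\<^bsub>R\<^esub>) \<longleftrightarrow>
          (\<forall>i<?n. ws ! i = map e xs ! i)" by auto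
      also have "\<dots> \<longleftrightarrow> ws = map e xs" using ws(1) by (auto intro: nth_equalityI)
      finally show ?thesis by simp
    qed
    then have "(\<exists>ws. length ws = ?n \<and> set ws \<subseteq> K \<and> ?S M e (list_assign \<zero>\<^bsub>R\<^esub> ws)) \<longleftrightarrow>
        (\<exists>ws. length ws = ?n \<and> set ws \<subseteq> K \<and> ws = map e xs \<and> sat (P_structure M) (list_assign \<zero>\<^bsub>R\<^esub> ws) \<phi>)"
      by blast
    then show "(\<exists>ws. length ws = ?n \<and> set ws \<subseteq> K \<and> ?S M e (list_assign \<zero>\<^bsub>R\<^esub> ws)) \<longleftrightarrow>
      e ` set xs \<subseteq> K \<and> sat (P_structure M) (list_assign \<zero>\<^bsub>R\<^esub> (map e xs)) \<phi>"
      by auto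
  qed
qed

lemma mdef_in_P: "mdef (\<lambda>M e. e ` set xs \<subseteq> P_of M)"
  using mdef_L_formula[of "Neg Falsum" xs] by simp

lemma mdef_rel:
  assumes r: "r \<in> rels (L_f L)" and len: "length xs = rarity (L_f L) r"
  shows "mdef (\<lambda>M e. rint M r (map e xs))"
proof (cases r)
  case (OldR s)
  then have s: "s \<in> rels L" "length xs = rarity L s" using r len by (auto simp: L_f_def L_ld_def L_P_def)
  let ?\<phi> = "Rel s (map Var [0..<length xs]) :: ('f rfun, 'r) fm"
  have f: "is_fm L ?\<phi>" using s by (auto simp: list_all_iff)
  have "mdef (\<lambda>M e. e ` set xs \<subseteq> P_of M \<and> sat (P_structure M) (list_assign \<zero>\<^bsub>rg M\<^esub> (map e xs)) ?\<phi>)"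
    by (rule mdef_L_formula[OF f]) auto
  then show ?thesis
  proof (rule mdef_cong)
    fix M :: "('f, 'r, 'm) pair" and e :: "nat \<Rightarrow> 'm" assume "pair_model L T M" and e: "range e \<subseteq> universe M"
    then interpret pair_model L T M by simp
    have "map (list_assign \<zero>\<^bsub>R\<^esub> (map e xs)) [0..<length xs] = map e xs"
      by (intro nth_equalityI) (auto simp: list_assign_def)
    then have "sat (P_structure M) (list_assign \<zero>\<^bsub>R\<^esub> (map e xs)) ?\<phi> \<longleftrightarrow> rint M r (map e xs)"
      by (simp add: P_structure_def OldR comp_def)
    moreover have "\<not> rint M r (map e xs)" if "\<not> e ` set xs \<subseteq> K"
      unfolding OldR by (rule rel_in_P) (use that s e in auto)
    ultimately show "(e ` set xs \<subseteq> K \<and> sat (P_structure M) (list_assign \<zero>\<^bsub>R\<^esub> (map e xs)) ?\<phi>) \<longleftrightarrow> rint M r (map e xs)"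
      by blast
  qed
next
  case InP
  then obtain x where x: "xs = [x]" using len by (auto simp: L_f_def L_ld_def L_P_def length_Suc_conv)
  show ?thesis by (rule mdef_cong[OF mdef_in_P[of xs]]) (auto simp: x InP P_of_def)
next
  case (LinInd n)
  then have n: "n \<ge> 1" "length xs = n" using r len by (auto simp: L_f_def L_ld_def L_P_def)
  show ?thesis
  proof (rule mdef_cong[OF mdef_indep[of xs]])
    fix M :: "('f, 'r, 'm) pair" and e :: "nat \<Rightarrow> 'm" assume "pair_model L T M" and e: "range e \<subseteq> universe M"
    then interpret pair_model L T M by simp
    show "ring.independent R K (map e xs) \<longleftrightarrow> rint M r (map e xs)"
      using LinInd_iff[of "map e xs"] n e LinInd by auto
  qed
qed

text \<open>Outside their proper domain the \<open>Extra\<close> and \<open>Coord\<close> symbols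
  take the value zero, so their graphs are disjunctions of a proper and a default case; ring symbols
  give polynomial equations.\<close>

lemma mdef_fun:
  assumes f: "f \<in> funs (L_f L)" and len: "length xs = farity (L_f L) f"
  shows "mdef (\<lambda>M e. e y = fint M f (map e xs))"
proof (cases f)
  case (OldF g)
  then have g: "g \<in> funs L" "length xs = farity L g" using f len by (auto simp: L_f_def L_ld_def L_P_def)
  show ?thesis
  proof (cases g)
    case (Ring c)
    have lc: "length xs = ring_arity c" using g Ring ext_L by (simp add: extends_L_rings_def)
    have "\<exists>t. pvs t = {} \<and> (\<forall>M e. pair_model L T (M :: ('f, 'r, 'm) pair) \<longrightarrow> range e \<subseteq> universe M \<longrightarrow>
      fint M f (map e xs) = mv M e (\<lambda>_. \<zero>\<^bsub>rg M\<^esub>) t)"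
    proof (cases c)
      case RZero
      then show ?thesis using lc Ring OldF by (intro exI[of _ MZero]) (auto simp: rg_sel(5)[symmetric] ring.mval.simps pair_model.field_rg field.is_ring)
    next
      case ROne
      then show ?thesis using lc Ring OldF by (intro exI[of _ MOne]) (auto simp: rg_sel(4)[symmetric] ring.mval.simps pair_model.field_rg field.is_ring)
    next
      case RPlus
      then obtain a b where xs: "xs = [a, b]" using lc by (auto simp: length_Suc_conv numeral_2_eq_2)
      show ?thesis using RPlus Ring OldF xs
        by (intro exI[of _ "MAdd (MV a) (MV b)"]) (auto simp: rg_sel(3)[symmetric] ring.mval.simps pair_model.field_rg field.is_ring)
    next
      case RTimes
      then obtain a b where xs: "xs = [a, b]" using lc by (auto simp: length_Suc_conv numeral_2_eq_2)
      show ?thesis using RTimes Ring OldF xs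
        by (intro exI[of _ "MMul (MV a) (MV b)"]) (auto simp: rg_sel(2)[symmetric] ring.mval.simps pair_model.field_rg field.is_ring)
    next
      case RMinus
      then obtain a where xs: "xs = [a]" using lc by (auto simp: length_Suc_conv)
      show ?thesis
      proof (intro exI[of _ "MNeg (MV a)"] conjI allI impI)
        fix M :: "('f, 'r, 'm) pair" and e :: "nat \<Rightarrow> 'm" assume "pair_model L T M" and e: "range e \<subseteq> universe M"
        then interpret pair_model L T M by simp
        show "fint M f (map e xs) = mv M e (\<lambda>_. \<zero>\<^bsub>R\<^esub>) (MNeg (MV a))"
          using minus_eq_a_inv[of "e a"] e RMinus Ring OldF xs by auto
      qed simp
    qed
    then obtain t where t: "pvs t = {}" "\<And>(M :: ('f, 'r, 'm) pair) e. pair_model L T M \<Longrightarrow> range e \<subseteq> universe M \<Longrightarrow>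
      fint M f (map e xs) = mv M e (\<lambda>_. \<zero>\<^bsub>rg M\<^esub>) t" by blast
    have y: "pvs (MV y) = {}" by simp
    show ?thesis
    proof (rule mdef_cong[OF mdef_diff[OF y t(1)]])
      fix M :: "('f, 'r, 'm) pair" and e :: "nat \<Rightarrow> 'm" assume M: "pair_model L T M" and e: "range e \<subseteq> universe M"
      then interpret pair_model L T M by simp
      show "mv M e (\<lambda>_. \<zero>\<^bsub>R\<^esub>) (MV y) = mv M e (\<lambda>_. \<zero>\<^bsub>R\<^esub>) t \<longleftrightarrow> e y = fint M f (map e xs)"
        using t(2)[OF M e] by simp
    qed
  next
    case (Extra h)
    let ?n = "length xs"
    let ?\<phi> = "Eq (Var ?n) (Fun g (map Var [0..<?n])) :: ('f rfun, 'r) fm"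
    have fm: "is_fm L ?\<phi>" using g by (auto simp: list_all_iff)
    have "mdef (\<lambda>M e. e ` set (xs @ [y]) \<subseteq> P_of M \<and> sat (P_structure M) (list_assign \<zero>\<^bsub>rg M\<^esub> (map e (xs @ [y]))) ?\<phi>)"
      by (rule mdef_L_formula[OF fm]) auto
    moreover have "mdef (\<lambda>M e. mv M e (\<lambda>_. \<zero>\<^bsub>rg M\<^esub>) (MV y) = \<zero>\<^bsub>rg M\<^esub>)" by (rule mdef_eq) simp
    ultimately have "mdef (\<lambda>M e. e ` set (xs @ [y]) \<subseteq> P_of M \<and> sat (P_structure M) (list_assign \<zero>\<^bsub>rg M\<^esub> (map e (xs @ [y]))) ?\<phi> \<or>
      \<not> e ` set xs \<subseteq> P_of M \<and> mv M e (\<lambda>_. \<zero>\<^bsub>rg M\<^esub>) (MV y) = \<zero>\<^bsub>rg M\<^esub>)"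
      by (intro mdef_or mdef_and[OF mdef_not[OF mdef_in_P]])
    then show ?thesis
    proof (rule mdef_cong)
      fix M :: "('f, 'r, 'm) pair" and e :: "nat \<Rightarrow> 'm" assume M: "pair_model L T M" and e: "range e \<subseteq> universe M"
      then interpret pair_model L T M by simp
      let ?l = "list_assign \<zero>\<^bsub>R\<^esub> (map e (xs @ [y]))"
      have l: "map ?l [0..<?n] = map e xs" "?l ?n = e y"
        by (auto intro!: nth_equalityI simp: list_assign_def nth_append)
      have "sat (P_structure M) ?l ?\<phi> \<longleftrightarrow> e y = fint M f (map e xs)"
        using l by (simp add: P_structure_def OldF comp_def)
      moreover have "set (map e xs) \<subseteq> U" using e by auto
      then have "e ` set xs \<subseteq> K \<Longrightarrow> fint M f (map e xs) \<in> K"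
        and "\<not> e ` set xs \<subseteq> K \<Longrightarrow> fint M f (map e xs) = \<zero>\<^bsub>R\<^esub>"
        using extra_fun[of h "map e xs"] g unfolding OldF Extra by simp_all
      ultimately show "(e ` set (xs @ [y]) \<subseteq> K \<and> sat (P_structure M) ?l ?\<phi> \<or>
          \<not> e ` set xs \<subseteq> K \<and> mv M e (\<lambda>_. \<zero>\<^bsub>R\<^esub>) (MV y) = \<zero>\<^bsub>R\<^esub>) \<longleftrightarrow> e y = fint M f (map e xs)"
        by (cases "e ` set xs \<subseteq> K") auto
    qed
  qed
next
  case (Coord n i)
  then have i: "i < n" using f by (auto simp: L_f_def L_ld_def L_P_def)
  have "length xs = Suc n" using len Coord by (simp add: L_f_def L_ld_def L_P_def)
  then obtain b vs where xs: "xs = b # vs" "length vs = n" by (auto simp: length_Suc_conv)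
  let ?dep = "\<lambda>M e. ring.independent (rg M) (P_of M) (map e vs) \<and> \<not> ring.independent (rg M) (P_of M) (map e (vs @ [b]))"
  have "mdef ?dep" by (rule mdef_and[OF mdef_indep mdef_not[OF mdef_indep]])
  moreover have "mdef (\<lambda>M e. mv M e (\<lambda>_. \<zero>\<^bsub>rg M\<^esub>) (MV y) = \<zero>\<^bsub>rg M\<^esub>)" by (rule mdef_eq) simp
  ultimately have "mdef (\<lambda>M e. ?dep M e \<and> (\<exists>ws. length ws = length vs \<and> set ws \<subseteq> P_of M \<and>
    e b = ring.combine (rg M) ws (map e vs) \<and> e y = ws ! i) \<or> \<not> ?dep M e \<and> mv M e (\<lambda>_. \<zero>\<^bsub>rg M\<^esub>) (MV y) = \<zero>\<^bsub>rg M\<^esub>)"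
    using i xs(2) by (intro mdef_or mdef_and[OF _ mdef_combine] mdef_and[OF mdef_not]) auto
  then show ?thesis
  proof (rule mdef_cong)
    fix M :: "('f, 'r, 'm) pair" and e :: "nat \<Rightarrow> 'm" assume M: "pair_model L T M" and e: "range e \<subseteq> universe M"
    then interpret pair_model L T M by simp
    let ?Us = "map e vs"
    have U: "set ?Us \<subseteq> U" "e b \<in> U" using e by auto
    have dep: "?dep M e \<longleftrightarrow> rint M (LinInd n) ?Us \<and> \<not> rint M (LinInd (n + 1)) (?Us @ [e b])"
      using LinInd_iff[of ?Us] LinInd_iff[of "?Us @ [e b]"] U i xs(2) by simp
    have fx: "fint M f (map e xs) = fint M (Coord n i) (e b # ?Us)" by (simp add: xs Coord)
    show "(?dep M e \<and> (\<exists>ws. length ws = length vs \<and> set ws \<subseteq> K \<and> e b = ring.combine R ws (map e vs) \<and> e y = ws ! i) \<or>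
      \<not> ?dep M e \<and> mv M e (\<lambda>_. \<zero>\<^bsub>R\<^esub>) (MV y) = \<zero>\<^bsub>R\<^esub>) \<longleftrightarrow> e y = fint M f (map e xs)"
    proof (cases "?dep M e")
      case True
      then obtain ys where ys: "length ys = n" "set ys \<subseteq> K" "e b = ring.combine R ys ?Us"
        "fint M (Coord n i) (e b # ?Us) = ys ! i"
        using coord(1)[OF i _ U] xs(2) dep by auto
      have ind: "ring.independent R K ?Us" using True by blast
      have "ws = ys" if "length ws = length vs" "set ws \<subseteq> K" "e b = ring.combine R ws ?Us" for ws
      proof -
        have "e b \<in> ring.Span R K ?Us"
          using R.Span_mem_iff_length_version[OF subfield_P R.independent_in_carrier[OF ind]] that by auto
        from R.unique_decomposition[OF subfield_P ind this] show ?thesis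
          using that ys xs(2) by (metis length_map)
      qed
      then show ?thesis using True ys fx xs(2) by metis
    next
      case False
      then have nd: "\<not> (rint M (LinInd n) ?Us \<and> \<not> rint M (LinInd (n + 1)) (?Us @ [e b]))" using dep by blast
      have "fint M (Coord n i) (e b # ?Us) = \<zero>\<^bsub>R\<^esub>" by (rule coord(2)[OF i _ U nd]) (simp add: xs(2))
      then show ?thesis using False fx by auto
    qed
  qed
qed

text \<open>Nested terms are unfolded by existential quantifiers, with fresh variables from
  \<open>N\<close> on for the values of the arguments. This works because definability is already
  closed under quantifiers over the universe.\<close>

lemma mdef_flatten:
  assumes ts: "\<And>t. t \<in> set ts \<Longrightarrow> is_tm (L_f L) t"
    and graph: "\<And>t x. t \<in> set ts \<Longrightarrow> mdef (\<lambda>M e. e x = eval M e t)"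
    and Q: "\<And>xs. length xs = length ts \<Longrightarrow> mdef (\<lambda>M e. Q M (e y) (map e xs))"
  shows "mdef (\<lambda>M e. Q M (e y) (map (eval M e) ts))"
proof -
  have "finite (insert y (\<Union> (fv_tm ` set ts)))" using finite_fv_tm by blast
  then obtain N where N: "\<And>x. x \<in> insert y (\<Union> (fv_tm ` set ts)) \<Longrightarrow> x < N"
    unfolding finite_nat_set_iff_bounded by blast
  let ?xs = "[N..<N + length ts]"
  have "mdef (\<lambda>M d. (\<forall>i\<in>set [0..<length ts]. d (N + i) = eval M d (ts ! i)) \<and> Q M (d y) (map d ?xs))"
    by (intro mdef_and mdef_ball graph Q) auto
  from mdef_block[OF this, of ?xs] show ?thesis
  proof (rule mdef_cong)
    fix M :: "('f, 'r, 'm) pair" and e :: "nat \<Rightarrow> 'm" assume "pair_model L T M" and e: "range e \<subseteq> universe M"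
    then interpret pair_model L T M by simp
    have ev: "eval M d (ts ! i) = eval M e (ts ! i)"
      if "\<And>j. j \<notin> set ?xs \<Longrightarrow> d j = e j" "i < length ts" for d i
    proof (rule eval_cong)
      fix x assume "x \<in> fv_tm (ts ! i)"
      then have "x < N" using that(2) by (intro N) auto
      then show "d x = e x" using that(1) by auto
    qed
    have dy: "d y = e y" if "\<And>j. j \<notin> set ?xs \<Longrightarrow> d j = e j" for d
      using that[of y] N[of y] by auto
    show "(\<exists>d. range d \<subseteq> U \<and> (\<forall>i. i \<notin> set ?xs \<longrightarrow> d i = e i) \<and>
        (\<forall>i\<in>set [0..<length ts]. d (N + i) = eval M d (ts ! i)) \<and> Q M (d y) (map d ?xs)) \<longleftrightarrow>
      Q M (e y) (map (eval M e) ts)" (is "?A \<longleftrightarrow> ?B")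
    proof
      assume ?A
      then obtain d where d: "\<And>i. i \<notin> set ?xs \<Longrightarrow> d i = e i"
        "\<forall>i\<in>set [0..<length ts]. d (N + i) = eval M d (ts ! i)" "Q M (d y) (map d ?xs)" by blast
      have "map d ?xs = map (eval M e) ts" using d(2) ev[OF d(1)] by (intro nth_equalityI) auto
      then show ?B using d(3) dy[OF d(1)] by simp
    next
      assume B: ?B
      define d where "d j = (if j \<in> set ?xs then eval M e (ts ! (j - N)) else e j)" for j
      have agree: "\<And>j. j \<notin> set ?xs \<Longrightarrow> d j = e j" by (auto simp: d_def)
      have "range d \<subseteq> U"
      proof -
        have "d j \<in> U" for j
        proof (cases "j \<in> set ?xs")
          case True
          then have "ts ! (j - N) \<in> set ts" by auto
          then show ?thesis using eval_closed[OF ts e] True by (simp add: d_def)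
        qed (use e in \<open>auto simp: d_def\<close>)
        then show ?thesis by blast
      qed
      moreover have "\<forall>i\<in>set [0..<length ts]. d (N + i) = eval M d (ts ! i)"
      proof
        fix i assume "i \<in> set [0..<length ts]"
        then have i: "i < length ts" by simp
        then have "d (N + i) = eval M e (ts ! i)" by (simp add: d_def)
        then show "d (N + i) = eval M d (ts ! i)" using ev[OF agree i] by simp
      qed
      moreover have "map d ?xs = map (eval M e) ts" by (intro nth_equalityI) (auto simp: d_def)
      ultimately show ?A using agree dy[OF agree] B by (intro exI[of _ d]) auto
    qed
  qed
qed

lemma mdef_term: "is_tm (L_f L) t \<Longrightarrow> mdef (\<lambda>M e. e y = eval M e t)"
proof (induction t arbitrary: y)
  case (Var x)
  have p: "pvs (MV y) = {}" "pvs (MV x) = {}" by simp_all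
  show ?case
  proof (rule mdef_cong[OF mdef_diff[OF p]])
    fix M :: "('f, 'r, 'm) pair" and e :: "nat \<Rightarrow> 'm" assume "pair_model L T M" and e: "range e \<subseteq> universe M"
    then interpret pair_model L T M by simp
    show "mv M e (\<lambda>_. \<zero>\<^bsub>R\<^esub>) (MV y) = mv M e (\<lambda>_. \<zero>\<^bsub>R\<^esub>) (MV x) \<longleftrightarrow> e y = eval M e (Var x)" by simp
  qed
next
  case (Fun f ts)
  have tms: "is_tm (L_f L) t" if "t \<in> set ts" for t using Fun.prems that by (auto simp: list_all_iff)
  have "mdef (\<lambda>M e. e y = fint M f (map (eval M e) ts))"
    by (rule mdef_flatten[OF tms Fun.IH mdef_fun]) (use Fun.prems tms in auto)
  then show ?case by simp
qed

lemma mdef_sat: "is_fm (L_f L) \<phi> \<Longrightarrow> mdef (\<lambda>M e. sat M e \<phi>)"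
proof (induction \<phi>)
  case Falsum
  show ?case using pbdef_False by (simp add: mdef_def)
next
  case (Eq s t)
  let ?Q = "\<lambda>(M :: ('f, 'r, 'm) pair) vs. vs ! 0 = vs ! 1"
  have "mdef (\<lambda>M e. ?Q M (map (eval M e) [s, t]))"
  proof (rule mdef_flatten[where Q = "\<lambda>M _. ?Q M", OF _ mdef_term])
    fix xs :: "nat list" assume "length xs = length [s, t]"
    then obtain a b where xs: "xs = [a, b]" by (auto simp: length_Suc_conv)
    show "mdef (\<lambda>M e. map e xs ! 0 = map e xs ! 1)" using mdef_term[of "Var b" a] by (simp add: xs)
  qed (use Eq in auto)
  then show ?case by simp
next
  case (Rel r ts)
  have "mdef (\<lambda>M e. rint M r (map (eval M e) ts))"
    by (rule mdef_flatten[where Q = "\<lambda>M _. rint M r", OF _ mdef_term mdef_rel])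
      (use Rel in \<open>auto simp: list_all_iff\<close>)
  then show ?case by simp
next
  case (Neg \<phi>)
  then show ?case using mdef_not by simp
next
  case (Conj \<phi> \<psi>)
  then show ?case using mdef_and by simp
next
  case (Exists x \<phi>)
  then show ?case using mdef_ex[of "\<lambda>M e. sat M e \<phi>" x] by simp
qed

end

theorem theorem4p3:
  fixes L :: "('f rfun, 'r) language" and T :: "('f rfun, 'r) fm set"
  assumes "theory_of_fields L T"
    and "has_qe L T"
  shows "has_qe (L_f L) (ACF_T_f L T)"
  unfolding has_qe_def
proof (intro allI impI)
  fix \<phi> :: "('f rfun pfun, 'r prel) fm" assume \<phi>: "is_fm (L_f L) \<phi>"
  \<comment> \<open>The universe type is the one over which \<open>entails\<close> for the language
    \<open>L_f L\<close> quantifies.\<close>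
  interpret field_pairs_typed L T "TYPE(('f rfun pfun, 'r prel) fm)"
    using assms by unfold_locales
  obtain \<psi> where \<psi>: "is_fm (L_f L) \<psi>" "qfree \<psi>"
    "\<And>(M :: ('f rfun pfun, 'r prel, ('f rfun pfun, 'r prel) fm) fo_structure) e.
      is_model (L_f L) (ACF_T_f L T) M \<Longrightarrow> range e \<subseteq> universe M \<Longrightarrow> sat M e \<phi> \<longleftrightarrow> sat M e \<psi>"
    using pbdef_imp_qfree[OF mdef_sat[OF \<phi>, unfolded mdef_def]] by blast
  \<comment> \<open>\<psi> may contain variables foreign to \<phi>. The constant zero takes their
    place, which is sound because the truth of \<phi> does not depend on their values.\<close>
  define \<sigma> :: "nat \<Rightarrow> 'f rfun pfun tm" where "\<sigma> x = (if x \<in> fv \<phi> then Var x else old_t zero_t)" for x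
  have \<sigma>: "\<And>x. is_tm (L_f L) (\<sigma> x)" "\<And>x. fv_tm (\<sigma> x) \<subseteq> fv \<phi>"
    using ext_L by (auto simp: \<sigma>_def extends_L_rings_def is_tm_old)
  note p = isubst_props[OF \<sigma>(1) \<psi>(2,1) \<sigma>(2)]
  have "entails (L_f L) (ACF_T_f L T) (Iff \<phi> (isubst_fm \<sigma> \<psi>))"
    unfolding entails_def valid_def
  proof (intro allI impI)
    fix M :: "('f rfun pfun, 'r prel, ('f rfun pfun, 'r prel) fm) fo_structure" and e :: "nat \<Rightarrow> ('f rfun pfun, 'r prel) fm"
    assume M: "is_model (L_f L) (ACF_T_f L T) M" and e: "range e \<subseteq> universe M"
    interpret pair_model L T M
      unfolding pair_model_def pair_model_axioms_def using field_pairs_axioms M by blast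
    let ?d = "\<lambda>x. eval M e (\<sigma> x)"
    have d: "range ?d \<subseteq> universe M" using e ring_closed(1) by (auto simp: \<sigma>_def)
    have "sat M e \<phi> \<longleftrightarrow> sat M ?d \<phi>" by (rule sat_cong) (simp add: \<sigma>_def)
    also have "\<dots> \<longleftrightarrow> sat M e (isubst_fm \<sigma> \<psi>)" using \<psi>(3)[OF M d] sat_isubst[OF \<psi>(2)] by blast
    finally show "sat M e (Iff \<phi> (isubst_fm \<sigma> \<psi>))" by simp
  qed
  then show "\<exists>\<psi>. is_fm (L_f L) \<psi> \<and> qfree \<psi> \<and> fv \<psi> \<subseteq> fv \<phi> \<and> entails (L_f L) (ACF_T_f L T) (Iff \<phi> \<psi>)"
    by (intro exI[of _ "isubst_fm \<sigma> \<psi>"] conjI p)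
qed

end
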